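(* Let $\mathcal B$ be a topos. The category $\mathsf{Clsn}(\mathcal B)$ of classifications and infomorphisms internal to $\mathcal B$ is equivalent to the category $\mathsf{Clg}(\mathcal B)$ of conceptual structures and concept morphisms internal to $\mathcal B$: \[\mathsf{Clsn}(\mathcal B)\equiv\mathsf{Clg}(\mathcal B),\] the equivalence being given by the concept lattice functor (polar factorization of the derivation adjunction) and the classification functor (composition of extent reflection and intent coreflection).
   Context: Work in a topos $\mathcal B$ with power objects $\wp X$ ordered by inclusion. For $f:X\to Y$, $\exists f:\wp X\to\wp Y$ (direct image) is left adjoint to $f^{-1}:\wp Y\to\wp X$; set $\mathsf{dir}(f)=\langle\exists f,f^{-1}\rangle:\wp X\rightleftharpoons\wp Y$ and $\mathsf{inv}(f)=\langle f^{-1},\exists f\rangle:(\wp Y)^{\mathrm{op}}\rightleftharpoons(\wp X)^{\mathrm{op}}$. An order adjunction $\mathbf g=\langle\check{\mathbf g},\hat{\mathbf g}\rangle:\mathbf P\rightleftharpoons\mathbf Q$ between internal preorders has left adjoint $\check{\mathbf g}:\mathbf P\to\mathbf Q$ and right adjoint $\hat{\mathbf g}:\mathbf Q\to\mathbf P$ with $1\le\hat{\mathbf g}\circ\check{\mathbf g}$, $\check{\mathbf g}\circ\hat{\mathbf g}\le1$; composites ("$\mathbf g$ then $\mathbf h$") are $\langle\check{\mathbf h}\circ\check{\mathbf g},\hat{\mathbf g}\circ\hat{\mathbf h}\rangle$. A reflection has $\check{\mathbf g}\circ\hat{\mathbf g}=1_Q$; a coreflection has $\hat{\mathbf g}\circ\check{\mathbf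 g}=1_P$. A classification $\mathbf A$ consists of objects $\mathsf{inst}(\mathbf A)$, $\mathsf{typ}(\mathbf A)$ and a relation $\models_{\mathbf A}\subseteq\mathsf{inst}(\mathbf A)\times\mathsf{typ}(\mathbf A)$. An infomorphism $\mathbf f:\mathbf A\rightleftharpoons\mathbf B$ is a pair of morphisms $\mathsf{inst}(\mathbf f):\mathsf{inst}(\mathbf B)\to\mathsf{inst}(\mathbf A)$, $\mathsf{typ}(\mathbf f):\mathsf{typ}(\mathbf A)\to\mathsf{typ}(\mathbf B)$ such that, internally, $\mathsf{inst}(\mathbf f)(x)\models_{\mathbf A}y$ iff $x\models_{\mathbf B}\mathsf{typ}(\mathbf f)(y)$ (i.e. the pullbacks of the two relations to $\mathsf{inst}(\mathbf B)\times\mathsf{typ}(\mathbf A)$ coincide). $\mathsf{Clsn}(\mathcal B)$ has classifications as objects and infomorphisms as morphisms, composed componentwise. Each classification has a derivation adjunction $\wp\,\mathsf{inst}(\mathbf A)\rightleftharpoons(\wp\,\mathsf{typ}(\mathbf A))^{\mathrm{op}}$ sending an extent to the types held by all its instances and an intent to the instances having all its types. A conceptual structure $\mathbf L$ consists of an internal preorder $\mathbf L=\langle L,\le_{\mathbf L}\rangle$, objects $\mathsf{inst}(\mathbf L)$, $\mathsf{typ}(\mathbf L)$, an extent reflection $\mathsf{extent}_{\mathbf L}:\wp\,\mathsf{inst}(\mathbf L)\rightleftharpoons\mathbf L$ and an intent coreflection $\mathsf{intent}_{\mathbf L}:\mathbf L\rightleftharpoons(\wp\,\mathsf{typ}(\mathbf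 L))^{\mathrm{op}}$. A concept morphism $\mathbf h:\mathbf L_1\rightleftharpoons\mathbf L_2$ consists of an adjunction $\mathsf{adj}(\mathbf h):\mathbf L_2\rightleftharpoons\mathbf L_1$, a morphism $\mathsf{inst}(\mathbf h):\mathsf{inst}(\mathbf L_2)\to\mathsf{inst}(\mathbf L_1)$ and a morphism $\mathsf{typ}(\mathbf h):\mathsf{typ}(\mathbf L_1)\to\mathsf{typ}(\mathbf L_2)$ satisfying the extent condition ($\mathsf{extent}_{\mathbf L_2}$ then $\mathsf{adj}(\mathbf h)$) $=$ ($\mathsf{dir}(\mathsf{inst}(\mathbf h))$ then $\mathsf{extent}_{\mathbf L_1}$) and the intent condition ($\mathsf{adj}(\mathbf h)$ then $\mathsf{intent}_{\mathbf L_1}$) $=$ ($\mathsf{intent}_{\mathbf L_2}$ then $\mathsf{inv}(\mathsf{typ}(\mathbf h))$). $\mathsf{Clg}(\mathcal B)$ has conceptual structures as objects and concept morphisms as morphisms, composed componentwise. *)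

theory Defs
  imports Main
begin

record ('o, 'm) cat =
  Obj :: "'o set"
  Arr :: "'m set"
  Dom :: "'m \<Rightarrow> 'o"
  Cod :: "'m \<Rightarrow> 'o"
  Ide :: "'o \<Rightarrow> 'm"
  Cmp :: "'m \<Rightarrow> 'm \<Rightarrow> 'm" (infixr "\<cdot>\<index>" 75)

text \<open>Composition is written in the order of function application: \<open>g \<cdot> f\<close> is \<open>f\<close> followed by \<open>g\<close>.\<close>

definition hom :: "('o, 'm, 'z) cat_scheme \<Rightarrow> 'o \<Rightarrow> 'o \<Rightarrow> 'm set" where
  "hom C X Y = {f \<in> Arr C. Dom C f = X \<and> Cod C f = Y}"

locale category =
  fixes C :: "('o, 'm, 'z) cat_scheme" (structure)
  assumes Dom_Obj: "f \<in> Arr C \<Longrightarrow> Dom C f \<in> Obj C"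
    and Cod_Obj: "f \<in> Arr C \<Longrightarrow> Cod C f \<in> Obj C"
    and Ide_hom: "X \<in> Obj C \<Longrightarrow> Ide C X \<in> hom C X X"
    and Cmp_hom: "f \<in> hom C X Y \<Longrightarrow> g \<in> hom C Y Z \<Longrightarrow> g \<cdot> f \<in> hom C X Z"
    and Ide_left: "f \<in> hom C X Y \<Longrightarrow> Ide C Y \<cdot> f = f"
    and Ide_right: "f \<in> hom C X Y \<Longrightarrow> f \<cdot> Ide C X = f"
    and Cmp_assoc: "f \<in> hom C W X \<Longrightarrow> g \<in> hom C X Y \<Longrightarrow> h \<in> hom C Y Z \<Longrightarrow>
      (h \<cdot> g) \<cdot> f = h \<cdot> (g \<cdot> f)"

definition is_iso :: "('o, 'm, 'z) cat_scheme \<Rightarrow> 'm \<Rightarrow> bool" where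
  "is_iso C f \<longleftrightarrow> f \<in> Arr C \<and> (\<exists>g \<in> hom C (Cod C f) (Dom C f).
     Cmp C g f = Ide C (Dom C f) \<and> Cmp C f g = Ide C (Cod C f))"

record ('o, 'm, 'p, 'n) fctr =
  onObj :: "'o \<Rightarrow> 'p"
  onArr :: "'m \<Rightarrow> 'n"

definition is_functor ::
  "('o, 'm, 'y) cat_scheme \<Rightarrow> ('p, 'n, 'z) cat_scheme \<Rightarrow> ('o, 'm, 'p, 'n) fctr \<Rightarrow> bool" where
  "is_functor C D F \<longleftrightarrow> category C \<and> category D \<and>
     (\<forall>X \<in> Obj C. onObj F X \<in> Obj D) \<and>
     (\<forall>f \<in> Arr C. onArr F f \<in> hom D (onObj F (Dom C f)) (onObj F (Cod C f))) \<and>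
     (\<forall>X \<in> Obj C. onArr F (Ide C X) = Ide D (onObj F X)) \<and>
     (\<forall>f \<in> Arr C. \<forall>g \<in> Arr C. Dom C g = Cod C f \<longrightarrow>
        onArr F (Cmp C g f) = Cmp D (onArr F g) (onArr F f))"

definition id_fctr :: "('o, 'm, 'o, 'm) fctr" where
  "id_fctr = \<lparr>onObj = (\<lambda>X. X), onArr = (\<lambda>f. f)\<rparr>"

definition comp_fctr ::
  "('p, 'n, 'q, 'k) fctr \<Rightarrow> ('o, 'm, 'p, 'n) fctr \<Rightarrow> ('o, 'm, 'q, 'k) fctr" where
  "comp_fctr G F = \<lparr>onObj = onObj G \<circ> onObj F, onArr = onArr G \<circ> onArr F\<rparr>"

definition natural_iso ::
  "('o, 'm, 'y) cat_scheme \<Rightarrow> ('p, 'n, 'z) cat_scheme \<Rightarrow>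
   ('o, 'm, 'p, 'n) fctr \<Rightarrow> ('o, 'm, 'p, 'n) fctr \<Rightarrow> ('o \<Rightarrow> 'n) \<Rightarrow> bool" where
  "natural_iso C D F G \<eta> \<longleftrightarrow>
     (\<forall>X \<in> Obj C. \<eta> X \<in> hom D (onObj F X) (onObj G X) \<and> is_iso D (\<eta> X)) \<and>
     (\<forall>f \<in> Arr C. Cmp D (\<eta> (Cod C f)) (onArr F f) = Cmp D (onArr G f) (\<eta> (Dom C f)))"

definition is_equivalence ::
  "('o, 'm, 'y) cat_scheme \<Rightarrow> ('p, 'n, 'z) cat_scheme \<Rightarrow>
   ('o, 'm, 'p, 'n) fctr \<Rightarrow> ('p, 'n, 'o, 'm) fctr \<Rightarrow> bool" where
  "is_equivalence C D F G \<longleftrightarrow> is_functor C D F \<and> is_functor D C G \<and>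
     (\<exists>\<eta>. natural_iso C C id_fctr (comp_fctr G F) \<eta>) \<and>
     (\<exists>\<epsilon>. natural_iso D D (comp_fctr F G) id_fctr \<epsilon>)"

context category
begin

definition monic :: "'m \<Rightarrow> bool" where
  "monic m \<longleftrightarrow> m \<in> Arr C \<and>
     (\<forall>T. \<forall>a \<in> hom C T (Dom C m). \<forall>b \<in> hom C T (Dom C m). m \<cdot> a = m \<cdot> b \<longrightarrow> a = b)"

definition factors :: "'m \<Rightarrow> 'm \<Rightarrow> bool" where
  "factors f m \<longleftrightarrow> (\<exists>u \<in> hom C (Dom C f) (Dom C m). f = m \<cdot> u)"

definition is_pullback :: "'m \<Rightarrow> 'm \<Rightarrow> 'm \<Rightarrow> 'm \<Rightarrow> bool" where
  "is_pullback p q f g \<longleftrightarrow>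
     f \<in> Arr C \<and> g \<in> Arr C \<and> Cod C f = Cod C g \<and>
     p \<in> hom C (Dom C p) (Dom C f) \<and> q \<in> hom C (Dom C p) (Dom C g) \<and> f \<cdot> p = g \<cdot> q \<and>
     (\<forall>T \<in> Obj C. \<forall>a \<in> hom C T (Dom C f). \<forall>b \<in> hom C T (Dom C g). f \<cdot> a = g \<cdot> b \<longrightarrow>
        (\<exists>!u. u \<in> hom C T (Dom C p) \<and> p \<cdot> u = a \<and> q \<cdot> u = b))"

text \<open>A subobject is an equivalence class of monomorphisms, so that equality of subobjects is
  equality of sets of arrows.\<close>

definition subobj :: "'m \<Rightarrow> 'm set" where
  "subobj m = {n. monic n \<and> Cod C n = Cod C m \<and> factors n m \<and> factors m n}"

definition Sub :: "'o \<Rightarrow> 'm set set" where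
  "Sub X = subobj ` {m. monic m \<and> Cod C m = X}"

definition lies :: "'m \<Rightarrow> 'm set \<Rightarrow> bool" where
  "lies f S \<longleftrightarrow> (\<exists>m \<in> S. factors f m)"

definition sub_le :: "'m set \<Rightarrow> 'm set \<Rightarrow> bool" where
  "sub_le S S' \<longleftrightarrow> (\<forall>m \<in> S. lies m S')"

definition pull :: "'m \<Rightarrow> 'm set \<Rightarrow> 'm set" where
  "pull f S = {m. \<exists>n \<in> S. \<exists>g. is_pullback m g f n}"

definition im :: "'m \<Rightarrow> 'm set" where
  "im h = {m. monic m \<and> Cod C m = Cod C h \<and> factors h m \<and>
     (\<forall>n. monic n \<and> Cod C n = Cod C h \<and> factors h n \<longrightarrow> factors m n)}"

definition lift :: "'m \<Rightarrow> 'm \<Rightarrow> 'm" where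
  "lift m f = (THE u. u \<in> hom C (Dom C f) (Dom C m) \<and> m \<cdot> u = f)"

end

text \<open>A topos is a category with finite limits and power objects. The terminal object, binary
  products, equalizers and power objects are chosen as part of the data; \<open>Mem B X\<close> is the
  membership relation, a monomorphism into \<open>\<wp>X \<times> X\<close>.\<close>

record ('o, 'm) topos_data = "('o, 'm) cat" +
  Trm :: "'o"
  Prod :: "'o \<Rightarrow> 'o \<Rightarrow> 'o"
  Fst :: "'o \<Rightarrow> 'o \<Rightarrow> 'm"
  Snd :: "'o \<Rightarrow> 'o \<Rightarrow> 'm"
  Eql :: "'m \<Rightarrow> 'm \<Rightarrow> 'm"
  Pwr :: "'o \<Rightarrow> 'o"
  Mem :: "'o \<Rightarrow> 'm"

locale fin_complete = category B
  for B :: "('o, 'm, 'z) topos_data_scheme" (structure) +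
  assumes Trm_Obj: "Trm B \<in> Obj B"
    and Trm_unique: "X \<in> Obj B \<Longrightarrow> \<exists>!f. f \<in> hom B X (Trm B)"
    and Prod_Obj: "X \<in> Obj B \<Longrightarrow> Y \<in> Obj B \<Longrightarrow> Prod B X Y \<in> Obj B"
    and Fst_hom: "X \<in> Obj B \<Longrightarrow> Y \<in> Obj B \<Longrightarrow> Fst B X Y \<in> hom B (Prod B X Y) X"
    and Snd_hom: "X \<in> Obj B \<Longrightarrow> Y \<in> Obj B \<Longrightarrow> Snd B X Y \<in> hom B (Prod B X Y) Y"
    and Prod_univ: "f \<in> hom B T X \<Longrightarrow> g \<in> hom B T Y \<Longrightarrow>
      \<exists>!h. h \<in> hom B T (Prod B X Y) \<and> Fst B X Y \<cdot> h = f \<and> Snd B X Y \<cdot> h = g"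
    and Eql_hom: "f \<in> hom B X Y \<Longrightarrow> g \<in> hom B X Y \<Longrightarrow>
      Eql B f g \<in> hom B (Dom B (Eql B f g)) X"
    and Eql_eq: "f \<in> hom B X Y \<Longrightarrow> g \<in> hom B X Y \<Longrightarrow> f \<cdot> Eql B f g = g \<cdot> Eql B f g"
    and Eql_univ: "f \<in> hom B X Y \<Longrightarrow> g \<in> hom B X Y \<Longrightarrow> h \<in> hom B T X \<Longrightarrow> f \<cdot> h = g \<cdot> h \<Longrightarrow>
      \<exists>!u. u \<in> hom B T (Dom B (Eql B f g)) \<and> Eql B f g \<cdot> u = h"
begin

definition pair :: "'m \<Rightarrow> 'm \<Rightarrow> 'm" where
  "pair f g = (THE h. h \<in> hom B (Dom B f) (Prod B (Cod B f) (Cod B g)) \<and>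
     Fst B (Cod B f) (Cod B g) \<cdot> h = f \<and> Snd B (Cod B f) (Cod B g) \<cdot> h = g)"

definition cross :: "'m \<Rightarrow> 'm \<Rightarrow> 'm" where
  "cross f g = pair (f \<cdot> Fst B (Dom B f) (Dom B g)) (g \<cdot> Snd B (Dom B f) (Dom B g))"

definition swap :: "'o \<Rightarrow> 'o \<Rightarrow> 'm" where
  "swap X Y = pair (Snd B X Y) (Fst B X Y)"

end

locale topos = fin_complete B
  for B :: "('o, 'm, 'z) topos_data_scheme" (structure) +
  assumes Pwr_Obj: "X \<in> Obj B \<Longrightarrow> Pwr B X \<in> Obj B"
    and Mem_monic: "X \<in> Obj B \<Longrightarrow> monic (Mem B X)"
    and Mem_Cod: "X \<in> Obj B \<Longrightarrow> Cod B (Mem B X) = Prod B (Pwr B X) X"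
    and Pwr_univ: "X \<in> Obj B \<Longrightarrow> Y \<in> Obj B \<Longrightarrow> monic r \<Longrightarrow> Cod B r = Prod B Y X \<Longrightarrow>
      \<exists>!g. g \<in> hom B Y (Pwr B X) \<and> (\<exists>h. is_pullback r h (cross g (Ide B X)) (Mem B X))"
begin

text \<open>\<open>rel X\<close> and \<open>classify Y X\<close> are the two directions of the bijection between arrows
  \<open>Y \<rightarrow> \<wp>X\<close> and relations in \<open>Sub (Y \<times> X)\<close>.\<close>

definition rel :: "'o \<Rightarrow> 'm \<Rightarrow> 'm set" where
  "rel X g = pull (cross g (Ide B X)) (subobj (Mem B X))"

definition classify :: "'o \<Rightarrow> 'o \<Rightarrow> 'm set \<Rightarrow> 'm" where
  "classify Y X R = (THE g. g \<in> hom B Y (Pwr B X) \<and> rel X g = R)"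

definition singleton :: "'o \<Rightarrow> 'm" where
  "singleton X = classify X X (subobj (pair (Ide B X) (Ide B X)))"

text \<open>The inclusion order on \<open>\<wp>X\<close>, as a subobject of \<open>\<wp>X \<times> \<wp>X\<close>: its generalized elements
  are the pairs of arrows \<open>T \<rightarrow> \<wp>X\<close> whose corresponding relations in \<open>Sub (T \<times> X)\<close> are
  included one in the other.\<close>

definition incl :: "'o \<Rightarrow> 'm set" where
  "incl X = {m. monic m \<and> Cod B m = Prod B (Pwr B X) (Pwr B X) \<and>
     (\<forall>c \<in> Arr B. Cod B c = Prod B (Pwr B X) (Pwr B X) \<longrightarrow>
        (factors c m \<longleftrightarrow> sub_le (rel X (Fst B (Pwr B X) (Pwr B X) \<cdot> c))
                              (rel X (Snd B (Pwr B X) (Pwr B X) \<cdot> c))))}"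

text \<open>For \<open>f : X \<rightarrow> Y\<close>, \<open>f\<inverse> : \<wp>Y \<rightarrow> \<wp>X\<close> classifies \<open>{(T, x). f x \<in> T}\<close>, and
  \<open>\<exists>f : \<wp>X \<rightarrow> \<wp>Y\<close> classifies the image of \<open>\<in>\<^sub>X \<rightarrow> \<wp>X \<times> X \<rightarrow> \<wp>X \<times> Y\<close>.\<close>

definition pre_image :: "'m \<Rightarrow> 'm" where
  "pre_image f = classify (Pwr B (Cod B f)) (Dom B f)
     (pull (cross (Ide B (Pwr B (Cod B f))) f) (subobj (Mem B (Cod B f))))"

definition dir_image :: "'m \<Rightarrow> 'm" where
  "dir_image f = classify (Pwr B (Dom B f)) (Cod B f)
     (im (cross (Ide B (Pwr B (Dom B f))) f \<cdot> Mem B (Dom B f)))"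

end

record ('o, 'm) preord =
  car :: "'o"
  leq :: "'m set"

record 'm adj =
  lft :: "'m"
  rgt :: "'m"

context topos
begin

text \<open>Internal statements about elements are read at generalized elements, i.e. at all arrows
  from a common stage \<open>T\<close>.\<close>

definition le :: "('o, 'm) preord \<Rightarrow> 'm \<Rightarrow> 'm \<Rightarrow> bool" where
  "le P a b \<longleftrightarrow> lies (pair a b) (leq P)"

definition is_preorder :: "('o, 'm) preord \<Rightarrow> bool" where
  "is_preorder P \<longleftrightarrow> car P \<in> Obj B \<and> leq P \<in> Sub (Prod B (car P) (car P)) \<and>
     (\<forall>T \<in> Obj B. \<forall>a \<in> hom B T (car P). le P a a) \<and>
     (\<forall>T \<in> Obj B. \<forall>a \<in> hom B T (car P). \<forall>b \<in> hom B T (car P). \<forall>c \<in> hom B T (car P).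
        le P a b \<longrightarrow> le P b c \<longrightarrow> le P a c)"

definition opp :: "('o, 'm) preord \<Rightarrow> ('o, 'm) preord" where
  "opp P = \<lparr>car = car P, leq = pull (swap (car P) (car P)) (leq P)\<rparr>"

definition pwr_ord :: "'o \<Rightarrow> ('o, 'm) preord" where
  "pwr_ord X = \<lparr>car = Pwr B X, leq = incl X\<rparr>"

definition is_monotone :: "('o, 'm) preord \<Rightarrow> ('o, 'm) preord \<Rightarrow> 'm \<Rightarrow> bool" where
  "is_monotone P Q f \<longleftrightarrow> f \<in> hom B (car P) (car Q) \<and>
     (\<forall>T \<in> Obj B. \<forall>a \<in> hom B T (car P). \<forall>b \<in> hom B T (car P).
        le P a b \<longrightarrow> le Q (f \<cdot> a) (f \<cdot> b))"

definition is_adj :: "('o, 'm) preord \<Rightarrow> ('o, 'm) preord \<Rightarrow> 'm adj \<Rightarrow> bool" where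
  "is_adj P Q g \<longleftrightarrow> is_preorder P \<and> is_preorder Q \<and>
     is_monotone P Q (lft g) \<and> is_monotone Q P (rgt g) \<and>
     le P (Ide B (car P)) (rgt g \<cdot> lft g) \<and> le Q (lft g \<cdot> rgt g) (Ide B (car Q))"

definition is_reflection :: "('o, 'm) preord \<Rightarrow> ('o, 'm) preord \<Rightarrow> 'm adj \<Rightarrow> bool" where
  "is_reflection P Q g \<longleftrightarrow> is_adj P Q g \<and> lft g \<cdot> rgt g = Ide B (car Q)"

definition is_coreflection :: "('o, 'm) preord \<Rightarrow> ('o, 'm) preord \<Rightarrow> 'm adj \<Rightarrow> bool" where
  "is_coreflection P Q g \<longleftrightarrow> is_adj P Q g \<and> rgt g \<cdot> lft g = Ide B (car P)"

definition adj_id :: "('o, 'm) preord \<Rightarrow> 'm adj" where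
  "adj_id P = \<lparr>lft = Ide B (car P), rgt = Ide B (car P)\<rparr>"

definition adj_then :: "'m adj \<Rightarrow> 'm adj \<Rightarrow> 'm adj" where
  "adj_then g h = \<lparr>lft = lft h \<cdot> lft g, rgt = rgt g \<cdot> rgt h\<rparr>"

definition dir_adj :: "'m \<Rightarrow> 'm adj" where
  "dir_adj f = \<lparr>lft = dir_image f, rgt = pre_image f\<rparr>"

definition inv_adj :: "'m \<Rightarrow> 'm adj" where
  "inv_adj f = \<lparr>lft = pre_image f, rgt = dir_image f\<rparr>"

text \<open>The polar factorization of \<open>g : P \<rightleftharpoons> Q\<close> through its axis, the object of bipolar pairs
  \<open>{(x, y). lft g x = y \<and> rgt g y = x}\<close> ordered by the first component:
  a reflection \<open>x \<mapsto> (rgt g (lft g x), lft g x)\<close>, with right adjoint the first projection,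
  followed by a coreflection, the second projection, with right adjoint
  \<open>y \<mapsto> (rgt g y, lft g (rgt g y))\<close>.\<close>

definition axis_arr :: "('o, 'm) preord \<Rightarrow> ('o, 'm) preord \<Rightarrow> 'm adj \<Rightarrow> 'm" where
  "axis_arr P Q g = Eql B (Ide B (Prod B (car P) (car Q)))
     (pair (rgt g \<cdot> Snd B (car P) (car Q)) (lft g \<cdot> Fst B (car P) (car Q)))"

definition axis_fst :: "('o, 'm) preord \<Rightarrow> ('o, 'm) preord \<Rightarrow> 'm adj \<Rightarrow> 'm" where
  "axis_fst P Q g = Fst B (car P) (car Q) \<cdot> axis_arr P Q g"

definition axis_snd :: "('o, 'm) preord \<Rightarrow> ('o, 'm) preord \<Rightarrow> 'm adj \<Rightarrow> 'm" where
  "axis_snd P Q g = Snd B (car P) (car Q) \<cdot> axis_arr P Q g"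

definition axis :: "('o, 'm) preord \<Rightarrow> ('o, 'm) preord \<Rightarrow> 'm adj \<Rightarrow> ('o, 'm) preord" where
  "axis P Q g = \<lparr>car = Dom B (axis_arr P Q g),
     leq = pull (cross (axis_fst P Q g) (axis_fst P Q g)) (leq P)\<rparr>"

definition polar_refl :: "('o, 'm) preord \<Rightarrow> ('o, 'm) preord \<Rightarrow> 'm adj \<Rightarrow> 'm adj" where
  "polar_refl P Q g = \<lparr>lft = lift (axis_arr P Q g) (pair (rgt g \<cdot> lft g) (lft g)),
     rgt = axis_fst P Q g\<rparr>"

definition polar_corefl :: "('o, 'm) preord \<Rightarrow> ('o, 'm) preord \<Rightarrow> 'm adj \<Rightarrow> 'm adj" where
  "polar_corefl P Q g = \<lparr>lft = axis_snd P Q g,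
     rgt = lift (axis_arr P Q g) (pair (rgt g) (lft g \<cdot> rgt g))\<rparr>"

text \<open>The diagonal of a square (\<open>e\<close> then \<open>s\<close>) = (\<open>r\<close> then \<open>m\<close>) with \<open>e\<close> a reflection and \<open>m\<close> a
  coreflection. The components are forced by (\<open>e\<close> then \<open>d\<close>) = \<open>r\<close> and (\<open>d\<close> then \<open>m\<close>) = \<open>s\<close>.\<close>

definition diagonal :: "'m adj \<Rightarrow> 'm adj \<Rightarrow> 'm adj \<Rightarrow> 'm adj \<Rightarrow> 'm adj" where
  "diagonal e s r m = \<lparr>lft = lft r \<cdot> rgt e, rgt = rgt s \<cdot> lft m\<rparr>"

end

record ('o, 'm) clsn =
  cInst :: "'o"
  cTyp :: "'o"
  cSat :: "'m set"

record ('o, 'm) infomorphism =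
  iSrc :: "('o, 'm) clsn"
  iTrg :: "('o, 'm) clsn"
  iInst :: "'m"
  iTyp :: "'m"

context topos
begin

definition is_clsn :: "('o, 'm) clsn \<Rightarrow> bool" where
  "is_clsn A \<longleftrightarrow> cInst A \<in> Obj B \<and> cTyp A \<in> Obj B \<and> cSat A \<in> Sub (Prod B (cInst A) (cTyp A))"

definition is_infomorphism :: "('o, 'm) infomorphism \<Rightarrow> bool" where
  "is_infomorphism f \<longleftrightarrow> is_clsn (iSrc f) \<and> is_clsn (iTrg f) \<and>
     iInst f \<in> hom B (cInst (iTrg f)) (cInst (iSrc f)) \<and>
     iTyp f \<in> hom B (cTyp (iSrc f)) (cTyp (iTrg f)) \<and>
     pull (cross (iInst f) (Ide B (cTyp (iSrc f)))) (cSat (iSrc f)) =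
     pull (cross (Ide B (cInst (iTrg f))) (iTyp f)) (cSat (iTrg f))"

definition Clsn :: "(('o, 'm) clsn, ('o, 'm) infomorphism) cat" where
  "Clsn = \<lparr>Obj = {A. is_clsn A}, Arr = {f. is_infomorphism f}, Dom = iSrc, Cod = iTrg,
     Ide = (\<lambda>A. \<lparr>iSrc = A, iTrg = A, iInst = Ide B (cInst A), iTyp = Ide B (cTyp A)\<rparr>),
     Cmp = (\<lambda>g f. \<lparr>iSrc = iSrc f, iTrg = iTrg g,
       iInst = iInst f \<cdot> iInst g, iTyp = iTyp g \<cdot> iTyp f\<rparr>)\<rparr>"

text \<open>The derivation adjunction. Its left adjoint \<open>\<wp>inst \<rightarrow> \<wp>typ\<close> classifies
  \<open>{(S, t). \<forall>i \<in> S. i \<Turnstile> t} = {(S, t). S \<subseteq> {i. i \<Turnstile> t}}\<close>; its right adjoint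
  \<open>\<wp>typ \<rightarrow> \<wp>inst\<close> classifies \<open>{(S, i). \<forall>t \<in> S. i \<Turnstile> t} = {(S, i). S \<subseteq> {t. i \<Turnstile> t}}\<close>.\<close>

definition inst_typ :: "('o, 'm) clsn \<Rightarrow> 'm" where
  "inst_typ A = classify (cInst A) (cTyp A) (cSat A)"

definition typ_inst :: "('o, 'm) clsn \<Rightarrow> 'm" where
  "typ_inst A = classify (cTyp A) (cInst A) (pull (swap (cTyp A) (cInst A)) (cSat A))"

definition deriv :: "('o, 'm) clsn \<Rightarrow> 'm adj" where
  "deriv A = \<lparr>
     lft = classify (Pwr B (cInst A)) (cTyp A)
       (pull (cross (Ide B (Pwr B (cInst A))) (typ_inst A)) (incl (cInst A))),
     rgt = classify (Pwr B (cTyp A)) (cInst A)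
       (pull (cross (Ide B (Pwr B (cTyp A))) (inst_typ A)) (incl (cTyp A)))\<rparr>"

end

record ('o, 'm) cstruct =
  lOrd :: "('o, 'm) preord"
  lInst :: "'o"
  lTyp :: "'o"
  extent :: "'m adj"
  intent :: "'m adj"

record ('o, 'm) cmorphism =
  mSrc :: "('o, 'm) cstruct"
  mTrg :: "('o, 'm) cstruct"
  mAdj :: "'m adj"
  mInst :: "'m"
  mTyp :: "'m"

context topos
begin

definition is_cstruct :: "('o, 'm) cstruct \<Rightarrow> bool" where
  "is_cstruct L \<longleftrightarrow> is_preorder (lOrd L) \<and> lInst L \<in> Obj B \<and> lTyp L \<in> Obj B \<and>
     is_reflection (pwr_ord (lInst L)) (lOrd L) (extent L) \<and>
     is_coreflection (lOrd L) (opp (pwr_ord (lTyp L))) (intent L)"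

definition is_cmorphism :: "('o, 'm) cmorphism \<Rightarrow> bool" where
  "is_cmorphism h \<longleftrightarrow> is_cstruct (mSrc h) \<and> is_cstruct (mTrg h) \<and>
     is_adj (lOrd (mTrg h)) (lOrd (mSrc h)) (mAdj h) \<and>
     mInst h \<in> hom B (lInst (mTrg h)) (lInst (mSrc h)) \<and>
     mTyp h \<in> hom B (lTyp (mSrc h)) (lTyp (mTrg h)) \<and>
     adj_then (extent (mTrg h)) (mAdj h) = adj_then (dir_adj (mInst h)) (extent (mSrc h)) \<and>
     adj_then (mAdj h) (intent (mSrc h)) = adj_then (intent (mTrg h)) (inv_adj (mTyp h))"

definition Clg :: "(('o, 'm) cstruct, ('o, 'm) cmorphism) cat" where
  "Clg = \<lparr>Obj = {L. is_cstruct L}, Arr = {h. is_cmorphism h}, Dom = mSrc, Cod = mTrg,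
     Ide = (\<lambda>L. \<lparr>mSrc = L, mTrg = L, mAdj = adj_id (lOrd L),
       mInst = Ide B (lInst L), mTyp = Ide B (lTyp L)\<rparr>),
     Cmp = (\<lambda>k h. \<lparr>mSrc = mSrc h, mTrg = mTrg k, mAdj = adj_then (mAdj k) (mAdj h),
       mInst = mInst h \<cdot> mInst k, mTyp = mTyp k \<cdot> mTyp h\<rparr>)\<rparr>"

definition clg_obj :: "('o, 'm) clsn \<Rightarrow> ('o, 'm) cstruct" where
  "clg_obj A =
    (let P = pwr_ord (cInst A); Q = opp (pwr_ord (cTyp A)); d = deriv A in
     \<lparr>lOrd = axis P Q d, lInst = cInst A, lTyp = cTyp A,
      extent = polar_refl P Q d, intent = polar_corefl P Q d\<rparr>)"

definition clg_arr :: "('o, 'm) infomorphism \<Rightarrow> ('o, 'm) cmorphism" where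
  "clg_arr f =
    (let L1 = clg_obj (iSrc f); L2 = clg_obj (iTrg f) in
     \<lparr>mSrc = L1, mTrg = L2,
      mAdj = diagonal (extent L2) (adj_then (intent L2) (inv_adj (iTyp f)))
        (adj_then (dir_adj (iInst f)) (extent L1)) (intent L1),
      mInst = iInst f, mTyp = iTyp f\<rparr>)"

definition clg_functor ::
  "(('o, 'm) clsn, ('o, 'm) infomorphism, ('o, 'm) cstruct, ('o, 'm) cmorphism) fctr" where
  "clg_functor = \<lparr>onObj = clg_obj, onArr = clg_arr\<rparr>"

text \<open>An adjunction \<open>d : \<wp>X \<rightleftharpoons> (\<wp>Y)\<^sup>o\<^sup>p\<close> amounts to the relation \<open>{(x, y). y \<in> lft d {x}}\<close>.
  The classification of \<open>L\<close> is the one for \<open>d\<close> the extent reflection followed by the intent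
  coreflection.\<close>

definition clsn_obj :: "('o, 'm) cstruct \<Rightarrow> ('o, 'm) clsn" where
  "clsn_obj L = \<lparr>cInst = lInst L, cTyp = lTyp L,
     cSat = rel (lTyp L) (lft (adj_then (extent L) (intent L)) \<cdot> singleton (lInst L))\<rparr>"

definition clsn_arr :: "('o, 'm) cmorphism \<Rightarrow> ('o, 'm) infomorphism" where
  "clsn_arr h = \<lparr>iSrc = clsn_obj (mSrc h), iTrg = clsn_obj (mTrg h),
     iInst = mInst h, iTyp = mTyp h\<rparr>"

definition clsn_functor ::
  "(('o, 'm) cstruct, ('o, 'm) cmorphism, ('o, 'm) clsn, ('o, 'm) infomorphism) fctr" where
  "clsn_functor = \<lparr>onObj = clsn_obj, onArr = clsn_arr\<rparr>"

end

end

theory Submission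
  imports Defs
begin

text \<open>All internal statements are read at generalized elements. The membership relation \<open>x \<in> a\<close> for
  \<open>x : T \<rightarrow> X\<close> and \<open>a : T \<rightarrow> \<wp>X\<close> determines \<open>a\<close>, so power objects behave like power sets.
  An extent reflection is split epi on left adjoints and an intent coreflection is split epi on
  right adjoints; hence a concept morphism is determined by its source, its target and its
  instance and type morphisms. Conversely, a pair of such morphisms extends to a concept morphism
  (the diagonal) as soon as it commutes with the adjunctions (extent then intent) of the two
  structures, and for derivation adjunctions this commutation says precisely that the pair is an
  infomorphism. Finally, adjunctions \<open>\<wp>X \<rightleftharpoons> (\<wp>Y)\<^sup>o\<^sup>p\<close> correspond bijectively to relations, so going
  from classifications to conceptual structures and back is the identity, and the other composite
  is isomorphic to the identity by the diagonals over identity morphisms.\<close>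

section \<open>Subobjects and pullbacks\<close>

text \<open>The first obstacle is existence. \<open>pull\<close>, \<open>incl\<close> and
  \<open>im\<close> are sets of arrows cut out by a universal property, and such a set could be
  empty; the axioms provide only finite limits and power objects. Pullbacks of subobjects and the
  inclusion order are obtained from equalizers. For images no factorization is built: a left adjoint
  of inverse image is defined by quantifying over all elements of \<wp>Y, and the adjunction then
  shows that the relation it classifies is the least one through which the given arrow factors. The
  second obstacle is equality. Adjunctions are compared in both components. Between powers one
  component suffices, because inclusion is antisymmetric and adjoints are unique. Over the preorder
  of a conceptual structure the argument instead cancels extents on left adjoints and intents on
  right adjoints. Satisfaction relations are equivalence classes of monomorphisms rather than chosen
  monomorphisms, which is why one round trip can be an identity on the nose.\<close>

context category
begin

lemma hom_iff: "f \<in> hom C X Y \<longleftrightarrow> f \<in> Arr C \<and> Dom C f = X \<and> Cod C f = Y"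
  by (auto simp: hom_def)

lemma Dom_Cod_Obj [simp]: "f \<in> Arr C \<Longrightarrow> Dom C f \<in> Obj C" "f \<in> Arr C \<Longrightarrow> Cod C f \<in> Obj C"
  by (fact Dom_Obj Cod_Obj)+

lemma Ide_simps [simp]:
  assumes "X \<in> Obj C"
  shows "Ide C X \<in> Arr C" "Dom C (Ide C X) = X" "Cod C (Ide C X) = X"
  using Ide_hom[OF assms] by (auto simp: hom_def)

lemma Cmp_simps [simp]:
  assumes "f \<in> Arr C" "g \<in> Arr C" "Dom C g = Cod C f"
  shows "g \<cdot> f \<in> Arr C" "Dom C (g \<cdot> f) = Dom C f" "Cod C (g \<cdot> f) = Cod C g"
  using Cmp_hom[of f "Dom C f" "Cod C f" g "Cod C g"] assms by (auto simp: hom_def)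

lemma Cmp_Ide [simp]:
  assumes "f \<in> Arr C"
  shows "X = Cod C f \<Longrightarrow> Ide C X \<cdot> f = f" "X = Dom C f \<Longrightarrow> f \<cdot> Ide C X = f"
  using assms Ide_left Ide_right by (auto simp: hom_def)

lemma Cmp_assoc_Arr [simp]:
  assumes "f \<in> Arr C" "g \<in> Arr C" "h \<in> Arr C" "Dom C g = Cod C f" "Dom C h = Cod C g"
  shows "(h \<cdot> g) \<cdot> f = h \<cdot> (g \<cdot> f)"
  using assms Cmp_assoc by (auto simp: hom_def)

text \<open>Composites are normalized to the right by \<open>Cmp_assoc_Arr\<close>, so the left side
  of an equation \<open>h \<cdot> g = k\<close> does not occur as a subterm of
  \<open>h \<cdot> (g \<cdot> f)\<close>. This form applies the equation there.\<close>

lemma Cmp_split_cong: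
  assumes "h \<cdot> g = k" "f \<in> Arr C" "g \<in> Arr C" "h \<in> Arr C" "Dom C g = Cod C f" "Dom C h = Cod C g"
  shows "h \<cdot> (g \<cdot> f) = k \<cdot> f"
  using assms Cmp_assoc_Arr by metis

section \<open>Monomorphisms and factorization\<close>

lemma monic_Arr: "monic m \<Longrightarrow> m \<in> Arr C"
  by (simp add: monic_def)

lemma monicD:
  assumes "monic m" "m \<cdot> a = m \<cdot> b" "a \<in> Arr C" "b \<in> Arr C" "Dom C b = Dom C a"
    "Cod C a = Dom C m" "Cod C b = Dom C m"
  shows "a = b"
proof -
  have "a \<in> hom C (Dom C a) (Dom C m)" "b \<in> hom C (Dom C a) (Dom C m)"
    using assms by (auto simp: hom_iff)
  with assms show ?thesis unfolding monic_def by blast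
qed

lemma factorsI: "u \<in> Arr C \<Longrightarrow> m \<in> Arr C \<Longrightarrow> Cod C u = Dom C m \<Longrightarrow> factors (m \<cdot> u) m"
  by (auto simp: factors_def hom_iff)

lemma factorsE:
  assumes "factors f m" "m \<in> Arr C"
  obtains u where "u \<in> Arr C" "Cod C u = Dom C m" "Dom C u = Dom C f" "f = m \<cdot> u"
    "f \<in> Arr C" "Cod C f = Cod C m"
  using assms by (auto simp: factors_def hom_iff)

lemma factors_CmpE:
  assumes "factors (f \<cdot> z) m" "m \<in> Arr C" "f \<in> Arr C" "z \<in> Arr C" "Dom C f = Cod C z"
  obtains w where "w \<in> Arr C" "Cod C w = Dom C m" "Dom C w = Dom C z" "f \<cdot> z = m \<cdot> w"
  using assms(1,2)
proof (rule factorsE)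
  fix u assume "u \<in> Arr C" "Cod C u = Dom C m" "Dom C u = Dom C (f \<cdot> z)" "f \<cdot> z = m \<cdot> u"
  moreover have "Dom C (f \<cdot> z) = Dom C z" using assms by simp
  ultimately show thesis using that by simp
qed

lemma factors_refl: "m \<in> Arr C \<Longrightarrow> factors m m"
  using factorsI[of "Ide C (Dom C m)" m] by simp

lemma factors_trans:
  assumes "factors f m" "factors m n" "n \<in> Arr C"
  shows "factors f n"
proof -
  obtain v where v: "v \<in> Arr C" "Cod C v = Dom C n" "Dom C v = Dom C m" "m = n \<cdot> v" "m \<in> Arr C"
    using assms(2,3) by (elim factorsE)
  obtain u where u: "u \<in> Arr C" "Cod C u = Dom C m" "f = m \<cdot> u"
    using assms(1) v(5) by (elim factorsE)
  have "f = n \<cdot> (v \<cdot> u)"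
    unfolding u(3) v(4) using u(1,2) v(1,2,3) assms(3) by simp
  then show ?thesis
    using factorsI[of "v \<cdot> u" n] u(1,2) v(1,2,3) assms(3) by simp
qed

lemma factors_Cmp:
  assumes "factors f m" "m \<in> Arr C" "t \<in> Arr C" "Cod C t = Dom C f"
  shows "factors (f \<cdot> t) m"
proof -
  obtain u where "u \<in> Arr C" "Cod C u = Dom C m" "Dom C u = Dom C f" "f = m \<cdot> u"
    using assms(1,2) by (elim factorsE)
  then show ?thesis
    using factorsI[of "u \<cdot> t" m] assms(2-4) by simp
qed

definition represents :: "'m \<Rightarrow> ('m \<Rightarrow> bool) \<Rightarrow> bool" where
  "represents m \<phi> \<longleftrightarrow> monic m \<and> (\<forall>z \<in> Arr C. Cod C z = Cod C m \<longrightarrow> factors z m = \<phi> z)"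

text \<open>\<open>represents m \<phi>\<close> treats a predicate of generalized elements as
  representable, in the sense of Yoneda. The set of all representing monomorphisms is either empty
  or a whole subobject. Pullbacks of subobjects and \<open>incl\<close> are sets of this form, so
  equality of subobjects becomes equivalence of predicates.\<close>

definition compr :: "'o \<Rightarrow> ('m \<Rightarrow> bool) \<Rightarrow> 'm set" where
  "compr X \<phi> = {m. represents m \<phi> \<and> Cod C m = X}"

text \<open>Two monomorphisms with the same predicate factor through each other: evaluate the
  predicate at each of them. Conversely, mutual factorization does not change which arrows
  factor.\<close>

lemma compr_eq:
  assumes "represents p \<phi>"
  shows "compr (Cod C p) \<phi> = subobj p"
proof -
  have p: "monic p" "p \<in> Arr C" and r: "\<And>z. z \<in> Arr C \<Longrightarrow> Cod C z = Cod C p \<Longrightarrow> factors z p = \<phi> z"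
    using assms monic_Arr by (auto simp: represents_def)
  show ?thesis
  proof (intro set_eqI iffI)
    fix m assume "m \<in> compr (Cod C p) \<phi>"
    then have m: "monic m" "m \<in> Arr C" "Cod C m = Cod C p"
      and r': "\<And>z. z \<in> Arr C \<Longrightarrow> Cod C z = Cod C p \<Longrightarrow> factors z m = \<phi> z"
      using monic_Arr by (auto simp: compr_def represents_def)
    show "m \<in> subobj p"
      using m p r[of m] r'[of m] r[of p] r'[of p] factors_refl[of m] factors_refl[of p]
      by (simp add: subobj_def)
  next
    fix m assume "m \<in> subobj p"
    then have m: "monic m" "m \<in> Arr C" "Cod C m = Cod C p" and f: "factors m p" "factors p m"
      using monic_Arr by (auto simp: subobj_def)
    have "factors z m = \<phi> z" if "z \<in> Arr C" "Cod C z = Cod C p" for z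
      using r[OF that] factors_trans[OF _ f(1) p(2), of z] factors_trans[OF _ f(2) m(2), of z] by blast
    with m show "m \<in> compr (Cod C p) \<phi>"
      by (auto simp: compr_def represents_def)
  qed
qed

lemma represents_subobj:
  assumes "monic m" shows "represents m (\<lambda>z. lies z (subobj m))"
proof -
  have "lies z (subobj m) = factors z m" if "z \<in> Arr C" "Cod C z = Cod C m" for z
    using factors_refl[OF monic_Arr[OF assms]] factors_trans[OF _ _ monic_Arr[OF assms]] assms
    unfolding lies_def subobj_def by blast
  with assms show ?thesis by (simp add: represents_def)
qed

lemma Sub_iff: "S \<in> Sub X \<longleftrightarrow> (\<exists>m. monic m \<and> Cod C m = X \<and> S = subobj m)"
  by (auto simp: Sub_def)

lemma lies_subobj:
  assumes "monic m" "z \<in> Arr C" "Cod C z = Cod C m"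
  shows "lies z (subobj m) \<longleftrightarrow> factors z m"
  using represents_subobj[OF assms(1)] assms by (simp add: represents_def)

lemma Sub_eq_compr: "S \<in> Sub X \<Longrightarrow> S = compr X (\<lambda>z. lies z S)"
  using compr_eq[OF represents_subobj] by (auto simp: Sub_iff)

lemma compr_cong:
  assumes "\<And>z. z \<in> Arr C \<Longrightarrow> Cod C z = X \<Longrightarrow> \<phi> z = \<psi> z"
  shows "compr X \<phi> = compr X \<psi>"
  using assms by (auto simp: compr_def represents_def)

text \<open>Extensionality: every subobject is the comprehension of its own \<open>lies\<close>
  predicate.\<close>

lemma Sub_ext:
  assumes "S \<in> Sub X" "S' \<in> Sub X" "\<And>z. z \<in> Arr C \<Longrightarrow> Cod C z = X \<Longrightarrow> lies z S = lies z S'"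
  shows "S = S'"
  using assms compr_cong[of X "\<lambda>z. lies z S" "\<lambda>z. lies z S'"] Sub_eq_compr by blast

lemma mem_Sub:
  assumes "S \<in> Sub X" "m \<in> S"
  shows "monic m" "m \<in> Arr C" "Cod C m = X" "S = subobj m"
proof -
  from assms Sub_eq_compr have m: "m \<in> compr X (\<lambda>z. lies z S)" by blast
  then show "monic m" "Cod C m = X" by (auto simp: compr_def represents_def)
  then show "m \<in> Arr C" by (simp add: monic_Arr)
  have "compr X (\<lambda>z. lies z S) = subobj m"
    using compr_eq[of m "\<lambda>z. lies z S"] m by (auto simp: compr_def)
  then show "S = subobj m"
    using Sub_eq_compr[OF assms(1)] by simp
qed

lemma Sub_nonempty: assumes "S \<in> Sub X" obtains m where "m \<in> S"
proof -
  from assms obtain n where "monic n" "S = subobj n" by (auto simp: Sub_iff)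
  then have "n \<in> S" by (simp add: subobj_def factors_refl monic_Arr)
  then show thesis by (rule that)
qed

lemma lies_factors:
  "S \<in> Sub X \<Longrightarrow> m \<in> S \<Longrightarrow> z \<in> Arr C \<Longrightarrow> Cod C z = X \<Longrightarrow> lies z S \<longleftrightarrow> factors z m"
  using mem_Sub lies_subobj by metis

lemma lies_Cmp:
  assumes "lies z S" "S \<in> Sub X" "t \<in> Arr C" "Cod C t = Dom C z"
  shows "lies (z \<cdot> t) S"
  using assms factors_Cmp mem_Sub(2)[OF assms(2)] unfolding lies_def by blast

lemma sub_le_iff:
  assumes "S \<in> Sub X" "S' \<in> Sub X"
  shows "sub_le S S' \<longleftrightarrow> (\<forall>z \<in> Arr C. Cod C z = X \<longrightarrow> lies z S \<longrightarrow> lies z S')"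
proof
  assume l: "sub_le S S'"
  show "\<forall>z \<in> Arr C. Cod C z = X \<longrightarrow> lies z S \<longrightarrow> lies z S'"
  proof safe
    fix z assume "z \<in> Arr C" "lies z S"
    then obtain m m' where m: "m \<in> S" "factors z m" "m' \<in> S'" "factors m m'"
      using l unfolding lies_def sub_le_def by blast
    then show "lies z S'"
      unfolding lies_def using factors_trans mem_Sub(2)[OF assms(2)] by blast
  qed
next
  assume l: "\<forall>z \<in> Arr C. Cod C z = X \<longrightarrow> lies z S \<longrightarrow> lies z S'"
  show "sub_le S S'"
    unfolding sub_le_def
  proof
    fix m assume "m \<in> S"
    note m = this mem_Sub[OF assms(1) this]
    then have "lies m S" using factors_refl[of m] unfolding lies_def by blast
    with l m show "lies m S'" by blast
  qed
qed

lemma represented: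
  assumes "represents p \<phi>"
  shows "compr (Cod C p) \<phi> \<in> Sub (Cod C p)"
    and "z \<in> Arr C \<Longrightarrow> Cod C z = Cod C p \<Longrightarrow> lies z (compr (Cod C p) \<phi>) \<longleftrightarrow> \<phi> z"
  using assms compr_eq[OF assms] lies_subobj[of p z] by (auto simp: Sub_iff represents_def)

text \<open>Translates pullback squares into predicates. In a pullback square \<open>z\<close>
  factors through \<open>m\<close> exactly when \<open>f \<cdot> z\<close> factors through
  \<open>n\<close>. Conversely, the second leg is found by factoring \<open>f \<cdot> m\<close>
  through \<open>n\<close>; monicity of \<open>m\<close> makes mediating arrows unique, and monicity
  of \<open>n\<close> gives their second triangle.\<close>

lemma is_pullback_iff:
  assumes "f \<in> Arr C" "S \<in> Sub (Cod C f)" and n: "n \<in> S"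
  shows "(\<exists>g. is_pullback m g f n) \<longleftrightarrow> m \<in> compr (Dom C f) (\<lambda>z. lies (f \<cdot> z) S)"
proof
  assume "\<exists>g. is_pullback m g f n"
  then obtain g where p: "is_pullback m g f n" by blast
  note n' = mem_Sub[OF assms(2) n]
  from p have m: "m \<in> Arr C" "Cod C m = Dom C f" and g: "g \<in> Arr C" "Dom C g = Dom C m" "Cod C g = Dom C n"
    and e: "f \<cdot> m = n \<cdot> g"
    and u: "\<And>T a b. T \<in> Obj C \<Longrightarrow> a \<in> hom C T (Dom C f) \<Longrightarrow> b \<in> hom C T (Dom C n) \<Longrightarrow> f \<cdot> a = n \<cdot> b \<Longrightarrow>
        \<exists>!u. u \<in> hom C T (Dom C m) \<and> m \<cdot> u = a \<and> g \<cdot> u = b"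
    by (auto simp: is_pullback_def hom_iff)
  have 1: "monic m"
    unfolding monic_def
  proof (intro conjI allI ballI impI m)
    fix T a b assume a: "a \<in> hom C T (Dom C m)" and b: "b \<in> hom C T (Dom C m)" and ab: "m \<cdot> a = m \<cdot> b"
    \<comment> \<open>The second leg must also agree on \<open>a\<close> and \<open>b\<close> before
      uniqueness of the mediating arrow applies; this is where \<open>n\<close> being monic
      enters.\<close>
    have "n \<cdot> (g \<cdot> a) = n \<cdot> (g \<cdot> b)"
      using a b ab m g n' e assms Cmp_assoc_Arr[of _ m f] Cmp_assoc_Arr[of _ g n] by (metis hom_iff)
    then have gab: "g \<cdot> a = g \<cdot> b"
      by (rule monicD[OF n'(1)]) (use a b g n' in \<open>auto simp: hom_iff\<close>)
    have "f \<cdot> (m \<cdot> a) = n \<cdot> (g \<cdot> a)"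
      using a m g n' e assms Cmp_assoc_Arr[of _ m f] Cmp_assoc_Arr[of _ g n] by (metis hom_iff)
    then have "\<exists>!u. u \<in> hom C T (Dom C m) \<and> m \<cdot> u = m \<cdot> a \<and> g \<cdot> u = g \<cdot> a"
      using a m g by (intro u) (auto simp: hom_iff)
    with a b ab gab show "a = b" by metis
  qed
  moreover have "factors z m = lies (f \<cdot> z) S" if z: "z \<in> Arr C" "Cod C z = Dom C f" for z
  proof -
    have "factors z m = factors (f \<cdot> z) n"
    proof
      assume "factors z m"
      then obtain w where w: "w \<in> Arr C" "Cod C w = Dom C m" "z = m \<cdot> w" using m by (elim factorsE)
      then have "f \<cdot> z = n \<cdot> (g \<cdot> w)"
        using m g n' e assms Cmp_assoc_Arr[of w m f] Cmp_assoc_Arr[of w g n] by metis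
      then show "factors (f \<cdot> z) n" using factorsI[of "g \<cdot> w" n] g w n' by simp
    next
      assume "factors (f \<cdot> z) n"
      then obtain w where w: "w \<in> Arr C" "Cod C w = Dom C n" "Dom C w = Dom C z" "f \<cdot> z = n \<cdot> w"
        using n'(2) z assms by (auto elim: factors_CmpE)
      then obtain v where "v \<in> hom C (Dom C z) (Dom C m)" "m \<cdot> v = z"
        using u[of "Dom C z" z w] z by (auto simp: hom_iff)
      then show "factors z m" using factorsI[of v m] m by (auto simp: hom_iff)
    qed
    also have "\<dots> = lies (f \<cdot> z) S" using lies_factors[OF assms(2) n] z assms by simp
    finally show ?thesis .
  qed
  ultimately show "m \<in> compr (Dom C f) (\<lambda>z. lies (f \<cdot> z) S)" using m
    by (auto simp: compr_def represents_def)
next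
  assume "m \<in> compr (Dom C f) (\<lambda>z. lies (f \<cdot> z) S)"
  then have m: "monic m" "Cod C m = Dom C f" "m \<in> Arr C"
    and r: "\<And>z. z \<in> Arr C \<Longrightarrow> Cod C z = Dom C f \<Longrightarrow> factors z m = lies (f \<cdot> z) S"
    by (auto simp: compr_def represents_def monic_Arr)
  note n' = mem_Sub[OF assms(2) n]
  note l = lies_factors[OF assms(2) n]
  have "factors (f \<cdot> m) n" using r[of m] l[of "f \<cdot> m"] m assms factors_refl by simp
  then obtain g where g: "g \<in> Arr C" "Cod C g = Dom C n" "Dom C g = Dom C m" "f \<cdot> m = n \<cdot> g"
    using n'(2) m assms by (auto elim: factors_CmpE)
  have "\<exists>!u. u \<in> hom C T (Dom C m) \<and> m \<cdot> u = a \<and> g \<cdot> u = b"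
    if T: "a \<in> hom C T (Dom C f)" "b \<in> hom C T (Dom C n)" "f \<cdot> a = n \<cdot> b" for T a b
  proof -
    have "factors (f \<cdot> a) n" using T factorsI[of b n] n' by (auto simp: hom_iff)
    moreover have "f \<cdot> a \<in> Arr C" "Cod C (f \<cdot> a) = Cod C f"
      using T(1) assms(1) by (auto simp: hom_iff)
    ultimately have "factors a m" using r[of a] l[of "f \<cdot> a"] T(1) by (simp add: hom_iff)
    then obtain v where v: "v \<in> Arr C" "Cod C v = Dom C m" "Dom C v = Dom C a" "a = m \<cdot> v"
      using m(3) by (elim factorsE)
    have Ta: "Dom C a = T" using T(1) by (simp add: hom_iff)
    have "n \<cdot> (g \<cdot> v) = n \<cdot> b"
      using T(3) v g m n' assms Cmp_assoc_Arr[of v m f] Cmp_assoc_Arr[of v g n] by metis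
    then have "g \<cdot> v = b"
      by (rule monicD[OF n'(1)]) (use T(2) v(1-3) Ta g(1-3) n'(1-3) in \<open>auto simp: hom_iff\<close>)
    moreover have "w = v" if "w \<in> hom C T (Dom C m)" "m \<cdot> w = a" for w
      by (rule monicD[OF m(1)]) (use that v Ta in \<open>auto simp: hom_iff\<close>)
    ultimately show ?thesis using v Ta unfolding hom_iff by metis
  qed
  then have "is_pullback m g f n"
    unfolding is_pullback_def
    by (intro conjI ballI impI) (use m g n'(1-3) assms(1) in \<open>simp_all add: hom_iff[of m] hom_iff[of g]\<close>)
  then show "\<exists>g. is_pullback m g f n" by blast
qed

text \<open>Both sides are empty if no pullback exists. Existence enters with
  \<open>pull_Sub\<close>.\<close>

lemma pull_eq_compr:
  assumes "f \<in> Arr C" "S \<in> Sub (Cod C f)"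
  shows "pull f S = compr (Dom C f) (\<lambda>z. lies (f \<cdot> z) S)"
proof -
  obtain n where "n \<in> S" using assms(2) Sub_nonempty by blast
  with is_pullback_iff[OF assms] show ?thesis unfolding pull_def by blast
qed

lemma self_subobj [simp]: "monic m \<Longrightarrow> m \<in> subobj m"
  by (simp add: subobj_def factors_refl monic_Arr)

lemma sub_le_subobj:
  assumes "monic m" "monic n" "Cod C m = Cod C n"
  shows "sub_le (subobj m) (subobj n) \<longleftrightarrow> factors m n"
proof
  assume "sub_le (subobj m) (subobj n)"
  then have "lies m (subobj n)" using assms self_subobj by (simp add: sub_le_def)
  then show "factors m n" using lies_subobj[of n m] assms monic_Arr[of m] by simp
next
  assume f: "factors m n"
  show "sub_le (subobj m) (subobj n)"
    unfolding sub_le_def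
  proof
    fix k assume "k \<in> subobj m"
    then have "factors k m" by (simp add: subobj_def)
    then have "factors k n" using f factors_trans assms(2) monic_Arr by blast
    then show "lies k (subobj n)" unfolding lies_def using assms(2) self_subobj by blast
  qed
qed

end

section \<open>Products, equalizers and pullbacks of subobjects from finite limits\<close>

context fin_complete
begin

lemma Fst_Snd_simps [simp]:
  assumes "X \<in> Obj B" "Y \<in> Obj B"
  shows "Prod B X Y \<in> Obj B"
    "Fst B X Y \<in> Arr B" "Dom B (Fst B X Y) = Prod B X Y" "Cod B (Fst B X Y) = X"
    "Snd B X Y \<in> Arr B" "Dom B (Snd B X Y) = Prod B X Y" "Cod B (Snd B X Y) = Y"
  using Prod_Obj[OF assms] Fst_hom[OF assms] Snd_hom[OF assms] by (auto simp: hom_iff)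

lemma pair_simps [simp]:
  assumes "f \<in> Arr B" "g \<in> Arr B" "Dom B f = Dom B g"
  shows "pair f g \<in> Arr B" "Dom B (pair f g) = Dom B g"
    "Cod B (pair f g) = Prod B (Cod B f) (Cod B g)"
    "X = Cod B f \<Longrightarrow> Y = Cod B g \<Longrightarrow> Fst B X Y \<cdot> pair f g = f"
    "X = Cod B f \<Longrightarrow> Y = Cod B g \<Longrightarrow> Snd B X Y \<cdot> pair f g = g"
  using theI'[OF Prod_univ[of f "Dom B f" "Cod B f" g "Cod B g"]] assms
  by (auto simp: hom_iff pair_def)

lemma pair_unique:
  assumes "z \<in> Arr B" "Cod B z = Prod B X Y" "X \<in> Obj B" "Y \<in> Obj B"
    "Fst B X Y \<cdot> z = f" "Snd B X Y \<cdot> z = g"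
  shows "z = pair f g"
proof -
  have f: "f \<in> Arr B" "Dom B f = Dom B z" "Cod B f = X" using assms(1-4) unfolding assms(5)[symmetric] by auto
  have g: "g \<in> Arr B" "Dom B g = Dom B z" "Cod B g = Y" using assms(1-4) unfolding assms(6)[symmetric] by auto
  have ex1: "\<exists>!h. h \<in> hom B (Dom B z) (Prod B X Y) \<and> Fst B X Y \<cdot> h = f \<and> Snd B X Y \<cdot> h = g"
    using f g by (intro Prod_univ) (simp_all add: hom_iff)
  have "z \<in> hom B (Dom B z) (Prod B X Y)" "pair f g \<in> hom B (Dom B z) (Prod B X Y)"
    using assms(1,2) f g by (simp_all add: hom_iff)
  moreover have "Fst B X Y \<cdot> pair f g = f" "Snd B X Y \<cdot> pair f g = g"
    using f g by simp_all
  ultimately show ?thesis using ex1 assms(5,6) by blast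
qed

lemma pair_eta:
  "z \<in> Arr B \<Longrightarrow> Cod B z = Prod B X Y \<Longrightarrow> X \<in> Obj B \<Longrightarrow> Y \<in> Obj B \<Longrightarrow>
    pair (Fst B X Y \<cdot> z) (Snd B X Y \<cdot> z) = z"
  using pair_unique by metis

lemma Prod_ext:
  assumes "Fst B X Y \<cdot> z = Fst B X Y \<cdot> z'" "Snd B X Y \<cdot> z = Snd B X Y \<cdot> z'"
    "z \<in> Arr B" "Cod B z = Prod B X Y" "z' \<in> Arr B" "Cod B z' = Prod B X Y" "X \<in> Obj B" "Y \<in> Obj B"
  shows "z = z'"
  using pair_eta[of z X Y] pair_eta[of z' X Y] assms by metis

lemma Prod_elem_cases:
  assumes "z \<in> Arr B" "Cod B z = Prod B X Y" "X \<in> Obj B" "Y \<in> Obj B"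
  obtains a b where "z = pair a b" "a \<in> Arr B" "b \<in> Arr B" "Dom B b = Dom B a" "Dom B a = Dom B z"
    "Cod B a = X" "Cod B b = Y"
  by (rule that[OF pair_eta[OF assms, symmetric]]) (use assms in simp_all)

lemma pair_Cmp [simp]:
  assumes "f \<in> Arr B" "g \<in> Arr B" "Dom B f = Dom B g" "t \<in> Arr B" "Cod B t = Dom B g"
  shows "pair f g \<cdot> t = pair (f \<cdot> t) (g \<cdot> t)"
proof (rule pair_unique[where X = "Cod B f" and Y = "Cod B g"])
  have "(Fst B (Cod B f) (Cod B g) \<cdot> pair f g) \<cdot> t = f \<cdot> t"
    "(Snd B (Cod B f) (Cod B g) \<cdot> pair f g) \<cdot> t = g \<cdot> t" using assms by simp_all
  with assms show "Fst B (Cod B f) (Cod B g) \<cdot> pair f g \<cdot> t = f \<cdot> t"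
    "Snd B (Cod B f) (Cod B g) \<cdot> pair f g \<cdot> t = g \<cdot> t"
    by (simp_all del: pair_simps(4,5))
qed (use assms in auto)

lemma pair_eq_iff:
  assumes "a \<in> Arr B" "b \<in> Arr B" "Dom B a = Dom B b" "a' \<in> Arr B" "b' \<in> Arr B" "Dom B a' = Dom B b'"
    "Cod B a' = Cod B a" "Cod B b' = Cod B b"
  shows "pair a b = pair a' b' \<longleftrightarrow> a = a' \<and> b = b'"
  using assms pair_simps(4,5) by metis

lemma cross_simps [simp]:
  assumes "f \<in> Arr B" "g \<in> Arr B"
  shows "cross f g \<in> Arr B" "Dom B (cross f g) = Prod B (Dom B f) (Dom B g)"
    "Cod B (cross f g) = Prod B (Cod B f) (Cod B g)"
  using assms by (auto simp: cross_def)

lemma cross_pair [simp]: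
  assumes "f \<in> Arr B" "g \<in> Arr B" "a \<in> Arr B" "b \<in> Arr B" "Dom B a = Dom B b"
    "Cod B a = Dom B f" "Cod B b = Dom B g"
  shows "cross f g \<cdot> pair a b = pair (f \<cdot> a) (g \<cdot> b)"
  using assms by (simp add: cross_def)

lemma swap_simps [simp]:
  assumes "X \<in> Obj B" "Y \<in> Obj B"
  shows "swap X Y \<in> Arr B" "Dom B (swap X Y) = Prod B X Y" "Cod B (swap X Y) = Prod B Y X"
  using assms by (auto simp: swap_def)

lemma swap_pair [simp]:
  assumes "a \<in> Arr B" "b \<in> Arr B" "Dom B a = Dom B b" "Cod B a = X" "Cod B b = Y"
  shows "swap X Y \<cdot> pair a b = pair b a"
  using assms by (auto simp: swap_def)

lemma Eql_simps [simp]: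
  assumes "f \<in> Arr B" "g \<in> Arr B" "Dom B g = Dom B f" "Cod B g = Cod B f"
  shows "Eql B f g \<in> Arr B" "Cod B (Eql B f g) = Dom B f"
  using Eql_hom[of f "Dom B f" "Cod B f" g] assms by (auto simp: hom_iff)

text \<open>The basic supply of representable predicates: solution sets of equations. Monicity is
  the uniqueness clause of the universal property.\<close>

lemma represents_Eql:
  assumes "f \<in> Arr B" "g \<in> Arr B" "Dom B g = Dom B f" "Cod B g = Cod B f"
  shows "represents (Eql B f g) (\<lambda>z. f \<cdot> z = g \<cdot> z)"
proof -
  let ?e = "Eql B f g"
  have fg: "f \<in> hom B (Dom B f) (Cod B f)" "g \<in> hom B (Dom B f) (Cod B f)"
    using assms by (auto simp: hom_iff)
  note e = Eql_simps[OF assms]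
  have eq: "f \<cdot> ?e = g \<cdot> ?e" using Eql_eq[OF fg] .
  then have eq': "f \<cdot> (?e \<cdot> w) = g \<cdot> (?e \<cdot> w)" if "w \<in> Arr B" "Cod B w = Dom B ?e" for w
    using that e assms Cmp_assoc_Arr[of w ?e f] Cmp_assoc_Arr[of w ?e g] by metis
  have "monic ?e"
    unfolding monic_def
  proof (intro conjI ballI allI impI e)
    fix T a b assume a: "a \<in> hom B T (Dom B ?e)" "b \<in> hom B T (Dom B ?e)" "?e \<cdot> a = ?e \<cdot> b"
    then have "\<exists>!u. u \<in> hom B T (Dom B ?e) \<and> ?e \<cdot> u = ?e \<cdot> a"
      using e eq'[of a] by (intro Eql_univ[OF fg]) (auto simp: hom_iff)
    with a show "a = b" by metis
  qed
  moreover have "factors z ?e" if z: "z \<in> Arr B" "Cod B z = Dom B f" "f \<cdot> z = g \<cdot> z" for z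
  proof -
    have "\<exists>!u. u \<in> hom B (Dom B z) (Dom B ?e) \<and> ?e \<cdot> u = z"
      using z by (intro Eql_univ[OF fg]) (simp_all add: hom_iff)
    then show ?thesis unfolding factors_def by blast
  qed
  moreover have "f \<cdot> z = g \<cdot> z" if fz: "factors z ?e" for z
  proof -
    obtain u where "u \<in> Arr B" "Cod B u = Dom B ?e" "z = ?e \<cdot> u"
      using fz e(1) by (elim factorsE)
    then show ?thesis using eq' by simp
  qed
  ultimately show ?thesis using e by (auto simp: represents_def)
qed

text \<open>For \<open>n\<close> in \<open>S\<close>, let \<open>?e\<close> be the equalizer of
  \<open>f\<close> and \<open>n\<close> on the product of their domains. Its first projection
  \<open>?p\<close> is the required monomorphism: the second coordinate is determined by the first,
  since \<open>n\<close> is monic.\<close>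

lemma pull:
  assumes f: "f \<in> Arr B" and S: "S \<in> Sub (Cod B f)"
  shows pull_Sub: "pull f S \<in> Sub (Dom B f)"
    and lies_pull: "z \<in> Arr B \<Longrightarrow> Cod B z = Dom B f \<Longrightarrow> lies z (pull f S) \<longleftrightarrow> lies (f \<cdot> z) S"
proof -
  obtain n where n: "n \<in> S" using S Sub_nonempty by blast
  note n' = mem_Sub[OF S n]
  let ?P = "Fst B (Dom B f) (Dom B n)" and ?Q = "Snd B (Dom B f) (Dom B n)"
  let ?e = "Eql B (f \<cdot> ?P) (n \<cdot> ?Q)"
  have e: "?e \<in> Arr B" "Cod B ?e = Prod B (Dom B f) (Dom B n)" using f n' by simp_all
  have r: "represents ?e (\<lambda>z. (f \<cdot> ?P) \<cdot> z = (n \<cdot> ?Q) \<cdot> z)"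
    using f n' by (intro represents_Eql) simp_all
  then have em: "monic ?e" by (simp add: represents_def)
  have r': "factors (pair a b) ?e \<longleftrightarrow> f \<cdot> a = n \<cdot> b"
    if "a \<in> Arr B" "b \<in> Arr B" "Dom B a = Dom B b" "Cod B a = Dom B f" "Cod B b = Dom B n" for a b
    using r that f n' e by (simp add: represents_def)
  let ?p = "?P \<cdot> ?e"
  have sq: "f \<cdot> (?P \<cdot> ?e) = n \<cdot> (?Q \<cdot> ?e)"
    using r'[of "?P \<cdot> ?e" "?Q \<cdot> ?e"] pair_eta[of ?e] factors_refl[OF e(1)] e f n' by simp
  have sq': "f \<cdot> (?P \<cdot> (?e \<cdot> u)) = n \<cdot> (?Q \<cdot> (?e \<cdot> u))" if "u \<in> Arr B" "Cod B u = Dom B ?e" for u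
    using Cmp_split_cong[OF sq, of u] that e f n' by simp
  have "monic ?p"
    unfolding monic_def
  proof (intro conjI allI ballI impI)
    fix T a b assume "a \<in> hom B T (Dom B ?p)" "b \<in> hom B T (Dom B ?p)" "?p \<cdot> a = ?p \<cdot> b"
    then have ab: "a \<in> Arr B" "Dom B a = T" "Cod B a = Dom B ?e" "b \<in> Arr B" "Dom B b = T" "Cod B b = Dom B ?e"
      and eq: "?P \<cdot> (?e \<cdot> a) = ?P \<cdot> (?e \<cdot> b)"
      using e f n' by (auto simp: hom_iff)
    have "n \<cdot> (?Q \<cdot> (?e \<cdot> a)) = n \<cdot> (?Q \<cdot> (?e \<cdot> b))"
      using sq'[of a] sq'[of b] eq ab by metis
    then have "?Q \<cdot> (?e \<cdot> a) = ?Q \<cdot> (?e \<cdot> b)"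
      by (rule monicD[OF n'(1)]) (use ab e f n' in auto)
    with eq have "?e \<cdot> a = ?e \<cdot> b"
      by (rule Prod_ext) (use ab e f n' in simp_all)
    then show "a = b" by (rule monicD[OF em]) (use ab in auto)
  qed (use e f n' in simp)
  moreover have "factors z ?p = lies (f \<cdot> z) S" if z: "z \<in> Arr B" "Cod B z = Dom B f" for z
  proof -
    have "factors z ?p = factors (f \<cdot> z) n"
    proof
      assume "factors z ?p"
      then obtain w where "w \<in> Arr B" "Cod B w = Dom B ?e" "z = ?P \<cdot> (?e \<cdot> w)"
        using e f n' by (elim factorsE) auto
      then have "f \<cdot> z = n \<cdot> (?Q \<cdot> (?e \<cdot> w))" "?Q \<cdot> (?e \<cdot> w) \<in> Arr B" "Cod B (?Q \<cdot> (?e \<cdot> w)) = Dom B n"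
        using sq' e f n' by auto
      then show "factors (f \<cdot> z) n" using factorsI n' by metis
    next
      assume "factors (f \<cdot> z) n"
      then obtain w where w: "w \<in> Arr B" "Cod B w = Dom B n" "Dom B w = Dom B z" "f \<cdot> z = n \<cdot> w"
        using n'(2) z f by (auto elim: factors_CmpE)
      then have "factors (pair z w) ?e" using r' z by auto
      then obtain v where v: "v \<in> Arr B" "Cod B v = Dom B ?e" "pair z w = ?e \<cdot> v" using e by (elim factorsE)
      then have "z = ?p \<cdot> v" using pair_simps(4)[of z w "Dom B f" "Dom B n"] w z f n' e by simp
      then show "factors z ?p" using factorsI[of v ?p] v e f n' by simp
    qed
    then show ?thesis using lies_factors[OF S n] z f by simp
  qed
  ultimately have r: "represents ?p (\<lambda>z. lies (f \<cdot> z) S)" using e f n' by (simp add: represents_def)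
  then show "pull f S \<in> Sub (Dom B f)"
    using represented(1)[OF r] pull_eq_compr[OF f S] e f n' by simp
  show "lies z (pull f S) \<longleftrightarrow> lies (f \<cdot> z) S" if "z \<in> Arr B" "Cod B z = Dom B f"
    using represented(2)[OF r, of z] that pull_eq_compr[OF f S] e f n' by simp
qed

text \<open>The intersection is \<open>m \<cdot> k\<close>, with \<open>m\<close> a representative
  of \<open>R\<close> and \<open>k\<close> a representative of the pullback of \<open>S\<close>
  along \<open>m\<close>.\<close>

lemma Sub_meet:
  assumes "R \<in> Sub Z" "S \<in> Sub Z"
  obtains M where "M \<in> Sub Z" "\<And>z. z \<in> Arr B \<Longrightarrow> Cod B z = Z \<Longrightarrow> lies z M \<longleftrightarrow> lies z R \<and> lies z S"
proof -
  obtain m where "m \<in> R" using assms(1) Sub_nonempty by blast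
  note m = this mem_Sub[OF assms(1) this]
  have P: "pull m S \<in> Sub (Dom B m)" using pull_Sub[of m S] m assms by simp
  then obtain k where "k \<in> pull m S" using Sub_nonempty by blast
  note k = this mem_Sub[OF P this]
  have mk: "m \<cdot> k \<in> Arr B" "Cod B (m \<cdot> k) = Z" "Dom B (m \<cdot> k) = Dom B k" using m k by auto
  have "monic (m \<cdot> k)"
    unfolding monic_def
  proof (intro conjI allI ballI impI)
    fix T a b assume ab: "a \<in> hom B T (Dom B (m \<cdot> k))" "b \<in> hom B T (Dom B (m \<cdot> k))" "(m \<cdot> k) \<cdot> a = (m \<cdot> k) \<cdot> b"
    then have "m \<cdot> (k \<cdot> a) = m \<cdot> (k \<cdot> b)" using m k by (auto simp: hom_iff)
    then have "k \<cdot> a = k \<cdot> b" by (rule monicD[OF m(2)]) (use ab m k in \<open>auto simp: hom_iff\<close>)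
    then show "a = b" by (rule monicD[OF k(2)]) (use ab m k in \<open>auto simp: hom_iff\<close>)
  qed (use mk in simp)
  moreover have "factors z (m \<cdot> k) \<longleftrightarrow> lies z R \<and> lies z S" if z: "z \<in> Arr B" "Cod B z = Z" for z
  proof -
    have "lies z R \<longleftrightarrow> factors z m" using lies_factors[OF assms(1) m(1)] z by simp
    moreover have "factors z (m \<cdot> k) \<longleftrightarrow> factors z m \<and> lies z S"
    proof
      assume "factors z (m \<cdot> k)"
      then obtain w where w: "w \<in> Arr B" "Cod B w = Dom B k" "z = m \<cdot> (k \<cdot> w)"
        using m k mk by (elim factorsE) auto
      then have "lies (k \<cdot> w) (pull m S)" using lies_factors[OF P k(1), of "k \<cdot> w"] factorsI[of w k] k by simp
      then show "factors z m \<and> lies z S"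
        using lies_pull[of m S "k \<cdot> w"] m k w assms factorsI[of "k \<cdot> w" m] by simp
    next
      assume a: "factors z m \<and> lies z S"
      then obtain w where w: "w \<in> Arr B" "Cod B w = Dom B m" "z = m \<cdot> w"
        using m by (auto elim: factorsE)
      then have "factors w k" using a lies_pull[of m S w] lies_factors[OF P k(1), of w] m assms by simp
      then obtain v where v: "v \<in> Arr B" "Cod B v = Dom B k" "w = k \<cdot> v" using k by (auto elim: factorsE)
      then show "factors z (m \<cdot> k)" using factorsI[of v "m \<cdot> k"] m k mk w by simp
    qed
    ultimately show ?thesis by simp
  qed
  ultimately have "represents (m \<cdot> k) (\<lambda>z. lies z R \<and> lies z S)" using mk by (simp add: represents_def)
  from represented[OF this] mk show thesis by (intro that[of "compr Z (\<lambda>z. lies z R \<and> lies z S)"]) simp_all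
qed

end

section \<open>Power objects\<close>

context topos
begin

lemma Pwr_Obj' [simp]: "X \<in> Obj B \<Longrightarrow> Pwr B X \<in> Obj B"
  by (rule Pwr_Obj)

lemma Mem_simps [simp]:
  assumes "X \<in> Obj B"
  shows "monic (Mem B X)" "Mem B X \<in> Arr B" "Cod B (Mem B X) = Prod B (Pwr B X) X"
    "subobj (Mem B X) \<in> Sub (Prod B (Pwr B X) X)"
  using Mem_monic[OF assms] Mem_Cod[OF assms] monic_Arr by (auto simp: Sub_iff)

text \<open>The set comes first in the pair because \<open>Mem B X\<close> is a monomorphism into
  \<wp>X \<times> X.\<close>

definition mem :: "'m \<Rightarrow> 'm \<Rightarrow> bool" where
  "mem x a \<longleftrightarrow> factors (pair a x) (Mem B (Cod B x))"

lemma lies_Mem: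
  assumes "a \<in> Arr B" "x \<in> Arr B" "Dom B a = Dom B x" "Cod B x = X" "Cod B a = Pwr B X"
  shows "lies (pair a x) (subobj (Mem B X)) \<longleftrightarrow> mem x a"
  using assms lies_subobj[of "Mem B X" "pair a x"] by (auto simp: mem_def)

lemma mem_Cmp:
  assumes "mem x a" "a \<in> Arr B" "x \<in> Arr B" "t \<in> Arr B" "Dom B a = Dom B x" "Cod B t = Dom B x"
  shows "mem (x \<cdot> t) (a \<cdot> t)"
  using assms factors_Cmp[of "pair a x" "Mem B (Cod B x)" t] by (simp add: mem_def)

lemma rel_Sub [simp]:
  assumes "g \<in> Arr B" "Cod B g = Pwr B X" "X \<in> Obj B"
  shows "rel X g \<in> Sub (Prod B (Dom B g) X)"
  using assms pull_Sub[of "cross g (Ide B X)" "subobj (Mem B X)"] by (simp add: rel_def)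

lemma lies_rel:
  assumes "g \<in> Arr B" "Cod B g = Pwr B X" "t \<in> Arr B" "x \<in> Arr B" "Dom B t = Dom B x"
    "Cod B t = Dom B g" "Cod B x = X"
  shows "lies (pair t x) (rel X g) \<longleftrightarrow> mem x (g \<cdot> t)"
proof -
  have X: "X \<in> Obj B" using assms by auto
  show ?thesis
    using assms X lies_pull[of "cross g (Ide B X)" "subobj (Mem B X)" "pair t x"]
      lies_Mem[of "g \<cdot> t" x X] by (simp add: rel_def)
qed

text \<open>Restates \<open>Pwr_univ\<close> for equivalence classes: a pullback square on a
  representative \<open>r\<close> exists iff \<open>r\<close> is a member of \<open>rel X g\<close>,
  and a subobject is determined by any of its members.\<close>

lemma rel_bij:
  assumes "X \<in> Obj B" "Y \<in> Obj B" "R \<in> Sub (Prod B Y X)"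
  shows "\<exists>!g. g \<in> hom B Y (Pwr B X) \<and> rel X g = R"
proof -
  obtain r where "r \<in> R" using assms(3) Sub_nonempty by blast
  note r = this mem_Sub[OF assms(3) this]
  have "rel X g = R \<longleftrightarrow> (\<exists>h. is_pullback r h (cross g (Ide B X)) (Mem B X))"
    if g: "g \<in> hom B Y (Pwr B X)" for g
  proof -
    have g': "g \<in> Arr B" "Dom B g = Y" "Cod B g = Pwr B X" using g by (auto simp: hom_iff)
    let ?c = "cross g (Ide B X)"
    have c: "?c \<in> Arr B" "subobj (Mem B X) \<in> Sub (Cod B ?c)" "Mem B X \<in> subobj (Mem B X)"
      using g' assms by simp_all
    have "(\<exists>h. is_pullback r h ?c (Mem B X)) \<longleftrightarrow> r \<in> rel X g"
      unfolding is_pullback_iff[OF c] rel_def using pull_eq_compr[OF c(1,2)] by simp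
    moreover have "rel X g \<in> Sub (Prod B Y X)" using g' assms(1) rel_Sub[of g X] by simp
    then have "r \<in> rel X g \<longleftrightarrow> rel X g = R" using r mem_Sub by metis
    ultimately show ?thesis by blast
  qed
  with Pwr_univ[OF assms(1,2), of r] r show ?thesis by (metis (no_types, lifting))
qed

lemma classify [simp]:
  assumes "R \<in> Sub (Prod B Y X)" "X \<in> Obj B" "Y \<in> Obj B"
  shows "classify Y X R \<in> Arr B" "Dom B (classify Y X R) = Y" "Cod B (classify Y X R) = Pwr B X"
    "rel X (classify Y X R) = R"
  using theI'[OF rel_bij[OF assms(2,3,1)]] by (auto simp: classify_def hom_iff)

lemma mem_classify:
  assumes "R \<in> Sub (Prod B Y X)" "t \<in> Arr B" "x \<in> Arr B" "Dom B t = Dom B x" "Cod B t = Y" "Cod B x = X"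
  shows "mem x (classify Y X R \<cdot> t) \<longleftrightarrow> lies (pair t x) R"
proof -
  have "X \<in> Obj B" "Y \<in> Obj B" using assms by auto
  then show ?thesis using lies_rel[of "classify Y X R" X t x] assms by simp
qed

lemma classify_unique:
  assumes "g \<in> Arr B" "Dom B g = Y" "Cod B g = Pwr B X" "rel X g = R" "X \<in> Obj B"
  shows "classify Y X R = g"
proof -
  have "Y \<in> Obj B" using assms by auto
  then have "\<exists>!g. g \<in> hom B Y (Pwr B X) \<and> rel X g = R"
    using assms rel_bij[of X Y R] rel_Sub[of g X] by auto
  then show ?thesis
    unfolding classify_def using assms by (intro the1_equality) (auto simp: hom_iff)
qed

text \<open>A generalized element of \<open>rel X a\<close> consists of a change of stage
  \<open>t\<close> into the domain of \<open>a\<close> and an element \<open>x\<close> of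
  \<open>X\<close> at the new stage. Inclusion therefore quantifies over all later stages, as the
  Kripke-Joyal reading of a universal quantifier demands.\<close>

lemma sub_le_rel:
  assumes "a \<in> Arr B" "b \<in> Arr B" "Dom B b = Dom B a" "Cod B a = Pwr B X" "Cod B b = Pwr B X" "X \<in> Obj B"
  shows "sub_le (rel X a) (rel X b) \<longleftrightarrow>
    (\<forall>t x. t \<in> Arr B \<longrightarrow> x \<in> Arr B \<longrightarrow> Dom B t = Dom B x \<longrightarrow> Cod B t = Dom B a \<longrightarrow> Cod B x = X \<longrightarrow>
      mem x (a \<cdot> t) \<longrightarrow> mem x (b \<cdot> t))" (is "?L \<longleftrightarrow> ?R")
proof -
  have S: "rel X a \<in> Sub (Prod B (Dom B a) X)" "rel X b \<in> Sub (Prod B (Dom B a) X)"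
    using assms rel_Sub[of a X] rel_Sub[of b X] by simp_all
  show ?thesis
    unfolding sub_le_iff[OF S]
  proof (intro iffI allI impI ballI)
    fix t x assume *: "\<forall>z\<in>Arr B. Cod B z = Prod B (Dom B a) X \<longrightarrow> lies z (rel X a) \<longrightarrow> lies z (rel X b)"
      and t: "t \<in> Arr B" "x \<in> Arr B" "Dom B t = Dom B x" "Cod B t = Dom B a" "Cod B x = X" "mem x (a \<cdot> t)"
    have "lies (pair t x) (rel X a)" using lies_rel[of a X t x] t assms by simp
    then have "lies (pair t x) (rel X b)" using *[rule_format, of "pair t x"] t by simp
    then show "mem x (b \<cdot> t)" using lies_rel[of b X t x] t assms by simp
  next
    fix z assume *: ?R and z: "z \<in> Arr B" "Cod B z = Prod B (Dom B a) X" "lies z (rel X a)"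
    obtain t x where t: "z = pair t x" "t \<in> Arr B" "x \<in> Arr B" "Dom B x = Dom B t" "Cod B t = Dom B a" "Cod B x = X"
      using Prod_elem_cases[OF z(1,2)] assms by (metis Dom_Cod_Obj(1))
    have "mem x (a \<cdot> t)" using z(3) lies_rel[of a X t x] t assms by simp
    then have "mem x (b \<cdot> t)" using *[rule_format, of t x] t by simp
    then show "lies z (rel X b)" using lies_rel[of b X t x] t assms by simp
  qed
qed

lemma Pwr_ext:
  assumes "a \<in> Arr B" "b \<in> Arr B" "Dom B b = Dom B a" "Cod B a = Pwr B X" "Cod B b = Pwr B X" "X \<in> Obj B"
    and mem: "\<And>t x. t \<in> Arr B \<Longrightarrow> x \<in> Arr B \<Longrightarrow> Dom B t = Dom B x \<Longrightarrow> Cod B t = Dom B a \<Longrightarrow> Cod B x = X \<Longrightarrow>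
      mem x (a \<cdot> t) \<longleftrightarrow> mem x (b \<cdot> t)"
  shows "a = b"
proof -
  have S: "rel X a \<in> Sub (Prod B (Dom B a) X)" "rel X b \<in> Sub (Prod B (Dom B a) X)"
    using assms rel_Sub[of a X] rel_Sub[of b X] by simp_all
  have "sub_le (rel X a) (rel X b)" "sub_le (rel X b) (rel X a)"
    using assms(1-6) mem by (simp_all add: sub_le_rel)
  then have "rel X a = rel X b"
    by (intro Sub_ext[OF S]) (auto simp: sub_le_iff[OF S] sub_le_iff[OF S(2,1)])
  then show "a = b"
    using classify_unique[of a "Dom B a" X] classify_unique[of b "Dom B a" X] assms(1-6) by metis
qed

text \<open>Since a \<subseteq> b iff a \<inter> b = a, inclusion is the solution set of an
  equation, hence representable, as soon as intersection is available as an arrow on \<wp>X \<times>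
  \<wp>X.\<close>

lemma incl:
  assumes X: "X \<in> Obj B"
  shows incl_Sub: "incl X \<in> Sub (Prod B (Pwr B X) (Pwr B X))"
    and lies_incl: "a \<in> Arr B \<Longrightarrow> b \<in> Arr B \<Longrightarrow> Dom B b = Dom B a \<Longrightarrow> Cod B a = Pwr B X \<Longrightarrow> Cod B b = Pwr B X \<Longrightarrow>
      lies (pair a b) (incl X) \<longleftrightarrow> sub_le (rel X a) (rel X b)"
proof -
  let ?P = "Pwr B X" let ?W = "Prod B ?P ?P" let ?p = "Fst B ?P ?P" let ?q = "Snd B ?P ?P"
  let ?\<phi> = "\<lambda>c. sub_le (rel X (?p \<cdot> c)) (rel X (?q \<cdot> c))"
  have S: "rel X ?p \<in> Sub (Prod B ?W X)" "rel X ?q \<in> Sub (Prod B ?W X)"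
    using X rel_Sub[of ?p X] rel_Sub[of ?q X] by simp_all
  obtain M where M: "M \<in> Sub (Prod B ?W X)"
    and lM: "\<And>z. z \<in> Arr B \<Longrightarrow> Cod B z = Prod B ?W X \<Longrightarrow> lies z M \<longleftrightarrow> lies z (rel X ?p) \<and> lies z (rel X ?q)"
    using Sub_meet[OF S] by metis
  \<comment> \<open>The intersection arrow: \<open>M\<close> relates a pair of subsets to the
    elements lying in both.\<close>
  let ?u = "classify ?W X M"
  let ?e = "Eql B ?u ?p"
  have e: "?e \<in> Arr B" "Cod B ?e = ?W" using X M by simp_all
  have mem: "mem x (?u \<cdot> (c \<cdot> t)) \<longleftrightarrow> mem x (?p \<cdot> (c \<cdot> t)) \<and> mem x (?q \<cdot> (c \<cdot> t))"
    if "c \<in> Arr B" "Cod B c = ?W" "t \<in> Arr B" "x \<in> Arr B" "Dom B t = Dom B x" "Cod B t = Dom B c" "Cod B x = X" for c t x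
    using that X M mem_classify[of M ?W X "c \<cdot> t" x] lM[of "pair (c \<cdot> t) x"]
      lies_rel[of ?p X "c \<cdot> t" x] lies_rel[of ?q X "c \<cdot> t" x] by simp
  have "?u \<cdot> c = ?p \<cdot> c \<longleftrightarrow> ?\<phi> c" if c: "c \<in> Arr B" "Cod B c = ?W" for c
  proof
    assume eq: "?u \<cdot> c = ?p \<cdot> c"
    show "?\<phi> c"
    proof (subst sub_le_rel)
      show "\<forall>t x. t \<in> Arr B \<longrightarrow> x \<in> Arr B \<longrightarrow> Dom B t = Dom B x \<longrightarrow> Cod B t = Dom B (?p \<cdot> c) \<longrightarrow> Cod B x = X \<longrightarrow>
        mem x ((?p \<cdot> c) \<cdot> t) \<longrightarrow> mem x ((?q \<cdot> c) \<cdot> t)"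
      proof (intro allI impI)
        fix t x assume t: "t \<in> Arr B" "x \<in> Arr B" "Dom B t = Dom B x" "Cod B t = Dom B (?p \<cdot> c)" "Cod B x = X" "mem x ((?p \<cdot> c) \<cdot> t)"
        then have "?u \<cdot> (c \<cdot> t) = ?p \<cdot> (c \<cdot> t)"
          using Cmp_split_cong[OF eq, of t] c X M by simp
        with t mem[of c t x] c X show "mem x ((?q \<cdot> c) \<cdot> t)" by simp
      qed
    qed (use c X in auto)
  next
    assume "?\<phi> c"
    then have *: "mem x (?p \<cdot> (c \<cdot> t)) \<Longrightarrow> mem x (?q \<cdot> (c \<cdot> t))"
      if "t \<in> Arr B" "x \<in> Arr B" "Dom B t = Dom B x" "Cod B t = Dom B c" "Cod B x = X" for t x
      using that c X by (simp add: sub_le_rel)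
    show "?u \<cdot> c = ?p \<cdot> c"
    proof (rule Pwr_ext[where X = X])
      fix t x assume t: "t \<in> Arr B" "x \<in> Arr B" "Dom B t = Dom B x" "Cod B t = Dom B (?u \<cdot> c)" "Cod B x = X"
      then show "mem x ((?u \<cdot> c) \<cdot> t) \<longleftrightarrow> mem x ((?p \<cdot> c) \<cdot> t)"
        using mem[of c t x] *[of t x] c X M by auto
    qed (use c X M in simp_all)
  qed
  moreover have "represents ?e (\<lambda>c. ?u \<cdot> c = ?p \<cdot> c)"
    using X M by (intro represents_Eql) simp_all
  ultimately have r: "represents ?e ?\<phi>" using e by (simp add: represents_def)
  have i: "incl X = compr ?W ?\<phi>"
    unfolding incl_def compr_def represents_def by auto
  show "incl X \<in> Sub ?W" using represented(1)[OF r] e i by simp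
  show "lies (pair a b) (incl X) \<longleftrightarrow> sub_le (rel X a) (rel X b)"
    if "a \<in> Arr B" "b \<in> Arr B" "Dom B b = Dom B a" "Cod B a = ?P" "Cod B b = ?P"
    using represented(2)[OF r, of "pair a b"] e i that by simp
qed

lemma car_pwr_ord [simp]: "car (pwr_ord X) = Pwr B X"
  by (simp add: pwr_ord_def)

lemma le_pwr_ord:
  assumes "a \<in> Arr B" "b \<in> Arr B" "Dom B b = Dom B a" "Cod B a = Pwr B X" "Cod B b = Pwr B X" "X \<in> Obj B"
  shows "le (pwr_ord X) a b \<longleftrightarrow> sub_le (rel X a) (rel X b)"
  using lies_incl[OF assms(6,1-5)] by (simp add: le_def pwr_ord_def)

lemma le_pwr_ordI:
  assumes "a \<in> Arr B" "b \<in> Arr B" "Dom B b = Dom B a" "Cod B a = Pwr B X" "Cod B b = Pwr B X" "X \<in> Obj B"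
    and "\<And>t x. t \<in> Arr B \<Longrightarrow> x \<in> Arr B \<Longrightarrow> Dom B t = Dom B x \<Longrightarrow> Cod B t = Dom B a \<Longrightarrow> Cod B x = X \<Longrightarrow>
      mem x (a \<cdot> t) \<Longrightarrow> mem x (b \<cdot> t)"
  shows "le (pwr_ord X) a b"
  using assms by (simp add: le_pwr_ord sub_le_rel)

lemma le_pwr_ordD:
  assumes "le (pwr_ord X) a b" "mem x (a \<cdot> t)"
    "a \<in> Arr B" "b \<in> Arr B" "Dom B b = Dom B a" "Cod B a = Pwr B X" "Cod B b = Pwr B X"
    "t \<in> Arr B" "x \<in> Arr B" "Dom B t = Dom B x" "Cod B t = Dom B a" "Cod B x = X"
  shows "mem x (b \<cdot> t)"
proof -
  have "X \<in> Obj B" using assms by auto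
  with assms show ?thesis by (simp add: le_pwr_ord sub_le_rel)
qed

lemma le_pwr_ordD_Ide:
  assumes "le (pwr_ord X) a b" "mem x a"
    "a \<in> Arr B" "b \<in> Arr B" "Dom B b = Dom B a" "Cod B a = Pwr B X" "Cod B b = Pwr B X"
    "x \<in> Arr B" "Dom B x = Dom B a" "Cod B x = X"
  shows "mem x b"
  using le_pwr_ordD[OF assms(1), of x "Ide B (Dom B a)"] assms by simp

section \<open>Internal preorders and adjunctions\<close>

lemma preorder_Obj: "is_preorder P \<Longrightarrow> car P \<in> Obj B"
  by (simp add: is_preorder_def)

lemma preorder_Sub: "is_preorder P \<Longrightarrow> leq P \<in> Sub (Prod B (car P) (car P))"
  by (simp add: is_preorder_def)

lemma le_refl:
  assumes "is_preorder P" "a \<in> Arr B" "Cod B a = car P"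
  shows "le P a a"
proof -
  have "a \<in> hom B (Dom B a) (car P)" "Dom B a \<in> Obj B"
    using assms by (simp_all add: hom_iff)
  with assms(1) show ?thesis unfolding is_preorder_def by blast
qed

lemma le_trans:
  assumes "le P a b" "le P b c" "is_preorder P" "a \<in> Arr B" "b \<in> Arr B" "c \<in> Arr B"
    "Dom B b = Dom B a" "Dom B c = Dom B a" "Cod B a = car P" "Cod B b = car P" "Cod B c = car P"
  shows "le P a c"
proof -
  have "a \<in> hom B (Dom B a) (car P)" "b \<in> hom B (Dom B a) (car P)" "c \<in> hom B (Dom B a) (car P)" "Dom B a \<in> Obj B"
    using assms by (simp_all add: hom_iff)
  with assms(1-3) show ?thesis unfolding is_preorder_def by blast
qed

lemma le_Cmp:
  assumes "le P a b" "is_preorder P" "a \<in> Arr B" "b \<in> Arr B" "Dom B b = Dom B a"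
    "Cod B a = car P" "Cod B b = car P" "t \<in> Arr B" "Cod B t = Dom B a"
  shows "le P (a \<cdot> t) (b \<cdot> t)"
  using assms lies_Cmp[of "pair a b" "leq P" "Prod B (car P) (car P)" t]
  by (simp add: le_def preorder_Sub)

lemma is_preorderI:
  assumes "car P \<in> Obj B" "leq P \<in> Sub (Prod B (car P) (car P))"
    and "\<And>a. a \<in> Arr B \<Longrightarrow> Cod B a = car P \<Longrightarrow> le P a a"
    and "\<And>a b c. le P a b \<Longrightarrow> le P b c \<Longrightarrow> a \<in> Arr B \<Longrightarrow> b \<in> Arr B \<Longrightarrow> c \<in> Arr B \<Longrightarrow>
      Dom B b = Dom B a \<Longrightarrow> Dom B c = Dom B a \<Longrightarrow> Cod B a = car P \<Longrightarrow> Cod B b = car P \<Longrightarrow> Cod B c = car P \<Longrightarrow> le P a c"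
  shows "is_preorder P"
  unfolding is_preorder_def
proof (intro conjI ballI impI assms(1,2))
  fix T a b c assume h: "a \<in> hom B T (car P)" "b \<in> hom B T (car P)" "c \<in> hom B T (car P)" "le P a b" "le P b c"
  show "le P a c"
    by (rule assms(4)[OF h(4,5)]) (use h(1-3) in \<open>auto simp: hom_iff\<close>)
qed (use assms(3) in \<open>auto simp: hom_iff\<close>)

text \<open>In a preorder adjoints are unique only up to order-equivalence. Powers and their
  opposites satisfy this additional condition, which turns the equivalence into equality.\<close>

definition antisymmetric :: "('o, 'm) preord \<Rightarrow> bool" where
  "antisymmetric P \<longleftrightarrow> (\<forall>a \<in> Arr B. \<forall>b \<in> Arr B. Dom B b = Dom B a \<longrightarrow> Cod B a = car P \<longrightarrow> Cod B b = car P \<longrightarrow>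
    le P a b \<longrightarrow> le P b a \<longrightarrow> a = b)"

lemma antisymmetricD:
  "antisymmetric P \<Longrightarrow> le P a b \<Longrightarrow> le P b a \<Longrightarrow> a \<in> Arr B \<Longrightarrow> b \<in> Arr B \<Longrightarrow> Dom B b = Dom B a \<Longrightarrow>
    Cod B a = car P \<Longrightarrow> Cod B b = car P \<Longrightarrow> a = b"
  unfolding antisymmetric_def by blast

lemma car_opp [simp]: "car (opp P) = car P"
  by (simp add: opp_def)

lemma le_opp:
  assumes "is_preorder P" "a \<in> Arr B" "b \<in> Arr B" "Dom B b = Dom B a" "Cod B a = car P" "Cod B b = car P"
  shows "le (opp P) a b \<longleftrightarrow> le P b a"
  using assms preorder_Obj[OF assms(1)] preorder_Sub[OF assms(1)]
    lies_pull[of "swap (car P) (car P)" "leq P" "pair a b"]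
  by (simp add: le_def opp_def)

lemma is_preorder_opp:
  assumes P: "is_preorder P" shows "is_preorder (opp P)"
proof (rule is_preorderI)
  show "leq (opp P) \<in> Sub (Prod B (car (opp P)) (car (opp P)))"
    using pull_Sub[of "swap (car P) (car P)" "leq P"] preorder_Obj[OF P] preorder_Sub[OF P]
    by (simp add: opp_def)
  fix a b c assume a: "le (opp P) a b" "le (opp P) b c" "a \<in> Arr B" "b \<in> Arr B" "c \<in> Arr B"
      "Dom B b = Dom B a" "Dom B c = Dom B a" "Cod B a = car (opp P)" "Cod B b = car (opp P)" "Cod B c = car (opp P)"
  then have "le P c b" "le P b a" using le_opp[OF P] by simp_all
  then have "le P c a" by (rule le_trans) (use a P in simp_all)
  then show "le (opp P) a c" using le_opp[OF P] a by simp
qed (use P in \<open>auto simp: le_opp le_refl preorder_Obj\<close>)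

lemma antisymmetric_opp: "is_preorder P \<Longrightarrow> antisymmetric P \<Longrightarrow> antisymmetric (opp P)"
  unfolding antisymmetric_def by (simp add: le_opp)

lemma is_preorder_pwr_ord [simp]:
  assumes X: "X \<in> Obj B" shows "is_preorder (pwr_ord X)"
proof (rule is_preorderI)
  show "leq (pwr_ord X) \<in> Sub (Prod B (car (pwr_ord X)) (car (pwr_ord X)))"
    using incl_Sub[OF X] by (simp add: pwr_ord_def)
next
  fix a assume "a \<in> Arr B" "Cod B a = car (pwr_ord X)"
  with X show "le (pwr_ord X) a a" by (intro le_pwr_ordI) simp_all
next
  fix a b c assume a: "le (pwr_ord X) a b" "le (pwr_ord X) b c" "a \<in> Arr B" "b \<in> Arr B" "c \<in> Arr B"
    "Dom B b = Dom B a" "Dom B c = Dom B a" "Cod B a = car (pwr_ord X)" "Cod B b = car (pwr_ord X)" "Cod B c = car (pwr_ord X)"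
  show "le (pwr_ord X) a c"
  proof (rule le_pwr_ordI)
    fix t x assume t: "t \<in> Arr B" "x \<in> Arr B" "Dom B t = Dom B x" "Cod B t = Dom B a" "Cod B x = X" "mem x (a \<cdot> t)"
    have "mem x (b \<cdot> t)" by (rule le_pwr_ordD[OF a(1)]) (use a t in simp_all)
    then show "mem x (c \<cdot> t)" by (rule le_pwr_ordD[OF a(2)]) (use a t in simp_all)
  qed (use a X in simp_all)
qed (use X in simp)

lemma antisymmetric_pwr_ord:
  assumes X: "X \<in> Obj B" shows "antisymmetric (pwr_ord X)"
  unfolding antisymmetric_def
proof (intro ballI impI)
  fix a b assume a: "a \<in> Arr B" "b \<in> Arr B" "Dom B b = Dom B a" "Cod B a = car (pwr_ord X)" "Cod B b = car (pwr_ord X)"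
    "le (pwr_ord X) a b" "le (pwr_ord X) b a"
  show "a = b"
  proof (rule Pwr_ext[where X = X])
    fix t x assume t: "t \<in> Arr B" "x \<in> Arr B" "Dom B t = Dom B x" "Cod B t = Dom B a" "Cod B x = X"
    show "mem x (a \<cdot> t) = mem x (b \<cdot> t)"
      using le_pwr_ordD[OF a(6), of x t] le_pwr_ordD[OF a(7), of x t] a t by auto
  qed (use a X in simp_all)
qed

section \<open>Adjunctions, Galois conditions and uniqueness of adjoints\<close>

lemma is_adj_simps:
  assumes "is_adj P Q g"
  shows "is_preorder P" "is_preorder Q" "car P \<in> Obj B" "car Q \<in> Obj B"
    "lft g \<in> Arr B" "Dom B (lft g) = car P" "Cod B (lft g) = car Q"
    "rgt g \<in> Arr B" "Dom B (rgt g) = car Q" "Cod B (rgt g) = car P"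
  using assms preorder_Obj unfolding is_adj_def is_monotone_def hom_iff by blast+

lemma is_monotoneD:
  assumes "is_monotone P Q f" "le P a b" "a \<in> Arr B" "b \<in> Arr B" "Dom B b = Dom B a" "Cod B a = car P" "Cod B b = car P"
  shows "le Q (f \<cdot> a) (f \<cdot> b)"
proof -
  have "a \<in> hom B (Dom B a) (car P)" "b \<in> hom B (Dom B a) (car P)" "Dom B a \<in> Obj B"
    using assms by (simp_all add: hom_iff)
  with assms(1,2) show ?thesis unfolding is_monotone_def by blast
qed

lemma adj_mono:
  assumes "is_adj P Q g" "a \<in> Arr B" "b \<in> Arr B" "Dom B b = Dom B a"
  shows "le P a b \<Longrightarrow> Cod B a = car P \<Longrightarrow> Cod B b = car P \<Longrightarrow> le Q (lft g \<cdot> a) (lft g \<cdot> b)"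
    and "le Q a b \<Longrightarrow> Cod B a = car Q \<Longrightarrow> Cod B b = car Q \<Longrightarrow> le P (rgt g \<cdot> a) (rgt g \<cdot> b)"
  using assms is_monotoneD unfolding is_adj_def by blast+

lemma adj_unit:
  assumes g: "is_adj P Q g" and a: "a \<in> Arr B" "Cod B a = car P"
  shows "le P a (rgt g \<cdot> (lft g \<cdot> a))"
proof -
  note s = is_adj_simps[OF g]
  have "le P (Ide B (car P)) (rgt g \<cdot> lft g)" using g by (simp add: is_adj_def)
  then have "le P (Ide B (car P) \<cdot> a) ((rgt g \<cdot> lft g) \<cdot> a)"
    by (rule le_Cmp) (use s a in simp_all)
  with s a show ?thesis by simp
qed

lemma adj_counit:
  assumes g: "is_adj P Q g" and a: "a \<in> Arr B" "Cod B a = car Q"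
  shows "le Q (lft g \<cdot> (rgt g \<cdot> a)) a"
proof -
  note s = is_adj_simps[OF g]
  have "le Q (lft g \<cdot> rgt g) (Ide B (car Q))" using g by (simp add: is_adj_def)
  then have "le Q ((lft g \<cdot> rgt g) \<cdot> a) (Ide B (car Q) \<cdot> a)"
    by (rule le_Cmp) (use s a in simp_all)
  with s a show ?thesis by simp
qed

lemma adj_galois:
  assumes g: "is_adj P Q g" and a: "a \<in> Arr B" "b \<in> Arr B" "Dom B b = Dom B a" "Cod B a = car P" "Cod B b = car Q"
  shows "le Q (lft g \<cdot> a) b \<longleftrightarrow> le P a (rgt g \<cdot> b)"
proof
  note s = is_adj_simps[OF g]
  assume "le Q (lft g \<cdot> a) b"
  then have "le P (rgt g \<cdot> (lft g \<cdot> a)) (rgt g \<cdot> b)"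
    by (intro adj_mono[OF g]) (use s a in simp_all)
  then show "le P a (rgt g \<cdot> b)"
    by (rule le_trans[OF adj_unit[OF g a(1,4)]]) (use s a in simp_all)
next
  note s = is_adj_simps[OF g]
  assume "le P a (rgt g \<cdot> b)"
  then have "le Q (lft g \<cdot> a) (lft g \<cdot> (rgt g \<cdot> b))"
    by (intro adj_mono[OF g]) (use s a in simp_all)
  then show "le Q (lft g \<cdot> a) b"
    by (rule le_trans[OF _ adj_counit[OF g a(2,5)]]) (use s a in simp_all)
qed

text \<open>The Galois condition at all stages is enough: its instances at
  \<open>lft g \<cdot> a\<close> and \<open>rgt g \<cdot> a\<close> are the unit and the counit, and
  monotonicity follows from these by transitivity.\<close>

lemma is_adjI:
  assumes P: "is_preorder P" and Q: "is_preorder Q"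
    and l: "lft g \<in> Arr B" "Dom B (lft g) = car P" "Cod B (lft g) = car Q"
    and r: "rgt g \<in> Arr B" "Dom B (rgt g) = car Q" "Cod B (rgt g) = car P"
    and gal: "\<And>a b. a \<in> Arr B \<Longrightarrow> b \<in> Arr B \<Longrightarrow> Dom B b = Dom B a \<Longrightarrow> Cod B a = car P \<Longrightarrow> Cod B b = car Q \<Longrightarrow>
      le Q (lft g \<cdot> a) b \<longleftrightarrow> le P a (rgt g \<cdot> b)"
  shows "is_adj P Q g"
proof -
  have o: "car P \<in> Obj B" "car Q \<in> Obj B" using P Q by (simp_all add: preorder_Obj)
  have unit: "le P a (rgt g \<cdot> (lft g \<cdot> a))" if "a \<in> Arr B" "Cod B a = car P" for a
    using gal[of a "lft g \<cdot> a"] that l r Q by (simp add: le_refl)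
  have counit: "le Q (lft g \<cdot> (rgt g \<cdot> a)) a" if "a \<in> Arr B" "Cod B a = car Q" for a
    using gal[of "rgt g \<cdot> a" a] that l r P by (simp add: le_refl)
  have "is_monotone P Q (lft g)"
    unfolding is_monotone_def
  proof (intro conjI ballI impI)
    fix T a b assume "a \<in> hom B T (car P)" "b \<in> hom B T (car P)" and ab: "le P a b"
    then have s: "a \<in> Arr B" "b \<in> Arr B" "Dom B b = Dom B a" "Cod B a = car P" "Cod B b = car P"
      by (simp_all add: hom_iff)
    have "le P a (rgt g \<cdot> (lft g \<cdot> b))"
      by (rule le_trans[OF ab unit]) (use s l r P in simp_all)
    then show "le Q (lft g \<cdot> a) (lft g \<cdot> b)"
      using gal[of a "lft g \<cdot> b"] s l by simp
  qed (use l in \<open>simp add: hom_iff\<close>)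
  moreover have "is_monotone Q P (rgt g)"
    unfolding is_monotone_def
  proof (intro conjI ballI impI)
    fix T a b assume "a \<in> hom B T (car Q)" "b \<in> hom B T (car Q)" and ab: "le Q a b"
    then have s: "a \<in> Arr B" "b \<in> Arr B" "Dom B b = Dom B a" "Cod B a = car Q" "Cod B b = car Q"
      by (simp_all add: hom_iff)
    have "le Q (lft g \<cdot> (rgt g \<cdot> a)) b"
      by (rule le_trans[OF counit ab]) (use s l r Q in simp_all)
    then show "le P (rgt g \<cdot> a) (rgt g \<cdot> b)"
      using gal[of "rgt g \<cdot> a" b] s r by simp
  qed (use r in \<open>simp add: hom_iff\<close>)
  moreover have "le P (Ide B (car P)) (rgt g \<cdot> lft g)" using unit[of "Ide B (car P)"] o l by simp
  moreover have "le Q (lft g \<cdot> rgt g) (Ide B (car Q))" using counit[of "Ide B (car Q)"] o r by simp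
  ultimately show ?thesis using P Q by (simp add: is_adj_def)
qed

text \<open>Each left adjoint is below the other: transpose the unit of one adjunction along the
  other, at the generic element \<open>Ide B (car P)\<close>.\<close>

lemma lft_unique:
  assumes g: "is_adj P Q g" and g': "is_adj P Q g'" and r: "rgt g = rgt g'" and Q: "antisymmetric Q"
  shows "lft g = lft g'"
proof -
  note s = is_adj_simps[OF g] is_adj_simps[OF g']
  have "le Q (lft g \<cdot> Ide B (car P)) (lft g' \<cdot> Ide B (car P))"
    using adj_galois[OF g, of "Ide B (car P)" "lft g'"] adj_unit[OF g', of "Ide B (car P)"] s r by simp
  moreover have "le Q (lft g' \<cdot> Ide B (car P)) (lft g \<cdot> Ide B (car P))"
    using adj_galois[OF g', of "Ide B (car P)" "lft g"] adj_unit[OF g, of "Ide B (car P)"] s r by simp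
  ultimately show ?thesis using s Q by (auto intro: antisymmetricD)
qed

lemma adj_then_simps [simp]:
  "lft (adj_then g h) = lft h \<cdot> lft g" "rgt (adj_then g h) = rgt g \<cdot> rgt h"
  by (simp_all add: adj_then_def)

lemma is_adj_then:
  assumes g: "is_adj P Q g" and h: "is_adj Q R h"
  shows "is_adj P R (adj_then g h)"
proof -
  note s = is_adj_simps[OF g] is_adj_simps[OF h]
  show ?thesis
  proof (rule is_adjI)
    fix a b assume a: "a \<in> Arr B" "b \<in> Arr B" "Dom B b = Dom B a" "Cod B a = car P" "Cod B b = car R"
    then show "le R (lft (adj_then g h) \<cdot> a) b \<longleftrightarrow> le P a (rgt (adj_then g h) \<cdot> b)"
      using adj_galois[OF g, of a "rgt h \<cdot> b"] adj_galois[OF h, of "lft g \<cdot> a" b] s by simp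
  qed (use s in simp_all)
qed

lemma is_adj_id: "is_preorder P \<Longrightarrow> is_adj P P (adj_id P)"
  by (rule is_adjI) (simp_all add: adj_id_def preorder_Obj)

lemma is_adj_opp:
  assumes g: "is_adj P Q g"
  shows "is_adj (opp Q) (opp P) \<lparr>lft = rgt g, rgt = lft g\<rparr>"
proof -
  note s = is_adj_simps[OF g]
  show ?thesis
    by (rule is_adjI) (use s adj_galois[OF g] in \<open>simp_all add: is_preorder_opp le_opp\<close>)
qed

section \<open>Direct and inverse images\<close>

lemma pre_image_simps:
  assumes f: "f \<in> Arr B"
  shows pre_image_arr [simp]: "pre_image f \<in> Arr B" "Dom B (pre_image f) = Pwr B (Cod B f)"
      "Cod B (pre_image f) = Pwr B (Dom B f)"
    and mem_pre_image: "a \<in> Arr B \<Longrightarrow> x \<in> Arr B \<Longrightarrow> Dom B a = Dom B x \<Longrightarrow> Cod B a = Pwr B (Cod B f) \<Longrightarrow>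
      Cod B x = Dom B f \<Longrightarrow> mem x (pre_image f \<cdot> a) \<longleftrightarrow> mem (f \<cdot> x) a"
proof -
  let ?c = "cross (Ide B (Pwr B (Cod B f))) f"
  let ?R = "pull ?c (subobj (Mem B (Cod B f)))"
  have R: "?R \<in> Sub (Prod B (Pwr B (Cod B f)) (Dom B f))"
    using f pull_Sub[of ?c "subobj (Mem B (Cod B f))"] by simp
  with f show "pre_image f \<in> Arr B" "Dom B (pre_image f) = Pwr B (Cod B f)" "Cod B (pre_image f) = Pwr B (Dom B f)"
    by (simp_all add: pre_image_def)
  show "mem x (pre_image f \<cdot> a) \<longleftrightarrow> mem (f \<cdot> x) a"
    if "a \<in> Arr B" "x \<in> Arr B" "Dom B a = Dom B x" "Cod B a = Pwr B (Cod B f)" "Cod B x = Dom B f"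
    using that f mem_classify[OF R, of a x] lies_pull[of ?c "subobj (Mem B (Cod B f))" "pair a x"]
      lies_Mem[of a "f \<cdot> x"] by (simp add: pre_image_def)
qed

text \<open>Internally, the left adjoint of \<open>f\<inverse>\<close> is \<open>S \<mapsto> {y. \<forall>U. S \<subseteq> f\<inverse> U \<longrightarrow> y \<in> U}\<close>; the universal
  quantifier is an inclusion between the elements \<open>{U. S \<subseteq> f\<inverse> U}\<close> and \<open>{U. y \<in> U}\<close> of \<open>\<wp>\<wp>Y\<close>.\<close>

lemma ex_left_adjoint_pre_image:
  assumes f: "f \<in> Arr B"
  obtains d where "is_adj (pwr_ord (Dom B f)) (pwr_ord (Cod B f)) \<lparr>lft = d, rgt = pre_image f\<rparr>"
proof -
  let ?X = "Dom B f" and ?Y = "Cod B f"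
  let ?PX = "Pwr B ?X" and ?PY = "Pwr B ?Y"
  let ?PPY = "Pwr B ?PY"
  have o [simp]: "?X \<in> Obj B" "?Y \<in> Obj B" using f by simp_all
  define c where "c = cross (Ide B ?PX) (pre_image f)"
  have c: "c \<in> Arr B" "Dom B c = Prod B ?PX ?PY" "Cod B c = Prod B ?PX ?PX"
    using f by (simp_all add: c_def)
  define R where "R = pull c (incl ?X)"
  have R: "R \<in> Sub (Prod B ?PX ?PY)" unfolding R_def using pull_Sub[of c "incl ?X"] c incl_Sub[of ?X] by simp
  have lR: "lies (pair s u) R \<longleftrightarrow> le (pwr_ord ?X) s (pre_image f \<cdot> u)"
    if "s \<in> Arr B" "u \<in> Arr B" "Dom B s = Dom B u" "Cod B s = ?PX" "Cod B u = ?PY" for s u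
    unfolding R_def using that f c incl_Sub[of ?X] lies_pull[of c "incl ?X" "pair s u"]
    by (simp add: le_def pwr_ord_def c_def)
  \<comment> \<open>With S in \<wp>X, U in \<wp>Y and y in Y, \<open>K\<close> is the map S
    \<mapsto> {U. S \<subseteq> \<open>f\<inverse>\<close> U}. The later \<open>\<eta>\<close> is y
    \<mapsto> {U. y \<in> U}, and \<open>D\<close> is S \<mapsto> {y. \<open>K\<close> S \<subseteq>
    \<open>\<eta>\<close> y}.\<close>
  define K where "K = classify ?PX ?PY R"
  have K: "K \<in> Arr B" "Dom B K = ?PX" "Cod B K = ?PPY" unfolding K_def using R by simp_all
  have mK: "mem u (K \<cdot> s) \<longleftrightarrow> le (pwr_ord ?X) s (pre_image f \<cdot> u)"
    if "s \<in> Arr B" "u \<in> Arr B" "Dom B s = Dom B u" "Cod B s = ?PX" "Cod B u = ?PY" for s u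
    unfolding K_def using that lR mem_classify[OF R, of s u] by simp
  define E where "E = pull (swap ?Y ?PY) (subobj (Mem B ?Y))"
  have E: "E \<in> Sub (Prod B ?Y ?PY)"
    unfolding E_def using pull_Sub[of "swap ?Y ?PY" "subobj (Mem B ?Y)"] by simp
  define \<eta> where "\<eta> = classify ?Y ?PY E"
  have \<eta>: "\<eta> \<in> Arr B" "Dom B \<eta> = ?Y" "Cod B \<eta> = ?PPY" unfolding \<eta>_def using E by simp_all
  have m\<eta>: "mem u (\<eta> \<cdot> y) \<longleftrightarrow> mem y u"
    if "y \<in> Arr B" "u \<in> Arr B" "Dom B y = Dom B u" "Cod B y = ?Y" "Cod B u = ?PY" for y u
    unfolding \<eta>_def using that mem_classify[OF E, of y u] lies_Mem[of u y ?Y]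
      lies_pull[of "swap ?Y ?PY" "subobj (Mem B ?Y)" "pair y u"] by (simp add: E_def)
  define G where "G = pull (cross K \<eta>) (incl ?PY)"
  have G: "G \<in> Sub (Prod B ?PX ?Y)"
    unfolding G_def using pull_Sub[of "cross K \<eta>" "incl ?PY"] K \<eta> incl_Sub[of ?PY] by simp
  have lG: "lies (pair s y) G \<longleftrightarrow> le (pwr_ord ?PY) (K \<cdot> s) (\<eta> \<cdot> y)"
    if "s \<in> Arr B" "y \<in> Arr B" "Dom B s = Dom B y" "Cod B s = ?PX" "Cod B y = ?Y" for s y
    unfolding G_def using that K \<eta> incl_Sub[of ?PY] lies_pull[of "cross K \<eta>" "incl ?PY" "pair s y"]
    by (simp add: le_def pwr_ord_def)
  define D where "D = classify ?PX ?Y G"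
  have D: "D \<in> Arr B" "Dom B D = ?PX" "Cod B D = ?PY" unfolding D_def using G by simp_all
  have mD: "mem y (D \<cdot> s) \<longleftrightarrow> le (pwr_ord ?PY) (K \<cdot> s) (\<eta> \<cdot> y)"
    if "s \<in> Arr B" "y \<in> Arr B" "Dom B s = Dom B y" "Cod B s = ?PX" "Cod B y = ?Y" for s y
    unfolding D_def using that lG mem_classify[OF G, of s y] by simp
  have "is_adj (pwr_ord ?X) (pwr_ord ?Y) \<lparr>lft = D, rgt = pre_image f\<rparr>"
  proof (rule is_adjI)
    fix a b assume ab: "a \<in> Arr B" "b \<in> Arr B" "Dom B b = Dom B a" "Cod B a = car (pwr_ord ?X)" "Cod B b = car (pwr_ord ?Y)"
    then have ab': "Cod B a = ?PX" "Cod B b = ?PY" by simp_all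
    have "le (pwr_ord ?Y) (D \<cdot> a) b \<longleftrightarrow> le (pwr_ord ?X) a (pre_image f \<cdot> b)"
    proof
      assume *: "le (pwr_ord ?Y) (D \<cdot> a) b"
      show "le (pwr_ord ?X) a (pre_image f \<cdot> b)"
      proof (rule le_pwr_ordI)
        fix t x assume t: "t \<in> Arr B" "x \<in> Arr B" "Dom B t = Dom B x" "Cod B t = Dom B a" "Cod B x = ?X" "mem x (a \<cdot> t)"
        \<comment> \<open>For x in the set \<open>a\<close>, the point \<open>f\<close> x lies in
          every U with \<open>a\<close> \<subseteq> \<open>f\<inverse>\<close> U. Hence
          \<open>f\<close> x belongs to \<open>D \<cdot> a\<close>, and the assumption carries it
          into \<open>b\<close>.\<close>
        have "le (pwr_ord ?PY) (K \<cdot> (a \<cdot> t)) (\<eta> \<cdot> (f \<cdot> x))"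
        proof (rule le_pwr_ordI)
          fix t' u assume t': "t' \<in> Arr B" "u \<in> Arr B" "Dom B t' = Dom B u" "Cod B t' = Dom B (K \<cdot> (a \<cdot> t))"
            "Cod B u = ?PY" "mem u ((K \<cdot> (a \<cdot> t)) \<cdot> t')"
          have ct: "Cod B t' = Dom B x" using t'(4) K t ab ab' by simp
          then have "le (pwr_ord ?X) (a \<cdot> (t \<cdot> t')) (pre_image f \<cdot> u)"
            using t' mK[of "a \<cdot> (t \<cdot> t')" u] K t ab ab' by simp
          moreover have "mem (x \<cdot> t') (a \<cdot> (t \<cdot> t'))"
            using mem_Cmp[OF t(6), of t'] ct t' t ab ab' by simp
          ultimately have "mem (x \<cdot> t') (pre_image f \<cdot> u)"
            by (rule le_pwr_ordD_Ide) (use t t' ct ab ab' f in simp_all)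
          then have "mem (f \<cdot> (x \<cdot> t')) u"
            using mem_pre_image[OF f, of u "x \<cdot> t'"] t t' ct by simp
          then show "mem u ((\<eta> \<cdot> (f \<cdot> x)) \<cdot> t')"
            using m\<eta>[of "f \<cdot> (x \<cdot> t')" u] t t' ct f \<eta> by simp
        qed (use t f ab ab' K \<eta> in simp_all)
        then have "mem (f \<cdot> x) ((D \<cdot> a) \<cdot> t)"
          using mD[of "a \<cdot> t" "f \<cdot> x"] t f ab ab' D by simp
        then have "mem (f \<cdot> x) (b \<cdot> t)"
          by (rule le_pwr_ordD[OF *]) (use t f ab ab' D in simp_all)
        then show "mem x ((pre_image f \<cdot> b) \<cdot> t)"
          using mem_pre_image[OF f, of "b \<cdot> t" x] t f ab ab' by simp
      qed (use ab ab' f in simp_all)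
    next
      assume *: "le (pwr_ord ?X) a (pre_image f \<cdot> b)"
      show "le (pwr_ord ?Y) (D \<cdot> a) b"
      proof (rule le_pwr_ordI)
        fix t y assume t: "t \<in> Arr B" "y \<in> Arr B" "Dom B t = Dom B y" "Cod B t = Dom B (D \<cdot> a)" "Cod B y = ?Y" "mem y ((D \<cdot> a) \<cdot> t)"
        have ct: "Cod B t = Dom B a" using t(4) D ab ab' by simp
        have 1: "le (pwr_ord ?PY) (K \<cdot> (a \<cdot> t)) (\<eta> \<cdot> y)"
          using mD[of "a \<cdot> t" y] t ct ab ab' D by simp
        \<comment> \<open>The impredicative step: the bound \<open>b\<close> is itself one of the
          sets U over which \<open>D\<close> quantifies, so the quantifier can be instantiated at
          \<open>b\<close>.\<close>
        have "le (pwr_ord ?X) (a \<cdot> t) ((pre_image f \<cdot> b) \<cdot> t)"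
          by (rule le_Cmp[OF *]) (use t ct ab ab' f in simp_all)
        then have "mem (b \<cdot> t) (K \<cdot> (a \<cdot> t))"
          using mK[of "a \<cdot> t" "b \<cdot> t"] t ct ab ab' f by simp
        then have "mem (b \<cdot> t) (\<eta> \<cdot> y)"
          by (rule le_pwr_ordD_Ide[OF 1]) (use t ct ab ab' K \<eta> in simp_all)
        then show "mem y (b \<cdot> t)"
          using m\<eta>[of y "b \<cdot> t"] t ct ab ab' by simp
      qed (use ab ab' D in simp_all)
    qed
    then show "le (pwr_ord ?Y) (lft \<lparr>lft = D, rgt = pre_image f\<rparr> \<cdot> a) b \<longleftrightarrow>
      le (pwr_ord ?X) a (rgt \<lparr>lft = D, rgt = pre_image f\<rparr> \<cdot> b)" by simp
  qed (use D f in simp_all)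
  then show thesis by (rule that)
qed

text \<open>A monomorphism \<open>n\<close> into \<wp>X \<times> Y is classified by some c : \<wp>X
  \<rightarrow> \<wp>Y. The arrow \<open>?h\<close> whose image is taken factors through
  \<open>n\<close> iff the identity of \<wp>X is below \<open>pre_image f \<cdot> c\<close>, iff
  \<open>d\<close> is below \<open>c\<close>, iff the relation of \<open>d\<close> is contained in
  \<open>n\<close>. So this relation is the least subobject through which \<open>?h\<close> factors,
  that is, the image.\<close>

lemma dir_image_eq:
  assumes f: "f \<in> Arr B"
    and d: "is_adj (pwr_ord (Dom B f)) (pwr_ord (Cod B f)) \<lparr>lft = d, rgt = pre_image f\<rparr>"
  shows "dir_image f = d"
proof -
  let ?X = "Dom B f" and ?Y = "Cod B f"
  let ?PX = "Pwr B ?X" and ?PY = "Pwr B ?Y"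
  have o [simp]: "?X \<in> Obj B" "?Y \<in> Obj B" using f by simp_all
  have d': "d \<in> Arr B" "Dom B d = ?PX" "Cod B d = ?PY" using is_adj_simps[OF d] by simp_all
  let ?c = "cross (Ide B ?PX) f" and ?m = "Mem B ?X"
  let ?h = "?c \<cdot> ?m"
  have h: "?h \<in> Arr B" "Dom B ?h = Dom B ?m" "Cod B ?h = Prod B ?PX ?Y" using f by simp_all
  have S: "rel ?Y d \<in> Sub (Prod B ?PX ?Y)" using rel_Sub[of d ?Y] d' by simp
  obtain r where "r \<in> rel ?Y d" using S Sub_nonempty by blast
  note r = this mem_Sub[OF S this]
  have key: "factors ?h n \<longleftrightarrow> factors r n" if n: "monic n" "Cod B n = Prod B ?PX ?Y" for n
  proof -
    have na: "n \<in> Arr B" using n monic_Arr by blast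
    have nS: "subobj n \<in> Sub (Prod B ?PX ?Y)" using n by (auto simp: Sub_iff)
    define c where "c = classify ?PX ?Y (subobj n)"
    have c: "c \<in> Arr B" "Dom B c = ?PX" "Cod B c = ?PY" "rel ?Y c = subobj n"
      unfolding c_def using nS by simp_all
    have mc: "mem y (c \<cdot> t) \<longleftrightarrow> factors (pair t y) n"
      if "t \<in> Arr B" "y \<in> Arr B" "Dom B t = Dom B y" "Cod B t = ?PX" "Cod B y = ?Y" for t y
      using mem_classify[OF nS, of t y] lies_subobj[of n "pair t y"] that n c_def by simp
    have "factors r n \<longleftrightarrow> sub_le (rel ?Y d) (rel ?Y c)"
      using sub_le_subobj[of r n] n r c(4) by simp
    also have "\<dots> \<longleftrightarrow> le (pwr_ord ?Y) (d \<cdot> Ide B ?PX) c"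
      using le_pwr_ord[of d c ?Y] c d' by simp
    also have "\<dots> \<longleftrightarrow> le (pwr_ord ?X) (Ide B ?PX) (pre_image f \<cdot> c)"
      using adj_galois[OF d, of "Ide B ?PX" c] c by simp
    also have "\<dots> \<longleftrightarrow> factors ?h n"
    proof
      assume *: "le (pwr_ord ?X) (Ide B ?PX) (pre_image f \<cdot> c)"
      \<comment> \<open>Read as a generalized element, the membership monomorphism is the generic
        pair of a subset and a member of it. Evaluating the inclusion at this pair gives the
        factorization of \<open>?h\<close>.\<close>
      obtain s x where m: "?m = pair s x" "s \<in> Arr B" "x \<in> Arr B" "Dom B x = Dom B s" "Cod B s = ?PX" "Cod B x = ?X"
        using Prod_elem_cases[of ?m ?PX ?X] Mem_simps[of ?X] by (metis Pwr_Obj' o(1))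
      have "mem x s" using m factors_refl[of ?m] by (simp add: mem_def)
      then have "mem x (Ide B ?PX \<cdot> s)" using m by simp
      then have "mem x ((pre_image f \<cdot> c) \<cdot> s)"
        by (rule le_pwr_ordD[OF *]) (use m c f in simp_all)
      then have "factors (pair s (f \<cdot> x)) n"
        using mem_pre_image[OF f, of "c \<cdot> s" x] mc[of s "f \<cdot> x"] m(2-) c f by simp
      then show "factors ?h n" unfolding m(1) using m(2-) f by simp
    next
      assume *: "factors ?h n"
      show "le (pwr_ord ?X) (Ide B ?PX) (pre_image f \<cdot> c)"
      proof (rule le_pwr_ordI)
        fix t x assume t: "t \<in> Arr B" "x \<in> Arr B" "Dom B t = Dom B x" "Cod B t = Dom B (Ide B ?PX)" "Cod B x = ?X" "mem x (Ide B ?PX \<cdot> t)"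
        have ct: "Cod B t = ?PX" using t(4) by simp
        have "factors (pair t x) ?m" using t ct by (simp add: mem_def)
        then obtain u where u: "u \<in> Arr B" "Cod B u = Dom B ?m" "pair t x = ?m \<cdot> u"
          using Mem_simps(2)[of ?X] by (auto elim: factorsE)
        have "factors (?h \<cdot> u) n" using factors_Cmp[OF * na u(1)] u(2) h by simp
        moreover have "?h \<cdot> u = ?c \<cdot> (?m \<cdot> u)" using u(1,2) f by simp
        moreover have "\<dots> = pair t (f \<cdot> x)" unfolding u(3)[symmetric] using t ct f by simp
        ultimately have "factors (pair t (f \<cdot> x)) n" by simp
        then show "mem x ((pre_image f \<cdot> c) \<cdot> t)"
          using mem_pre_image[OF f, of "c \<cdot> t" x] mc[of t "f \<cdot> x"] t ct c f by simp
      qed (use c f in simp_all)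
    qed
    finally show ?thesis by simp
  qed
  have "im ?h = subobj r"
  proof (intro set_eqI iffI)
    fix m assume "m \<in> im ?h"
    then have m: "monic m" "Cod B m = Prod B ?PX ?Y" "factors ?h m"
      and least: "\<And>n. monic n \<Longrightarrow> Cod B n = Prod B ?PX ?Y \<Longrightarrow> factors ?h n \<Longrightarrow> factors m n"
      unfolding im_def h(3) by blast+
    have "factors r m" using key[OF m(1,2)] m(3) by simp
    moreover have "factors m r" using least[of r] key[of r] r factors_refl[of r] by simp
    ultimately show "m \<in> subobj r" using m r by (simp add: subobj_def)
  next
    fix m assume "m \<in> subobj r"
    then have m: "monic m" "Cod B m = Prod B ?PX ?Y" "factors m r" "factors r m" using r by (auto simp: subobj_def)
    then have "factors ?h m" using key by simp
    moreover have "factors m n" if "monic n" "Cod B n = Prod B ?PX ?Y" "factors ?h n" for n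
      using key[OF that(1,2)] that factors_trans[OF m(3), of n] monic_Arr[of n] by simp
    ultimately show "m \<in> im ?h" unfolding im_def h(3) using m by blast
  qed
  then have "im ?h = rel ?Y d" using r by simp
  then show ?thesis
    unfolding dir_image_def using classify_unique[of d ?PX ?Y] d' by simp
qed

lemma is_adj_dir:
  assumes f: "f \<in> Arr B"
  shows "is_adj (pwr_ord (Dom B f)) (pwr_ord (Cod B f)) (dir_adj f)"
proof -
  obtain d where d: "is_adj (pwr_ord (Dom B f)) (pwr_ord (Cod B f)) \<lparr>lft = d, rgt = pre_image f\<rparr>"
    using ex_left_adjoint_pre_image[OF f] .
  with dir_image_eq[OF f d] show ?thesis by (simp add: dir_adj_def)
qed

lemma is_adj_inv:
  assumes f: "f \<in> Arr B"
  shows "is_adj (opp (pwr_ord (Cod B f))) (opp (pwr_ord (Dom B f))) (inv_adj f)"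
  using is_adj_opp[OF is_adj_dir[OF f]] by (simp add: dir_adj_def inv_adj_def)

lemma dir_image_simps [simp]:
  assumes "f \<in> Arr B"
  shows "dir_image f \<in> Arr B" "Dom B (dir_image f) = Pwr B (Dom B f)" "Cod B (dir_image f) = Pwr B (Cod B f)"
  using is_adj_simps[OF is_adj_dir[OF assms]] by (simp_all add: dir_adj_def)

lemma pre_image_Cmp:
  assumes "f \<in> Arr B" "g \<in> Arr B" "Dom B g = Cod B f"
  shows "pre_image (g \<cdot> f) = pre_image f \<cdot> pre_image g"
  by (rule Pwr_ext[where X = "Dom B f"]) (use assms in \<open>simp_all add: mem_pre_image\<close>)

lemma pre_image_Ide:
  assumes "X \<in> Obj B"
  shows "pre_image (Ide B X) = Ide B (Pwr B X)"
  by (rule Pwr_ext[where X = X]) (use assms in \<open>simp_all add: mem_pre_image\<close>)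

text \<open>Inverse images compose by an elementwise check; direct images then compose because left
  adjoints are unique.\<close>

lemma dir_adj_Cmp:
  assumes "f \<in> Arr B" "g \<in> Arr B" "Dom B g = Cod B f"
  shows "dir_adj (g \<cdot> f) = adj_then (dir_adj f) (dir_adj g)"
proof -
  have "is_adj (pwr_ord (Dom B f)) (pwr_ord (Cod B g)) (dir_adj (g \<cdot> f))"
    using is_adj_dir[of "g \<cdot> f"] assms by simp
  moreover have "is_adj (pwr_ord (Dom B f)) (pwr_ord (Cod B g)) (adj_then (dir_adj f) (dir_adj g))"
    using is_adj_then is_adj_dir[of f] is_adj_dir[of g] assms by simp
  moreover have "rgt (dir_adj (g \<cdot> f)) = rgt (adj_then (dir_adj f) (dir_adj g))"
    using pre_image_Cmp[OF assms] by (simp add: dir_adj_def)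
  moreover have "antisymmetric (pwr_ord (Cod B g))" using assms by (simp add: antisymmetric_pwr_ord)
  ultimately have "lft (dir_adj (g \<cdot> f)) = lft (adj_then (dir_adj f) (dir_adj g))"
    by (rule lft_unique)
  with pre_image_Cmp[OF assms] show ?thesis by (simp add: dir_adj_def adj_then_def)
qed

lemma dir_adj_Ide:
  assumes "X \<in> Obj B"
  shows "dir_adj (Ide B X) = adj_id (pwr_ord X)"
proof -
  have "dir_image (Ide B X) = Ide B (Pwr B X)"
    using dir_image_eq[of "Ide B X" "Ide B (Pwr B X)"] is_adj_id[of "pwr_ord X"] assms
    by (simp add: pre_image_Ide adj_id_def)
  with assms show ?thesis by (simp add: dir_adj_def adj_id_def pre_image_Ide)
qed

lemma rgt_unique:
  assumes g: "is_adj P Q g" and g': "is_adj P Q g'" and l: "lft g = lft g'" and P: "antisymmetric P"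
  shows "rgt g = rgt g'"
proof -
  note s = is_adj_simps[OF g] is_adj_simps[OF g']
  have "le P (rgt g \<cdot> Ide B (car Q)) (rgt g' \<cdot> Ide B (car Q))"
    using adj_galois[OF g', of "rgt g" "Ide B (car Q)"] adj_counit[OF g, of "Ide B (car Q)"] s l by simp
  moreover have "le P (rgt g' \<cdot> Ide B (car Q)) (rgt g \<cdot> Ide B (car Q))"
    using adj_galois[OF g, of "rgt g'" "Ide B (car Q)"] adj_counit[OF g', of "Ide B (car Q)"] s l by simp
  ultimately show ?thesis using s P by (auto intro: antisymmetricD)
qed

lemma adj_eqI: "lft g = lft h \<Longrightarrow> rgt g = rgt h \<Longrightarrow> g = (h :: 'm adj)"
  by simp

section \<open>Singletons and derivation adjunctions\<close>

lemma singleton_simps [simp]: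
  assumes "X \<in> Obj B"
  shows "singleton X \<in> Arr B" "Dom B (singleton X) = X" "Cod B (singleton X) = Pwr B X"
    and mem_singleton: "x \<in> Arr B \<Longrightarrow> x' \<in> Arr B \<Longrightarrow> Dom B x = Dom B x' \<Longrightarrow> Cod B x = X \<Longrightarrow> Cod B x' = X \<Longrightarrow>
      mem x' (singleton X \<cdot> x) \<longleftrightarrow> x' = x"
proof -
  let ?d = "pair (Ide B X) (Ide B X)"
  have "monic ?d"
    unfolding monic_def
  proof (intro conjI allI ballI impI)
    fix T a b assume "a \<in> hom B T (Dom B ?d)" "b \<in> hom B T (Dom B ?d)" "?d \<cdot> a = ?d \<cdot> b"
    then show "a = b" using assms by (simp add: hom_iff pair_eq_iff)
  qed (use assms in simp)
  moreover from this have "subobj ?d \<in> Sub (Prod B X X)" using assms by (auto simp: Sub_iff)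
  ultimately have d: "monic ?d" "subobj ?d \<in> Sub (Prod B X X)" by simp_all
  with assms show "singleton X \<in> Arr B" "Dom B (singleton X) = X" "Cod B (singleton X) = Pwr B X"
    by (simp_all add: singleton_def)
  assume x: "x \<in> Arr B" "x' \<in> Arr B" "Dom B x = Dom B x'" "Cod B x = X" "Cod B x' = X"
  have "mem x' (singleton X \<cdot> x) \<longleftrightarrow> factors (pair x x') ?d"
    unfolding singleton_def using mem_classify[OF d(2), of x x'] lies_subobj[OF d(1), of "pair x x'"] x assms by simp
  also have "\<dots> \<longleftrightarrow> x' = x"
  proof
    assume "factors (pair x x') ?d"
    then obtain u where u: "u \<in> Arr B" "Cod B u = X" "pair x x' = ?d \<cdot> u"
      using assms by (elim factorsE) simp_all
    then have "pair x x' = pair u u" using assms by simp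
    then show "x' = x"
      using pair_simps(4,5)[of x x' X X] pair_simps(4,5)[of u u X X] x u(1,2) by metis
  next
    assume "x' = x"
    then show "factors (pair x x') ?d" using factorsI[of x ?d] x assms by simp
  qed
  finally show "mem x' (singleton X \<cdot> x) \<longleftrightarrow> x' = x" .
qed

text \<open>Turns membership into an inequality, so that adjunctions between powers can be applied
  to elements.\<close>

lemma le_singleton:
  assumes x: "x \<in> Arr B" "Cod B x = X" and a: "a \<in> Arr B" "Cod B a = Pwr B X" "Dom B a = Dom B x"
  shows "le (pwr_ord X) (singleton X \<cdot> x) a \<longleftrightarrow> mem x a"
proof
  have X: "X \<in> Obj B" using x by auto
  {
    assume *: "le (pwr_ord X) (singleton X \<cdot> x) a"
    have "mem x (singleton X \<cdot> x)" using mem_singleton[OF X, of x x] x by simp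
    then show "mem x a" by (rule le_pwr_ordD_Ide[OF *]) (use x a X in simp_all)
  }
  assume *: "mem x a"
  show "le (pwr_ord X) (singleton X \<cdot> x) a"
  proof (rule le_pwr_ordI)
    fix t x' assume t: "t \<in> Arr B" "x' \<in> Arr B" "Dom B t = Dom B x'" "Cod B t = Dom B (singleton X \<cdot> x)" "Cod B x' = X"
      "mem x' ((singleton X \<cdot> x) \<cdot> t)"
    have ct: "Cod B t = Dom B x" using t(4) x X by simp
    have "x' = x \<cdot> t" using mem_singleton[OF X, of "x \<cdot> t" x'] t ct x X by simp
    then show "mem x' (a \<cdot> t)" using mem_Cmp[OF *, of t] t(1) ct x a by simp
  qed (use x a X in simp_all)
qed

text \<open>Both sides have the same upper bounds: \<open>c\<close> bounds either of them iff it
  contains \<open>f \<cdot> x\<close>. Taking each side as a bound of the other gives equality by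
  antisymmetry.\<close>

lemma dir_image_singleton:
  assumes f: "f \<in> Arr B" and x: "x \<in> Arr B" "Cod B x = Dom B f"
  shows "dir_image f \<cdot> (singleton (Dom B f) \<cdot> x) = singleton (Cod B f) \<cdot> (f \<cdot> x)"
proof -
  let ?l = "dir_image f \<cdot> (singleton (Dom B f) \<cdot> x)" and ?r = "singleton (Cod B f) \<cdot> (f \<cdot> x)"
  have s: "?l \<in> Arr B" "Dom B ?l = Dom B x" "Cod B ?l = Pwr B (Cod B f)"
    "?r \<in> Arr B" "Dom B ?r = Dom B x" "Cod B ?r = Pwr B (Cod B f)" using f x by simp_all
  have *: "le (pwr_ord (Cod B f)) ?l c \<longleftrightarrow> le (pwr_ord (Cod B f)) ?r c"
    if c: "c \<in> Arr B" "Dom B c = Dom B x" "Cod B c = Pwr B (Cod B f)" for c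
  proof -
    have "le (pwr_ord (Cod B f)) ?l c \<longleftrightarrow> le (pwr_ord (Dom B f)) (singleton (Dom B f) \<cdot> x) (pre_image f \<cdot> c)"
      using adj_galois[OF is_adj_dir[OF f], of "singleton (Dom B f) \<cdot> x" c] f x c by (simp add: dir_adj_def)
    also have "\<dots> \<longleftrightarrow> le (pwr_ord (Cod B f)) ?r c"
      using le_singleton[of x "Dom B f" "pre_image f \<cdot> c"] le_singleton[of "f \<cdot> x" "Cod B f" c] mem_pre_image[OF f, of c x] f x c
      by simp
    finally show ?thesis .
  qed
  have "le (pwr_ord (Cod B f)) ?l ?r" "le (pwr_ord (Cod B f)) ?r ?l"
    using *[of ?r] *[of ?l] s f by (simp_all add: le_refl)
  then show ?thesis
    by (rule antisymmetricD[OF antisymmetric_pwr_ord[OF Dom_Cod_Obj(2)[OF f]]]) (use f s in simp_all)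
qed

text \<open>For a family h : Y \<rightarrow> \<wp>X this is S \<mapsto> {y. S \<subseteq> h y}. The
  two components of \<open>deriv\<close> are the polars of \<open>typ_inst\<close> and
  \<open>inst_typ\<close>.\<close>

definition polar :: "'m \<Rightarrow> 'o \<Rightarrow> 'm" where
  "polar h X = classify (Pwr B X) (Dom B h) (pull (cross (Ide B (Pwr B X)) h) (incl X))"

lemma polar_simps:
  assumes h: "h \<in> Arr B" "Cod B h = Pwr B X" and X: "X \<in> Obj B"
  shows polar_arr [simp]: "polar h X \<in> Arr B" "Dom B (polar h X) = Pwr B X" "Cod B (polar h X) = Pwr B (Dom B h)"
    and mem_polar: "S \<in> Arr B \<Longrightarrow> y \<in> Arr B \<Longrightarrow> Dom B S = Dom B y \<Longrightarrow> Cod B S = Pwr B X \<Longrightarrow> Cod B y = Dom B h \<Longrightarrow>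
      mem y (polar h X \<cdot> S) \<longleftrightarrow> le (pwr_ord X) S (h \<cdot> y)"
proof -
  let ?c = "cross (Ide B (Pwr B X)) h"
  let ?R = "pull ?c (incl X)"
  have R: "?R \<in> Sub (Prod B (Pwr B X) (Dom B h))"
    using h X incl_Sub[OF X] pull_Sub[of ?c "incl X"] by simp
  with h X show "polar h X \<in> Arr B" "Dom B (polar h X) = Pwr B X" "Cod B (polar h X) = Pwr B (Dom B h)"
    by (simp_all add: polar_def)
  show "mem y (polar h X \<cdot> S) \<longleftrightarrow> le (pwr_ord X) S (h \<cdot> y)"
    if "S \<in> Arr B" "y \<in> Arr B" "Dom B S = Dom B y" "Cod B S = Pwr B X" "Cod B y = Dom B h"
    using that h X mem_classify[OF R, of S y] lies_pull[of ?c "incl X" "pair S y"] incl_Sub[OF X]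
    by (simp add: polar_def le_def pwr_ord_def)
qed

text \<open>Both inequalities say that every element of \<open>S\<close> is related to every element
  of \<open>U\<close>, where \<open>h\<close> and \<open>k\<close> are the two transposes of a
  single relation. The hypotheses are symmetric under exchanging the two sides, so the converse
  implication is another instance.\<close>

lemma polar_galois:
  assumes h: "h \<in> Arr B" "Dom B h = Y" "Cod B h = Pwr B X" and k: "k \<in> Arr B" "Dom B k = X" "Cod B k = Pwr B Y"
    and hk: "\<And>x y. x \<in> Arr B \<Longrightarrow> y \<in> Arr B \<Longrightarrow> Dom B x = Dom B y \<Longrightarrow> Cod B x = X \<Longrightarrow> Cod B y = Y \<Longrightarrow>
      mem x (h \<cdot> y) \<longleftrightarrow> mem y (k \<cdot> x)"
    and S: "S \<in> Arr B" "Cod B S = Pwr B X" and U: "U \<in> Arr B" "Cod B U = Pwr B Y" "Dom B U = Dom B S"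
    and le: "le (pwr_ord Y) U (polar h X \<cdot> S)"
  shows "le (pwr_ord X) S (polar k Y \<cdot> U)"
proof (rule le_pwr_ordI)
  have o: "X \<in> Obj B" "Y \<in> Obj B" using h k by auto
  note p = polar_arr[OF h(1,3) o(1)] polar_arr[OF k(1,3) o(2)]
  show "X \<in> Obj B" "polar k Y \<cdot> U \<in> Arr B" "Dom B (polar k Y \<cdot> U) = Dom B S" "Cod B (polar k Y \<cdot> U) = Pwr B X"
    using p k U o by simp_all
  fix t x assume t: "t \<in> Arr B" "x \<in> Arr B" "Dom B t = Dom B x" "Cod B t = Dom B S" "Cod B x = X" "mem x (S \<cdot> t)"
  have "le (pwr_ord Y) (U \<cdot> t) (k \<cdot> x)"
  proof (rule le_pwr_ordI)
    fix t' y assume t': "t' \<in> Arr B" "y \<in> Arr B" "Dom B t' = Dom B y" "Cod B t' = Dom B (U \<cdot> t)" "Cod B y = Y" "mem y ((U \<cdot> t) \<cdot> t')"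
    have ct: "Cod B t' = Dom B x" using t'(4) t U by simp
    have "mem y (U \<cdot> (t \<cdot> t'))" using t' ct t U by simp
    then have "mem y ((polar h X \<cdot> S) \<cdot> (t \<cdot> t'))"
      by (rule le_pwr_ordD[OF le]) (use t' t ct S U h p in simp_all)
    then have "le (pwr_ord X) (S \<cdot> (t \<cdot> t')) (h \<cdot> y)"
      using mem_polar[OF h(1,3) o(1), of "S \<cdot> (t \<cdot> t')" y] t' t ct S U h p by simp
    \<comment> \<open>The element \<open>y\<close> lives at a later stage than \<open>x\<close>, so
      \<open>x\<close> is restricted along \<open>t'\<close> before the two are compared.\<close>
    moreover have "mem (x \<cdot> t') (S \<cdot> (t \<cdot> t'))"
      using mem_Cmp[OF t(6), of t'] t' ct t S by simp
    ultimately have "mem (x \<cdot> t') (h \<cdot> y)"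
      by (rule le_pwr_ordD_Ide) (use t t' ct S h in simp_all)
    then show "mem y ((k \<cdot> x) \<cdot> t')"
      using hk[of "x \<cdot> t'" y] t t' ct k by simp
  qed (use U t k o in simp_all)
  then show "mem x ((polar k Y \<cdot> U) \<cdot> t)"
    using mem_polar[OF k(1,3) o(2), of "U \<cdot> t" x] t U k p by simp
qed (use S in simp_all)

section \<open>Derivation adjunctions of classifications\<close>

lemma is_clsnD:
  assumes "is_clsn A"
  shows "cInst A \<in> Obj B" "cTyp A \<in> Obj B" "cSat A \<in> Sub (Prod B (cInst A) (cTyp A))"
  using assms by (auto simp: is_clsn_def)

lemma inst_typ_simps:
  assumes A: "is_clsn A"
  shows inst_typ_arr: "inst_typ A \<in> Arr B" "Dom B (inst_typ A) = cInst A" "Cod B (inst_typ A) = Pwr B (cTyp A)"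
    and mem_inst_typ: "x \<in> Arr B \<Longrightarrow> y \<in> Arr B \<Longrightarrow> Dom B x = Dom B y \<Longrightarrow> Cod B x = cInst A \<Longrightarrow> Cod B y = cTyp A \<Longrightarrow>
      mem y (inst_typ A \<cdot> x) \<longleftrightarrow> lies (pair x y) (cSat A)"
  unfolding inst_typ_def using is_clsnD[OF A] mem_classify[of "cSat A"] by simp_all

lemma typ_inst_simps:
  assumes A: "is_clsn A"
  shows typ_inst_arr: "typ_inst A \<in> Arr B" "Dom B (typ_inst A) = cTyp A" "Cod B (typ_inst A) = Pwr B (cInst A)"
    and mem_typ_inst: "x \<in> Arr B \<Longrightarrow> y \<in> Arr B \<Longrightarrow> Dom B x = Dom B y \<Longrightarrow> Cod B x = cInst A \<Longrightarrow> Cod B y = cTyp A \<Longrightarrow>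
      mem x (typ_inst A \<cdot> y) \<longleftrightarrow> lies (pair x y) (cSat A)"
proof -
  note s = is_clsnD[OF A]
  let ?c = "swap (cTyp A) (cInst A)"
  have R: "pull ?c (cSat A) \<in> Sub (Prod B (cTyp A) (cInst A))" using s pull_Sub[of ?c "cSat A"] by simp
  show "typ_inst A \<in> Arr B" "Dom B (typ_inst A) = cTyp A" "Cod B (typ_inst A) = Pwr B (cInst A)"
    unfolding typ_inst_def using s R by simp_all
  show "mem x (typ_inst A \<cdot> y) \<longleftrightarrow> lies (pair x y) (cSat A)"
    if "x \<in> Arr B" "y \<in> Arr B" "Dom B x = Dom B y" "Cod B x = cInst A" "Cod B y = cTyp A"
    unfolding typ_inst_def using that s mem_classify[OF R, of y x] lies_pull[of ?c "cSat A" "pair y x"] by simp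
qed

lemma deriv_eq:
  assumes "is_clsn A"
  shows "lft (deriv A) = polar (typ_inst A) (cInst A)" "rgt (deriv A) = polar (inst_typ A) (cTyp A)"
  using inst_typ_arr[OF assms] typ_inst_arr[OF assms] by (simp_all add: deriv_def polar_def)

text \<open>The opposite order on the type side reverses the inequality, after which
  \<open>polar_galois\<close> serves for both implications, with the two families exchanged.\<close>

lemma is_adj_deriv:
  assumes A: "is_clsn A"
  shows "is_adj (pwr_ord (cInst A)) (opp (pwr_ord (cTyp A))) (deriv A)"
proof -
  note s = is_clsnD[OF A] and i = inst_typ_arr[OF A] and t = typ_inst_arr[OF A]
  note p = polar_arr[OF t(1,3) s(1)] polar_arr[OF i(1,3) s(2)]
  have it: "mem x (typ_inst A \<cdot> y) \<longleftrightarrow> mem y (inst_typ A \<cdot> x)"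
    if "x \<in> Arr B" "y \<in> Arr B" "Dom B x = Dom B y" "Cod B x = cInst A" "Cod B y = cTyp A" for x y
    using mem_typ_inst[OF A that] mem_inst_typ[OF A that] by simp
  show ?thesis
  proof (rule is_adjI)
    fix a b assume ab: "a \<in> Arr B" "b \<in> Arr B" "Dom B b = Dom B a"
      "Cod B a = car (pwr_ord (cInst A))" "Cod B b = car (opp (pwr_ord (cTyp A)))"
    then have c: "Cod B a = Pwr B (cInst A)" "Cod B b = Pwr B (cTyp A)" by simp_all
    have "le (opp (pwr_ord (cTyp A))) (lft (deriv A) \<cdot> a) b \<longleftrightarrow>
      le (pwr_ord (cTyp A)) b (polar (typ_inst A) (cInst A) \<cdot> a)"
      using le_opp[of "pwr_ord (cTyp A)" "lft (deriv A) \<cdot> a" b] ab c s t p by (simp add: deriv_eq[OF A])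
    also have "\<dots> \<longleftrightarrow> le (pwr_ord (cInst A)) a (polar (inst_typ A) (cTyp A) \<cdot> b)"
    proof
      assume "le (pwr_ord (cTyp A)) b (polar (typ_inst A) (cInst A) \<cdot> a)"
      then show "le (pwr_ord (cInst A)) a (polar (inst_typ A) (cTyp A) \<cdot> b)"
        by (rule polar_galois[OF t i _ ab(1) c(1) ab(2) c(2) ab(3), rotated]) (use it in simp)
    next
      assume "le (pwr_ord (cInst A)) a (polar (inst_typ A) (cTyp A) \<cdot> b)"
      then show "le (pwr_ord (cTyp A)) b (polar (typ_inst A) (cInst A) \<cdot> a)"
        by (rule polar_galois[OF i t _ ab(2) c(2) ab(1) c(1) ab(3)[symmetric], rotated]) (use it in simp)
    qed
    finally show "le (opp (pwr_ord (cTyp A))) (lft (deriv A) \<cdot> a) b \<longleftrightarrow> le (pwr_ord (cInst A)) a (rgt (deriv A) \<cdot> b)"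
      by (simp add: deriv_eq[OF A])
  qed (use s i t p in \<open>simp_all add: is_preorder_opp deriv_eq[OF A]\<close>)
qed

lemma mem_deriv:
  assumes A: "is_clsn A" and s: "S \<in> Arr B" "y \<in> Arr B" "Dom B S = Dom B y" "Cod B S = Pwr B (cInst A)" "Cod B y = cTyp A"
  shows "mem y (lft (deriv A) \<cdot> S) \<longleftrightarrow> le (pwr_ord (cInst A)) S (typ_inst A \<cdot> y)"
  using mem_polar[of "typ_inst A" "cInst A" S y] typ_inst_arr[OF A] is_clsnD[OF A] s by (simp add: deriv_eq[OF A])

lemma mem_deriv_singleton:
  assumes A: "is_clsn A" and s: "x \<in> Arr B" "y \<in> Arr B" "Dom B x = Dom B y" "Cod B x = cInst A" "Cod B y = cTyp A"
  shows "mem y (lft (deriv A) \<cdot> (singleton (cInst A) \<cdot> x)) \<longleftrightarrow> lies (pair x y) (cSat A)"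
  using mem_deriv[OF A, of "singleton (cInst A) \<cdot> x" y] le_singleton[of x "cInst A" "typ_inst A \<cdot> y"]
    mem_typ_inst[OF A s] typ_inst_arr[OF A] is_clsnD[OF A] s by simp

text \<open>An adjunction between powers is determined by its left adjoint on singletons: since
  \<open>rgt g {y} = {x. y \<in> lft g {x}}\<close>, one has \<open>y \<in> lft g S\<close> iff \<open>S \<subseteq> {x. y \<in> lft g {x}}\<close>.\<close>

lemma deriv_unique:
  assumes A: "is_clsn A" and g: "is_adj (pwr_ord (cInst A)) (opp (pwr_ord (cTyp A))) g"
    and sat: "\<And>x y. x \<in> Arr B \<Longrightarrow> y \<in> Arr B \<Longrightarrow> Dom B x = Dom B y \<Longrightarrow> Cod B x = cInst A \<Longrightarrow> Cod B y = cTyp A \<Longrightarrow>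
      mem y (lft g \<cdot> (singleton (cInst A) \<cdot> x)) \<longleftrightarrow> lies (pair x y) (cSat A)"
  shows "g = deriv A"
proof -
  let ?X = "cInst A" and ?Y = "cTyp A"
  note o = is_clsnD[OF A] and t = typ_inst_arr[OF A]
  have gs: "lft g \<in> Arr B" "Dom B (lft g) = Pwr B ?X" "Cod B (lft g) = Pwr B ?Y"
    "rgt g \<in> Arr B" "Dom B (rgt g) = Pwr B ?Y" "Cod B (rgt g) = Pwr B ?X"
    using is_adj_simps[OF g] by simp_all
  have ds: "lft (deriv A) \<in> Arr B" "Dom B (lft (deriv A)) = Pwr B ?X" "Cod B (lft (deriv A)) = Pwr B ?Y"
    using is_adj_simps[OF is_adj_deriv[OF A]] by simp_all
  have gal: "le (pwr_ord ?X) S (rgt g \<cdot> U) \<longleftrightarrow> le (pwr_ord ?Y) U (lft g \<cdot> S)"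
    if "S \<in> Arr B" "U \<in> Arr B" "Dom B U = Dom B S" "Cod B S = Pwr B ?X" "Cod B U = Pwr B ?Y" for S U
    using adj_galois[OF g, of S U] that gs o by (simp add: le_opp)
  have mem_g: "mem y (lft g \<cdot> S) \<longleftrightarrow> le (pwr_ord ?X) S (rgt g \<cdot> (singleton ?Y \<cdot> y))"
    if "S \<in> Arr B" "y \<in> Arr B" "Dom B S = Dom B y" "Cod B S = Pwr B ?X" "Cod B y = ?Y" for S y
    using gal[of S "singleton ?Y \<cdot> y"] le_singleton[of y ?Y "lft g \<cdot> S"] that gs o by simp
  have r: "rgt g \<cdot> (singleton ?Y \<cdot> y) = typ_inst A \<cdot> y" if y: "y \<in> Arr B" "Cod B y = ?Y" for y
  proof (rule Pwr_ext[where X = ?X])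
    fix u x assume u: "u \<in> Arr B" "x \<in> Arr B" "Dom B u = Dom B x" "Cod B u = Dom B (rgt g \<cdot> (singleton ?Y \<cdot> y))" "Cod B x = ?X"
    have cu: "Cod B u = Dom B y" using u(4) y gs o by simp
    have "mem x (rgt g \<cdot> (singleton ?Y \<cdot> (y \<cdot> u))) \<longleftrightarrow> mem (y \<cdot> u) (lft g \<cdot> (singleton ?X \<cdot> x))"
      using mem_g[of "singleton ?X \<cdot> x" "y \<cdot> u"] le_singleton[of x ?X "rgt g \<cdot> (singleton ?Y \<cdot> (y \<cdot> u))"] u cu y gs o by simp
    also have "\<dots> \<longleftrightarrow> mem x (typ_inst A \<cdot> (y \<cdot> u))"
      using sat[of x "y \<cdot> u"] mem_typ_inst[OF A, of x "y \<cdot> u"] u cu y by simp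
    finally show "mem x ((rgt g \<cdot> (singleton ?Y \<cdot> y)) \<cdot> u) \<longleftrightarrow> mem x ((typ_inst A \<cdot> y) \<cdot> u)"
      using u cu y gs o t by simp
  qed (use y gs o t in simp_all)
  have l: "lft g = lft (deriv A)"
  proof (rule Pwr_ext[where X = ?Y])
    fix S y assume "S \<in> Arr B" "y \<in> Arr B" "Dom B S = Dom B y" "Cod B S = Dom B (lft g)" "Cod B y = ?Y"
    then show "mem y (lft g \<cdot> S) \<longleftrightarrow> mem y (lft (deriv A) \<cdot> S)"
      using mem_g[of S y] mem_deriv[OF A, of S y] r[of y] gs by simp
  qed (use gs ds o in simp_all)
  show ?thesis
    by (rule adj_eqI[OF l rgt_unique[OF g is_adj_deriv[OF A] l]]) (use o in \<open>simp add: antisymmetric_pwr_ord\<close>)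
qed

text \<open>From left to right, the condition says that \<open>typ_inst A2\<close> after
  \<open>t\<close> equals \<open>pre_image i\<close> after \<open>typ_inst A1\<close>. Hence y lies
  in \<open>pre_image t \<cdot> lft (deriv A2)\<close> at S iff S is below the inverse image under
  \<open>i\<close> of \<open>typ_inst A1\<close> at y, and transposing along
  \<open>dir_adj i\<close> gives the other left component. The right components agree by uniqueness
  of adjoints. From right to left, evaluate the left components at the singleton of x, which
  \<open>dir_image i\<close> sends to the singleton of \<open>i \<cdot> x\<close>.\<close>

lemma sat_square:
  assumes A1: "is_clsn A1" and A2: "is_clsn A2"
    and i: "i \<in> Arr B" "Dom B i = cInst A2" "Cod B i = cInst A1"
    and t: "t \<in> Arr B" "Dom B t = cTyp A1" "Cod B t = cTyp A2"
  shows "(\<forall>x y. x \<in> Arr B \<longrightarrow> y \<in> Arr B \<longrightarrow> Dom B x = Dom B y \<longrightarrow> Cod B x = cInst A2 \<longrightarrow> Cod B y = cTyp A1 \<longrightarrow>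
      lies (pair (i \<cdot> x) y) (cSat A1) = lies (pair x (t \<cdot> y)) (cSat A2)) \<longleftrightarrow>
    adj_then (deriv A2) (inv_adj t) = adj_then (dir_adj i) (deriv A1)" (is "?L \<longleftrightarrow> ?R")
proof
  let ?X1 = "cInst A1" and ?X2 = "cInst A2" and ?Y1 = "cTyp A1" and ?Y2 = "cTyp A2"
  note o = is_clsnD[OF A1] is_clsnD[OF A2] and ti = typ_inst_arr[OF A1] typ_inst_arr[OF A2]
  have ds: "lft (deriv A1) \<in> Arr B" "Dom B (lft (deriv A1)) = Pwr B ?X1" "Cod B (lft (deriv A1)) = Pwr B ?Y1"
    "lft (deriv A2) \<in> Arr B" "Dom B (lft (deriv A2)) = Pwr B ?X2" "Cod B (lft (deriv A2)) = Pwr B ?Y2"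
    using is_adj_simps[OF is_adj_deriv[OF A1]] is_adj_simps[OF is_adj_deriv[OF A2]] by simp_all
  {
    assume sat: ?L
    have adj: "is_adj (pwr_ord ?X2) (opp (pwr_ord ?Y1)) (adj_then (deriv A2) (inv_adj t))"
      "is_adj (pwr_ord ?X2) (opp (pwr_ord ?Y1)) (adj_then (dir_adj i) (deriv A1))"
      using is_adj_then[OF is_adj_deriv[OF A2], of "opp (pwr_ord ?Y1)" "inv_adj t"]
        is_adj_then[OF _ is_adj_deriv[OF A1], of "pwr_ord ?X2" "dir_adj i"] is_adj_inv[of t] is_adj_dir[of i] i t by simp_all
    have h: "typ_inst A2 \<cdot> (t \<cdot> y) = pre_image i \<cdot> (typ_inst A1 \<cdot> y)" if y: "y \<in> Arr B" "Cod B y = ?Y1" for y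
    proof (rule Pwr_ext[where X = ?X2])
      fix u x assume u: "u \<in> Arr B" "x \<in> Arr B" "Dom B u = Dom B x" "Cod B u = Dom B (typ_inst A2 \<cdot> (t \<cdot> y))" "Cod B x = ?X2"
      have cu: "Cod B u = Dom B y" using u(4) y t ti by simp
      show "mem x ((typ_inst A2 \<cdot> (t \<cdot> y)) \<cdot> u) \<longleftrightarrow> mem x ((pre_image i \<cdot> (typ_inst A1 \<cdot> y)) \<cdot> u)"
        using sat[rule_format, of x "y \<cdot> u"] mem_typ_inst[OF A2, of x "t \<cdot> (y \<cdot> u)"] mem_typ_inst[OF A1, of "i \<cdot> x" "y \<cdot> u"]
          mem_pre_image[OF i(1), of "typ_inst A1 \<cdot> (y \<cdot> u)" x] u cu y i t ti by simp
    qed (use y i t ti o in simp_all)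
    have l: "pre_image t \<cdot> lft (deriv A2) = lft (deriv A1) \<cdot> dir_image i"
    proof (rule Pwr_ext[where X = ?Y1])
      fix S y assume S: "S \<in> Arr B" "y \<in> Arr B" "Dom B S = Dom B y" "Cod B S = Dom B (pre_image t \<cdot> lft (deriv A2))" "Cod B y = ?Y1"
      have cS: "Cod B S = Pwr B ?X2" using S(4) t ds by simp
      have "mem y (pre_image t \<cdot> (lft (deriv A2) \<cdot> S)) \<longleftrightarrow> le (pwr_ord ?X2) S (pre_image i \<cdot> (typ_inst A1 \<cdot> y))"
        using mem_pre_image[OF t(1), of "lft (deriv A2) \<cdot> S" y] mem_deriv[OF A2, of S "t \<cdot> y"] h[of y] S cS t ds by simp
      also have "\<dots> \<longleftrightarrow> mem y (lft (deriv A1) \<cdot> (dir_image i \<cdot> S))"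
        using mem_deriv[OF A1, of "dir_image i \<cdot> S" y] adj_galois[OF is_adj_dir[OF i(1)], of S "typ_inst A1 \<cdot> y"] S cS i ti
        by (simp add: dir_adj_def)
      finally show "mem y ((pre_image t \<cdot> lft (deriv A2)) \<cdot> S) \<longleftrightarrow> mem y ((lft (deriv A1) \<cdot> dir_image i) \<cdot> S)"
        using S cS i t ds by simp
    qed (use i t ds o in simp_all)
    then have l: "lft (adj_then (deriv A2) (inv_adj t)) = lft (adj_then (dir_adj i) (deriv A1))"
      by (simp add: dir_adj_def inv_adj_def)
    show ?R
      by (rule adj_eqI[OF l rgt_unique[OF adj l]]) (use o in \<open>simp add: antisymmetric_pwr_ord\<close>)
  }
  assume ?R
  then have "lft (adj_then (deriv A2) (inv_adj t)) = lft (adj_then (dir_adj i) (deriv A1))" by simp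
  then have l: "pre_image t \<cdot> lft (deriv A2) = lft (deriv A1) \<cdot> dir_image i"
    by (simp add: dir_adj_def inv_adj_def)
  show ?L
  proof (intro allI impI)
    fix x y assume s: "x \<in> Arr B" "y \<in> Arr B" "Dom B x = Dom B y" "Cod B x = ?X2" "Cod B y = ?Y1"
    let ?s = "singleton ?X2 \<cdot> x"
    have "lies (pair x (t \<cdot> y)) (cSat A2) \<longleftrightarrow> mem y (pre_image t \<cdot> (lft (deriv A2) \<cdot> ?s))"
      using mem_deriv_singleton[OF A2, of x "t \<cdot> y"] mem_pre_image[OF t(1), of "lft (deriv A2) \<cdot> ?s" y] s t ds o by simp
    also have "pre_image t \<cdot> (lft (deriv A2) \<cdot> ?s) = lft (deriv A1) \<cdot> (dir_image i \<cdot> ?s)"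
      using Cmp_split_cong[OF l, of ?s] s t i ds o by simp
    also have "dir_image i \<cdot> ?s = singleton ?X1 \<cdot> (i \<cdot> x)"
      using dir_image_singleton[OF i(1), of x] s i by simp
    also have "mem y (lft (deriv A1) \<cdot> (singleton ?X1 \<cdot> (i \<cdot> x))) \<longleftrightarrow> lies (pair (i \<cdot> x) y) (cSat A1)"
      using mem_deriv_singleton[OF A1, of "i \<cdot> x" y] s i by simp
    finally show "lies (pair (i \<cdot> x) y) (cSat A1) = lies (pair x (t \<cdot> y)) (cSat A2)" by simp
  qed
qed

section \<open>Polar factorization and diagonals\<close>

lemma adj_then_assoc:
  assumes "is_adj P Q g" "is_adj Q R h" "is_adj R S k"
  shows "adj_then (adj_then g h) k = adj_then g (adj_then h k)"
  by (rule adj_eqI) (use is_adj_simps[OF assms(1)] is_adj_simps[OF assms(2)] is_adj_simps[OF assms(3)] in simp_all)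

lemma adj_then_id:
  assumes "is_adj P Q g"
  shows "adj_then (adj_id P) g = g" "adj_then g (adj_id Q) = g"
  by (rule adj_eqI; use is_adj_simps[OF assms] in \<open>simp add: adj_id_def\<close>)+

lemma inv_adj_Cmp:
  assumes "f \<in> Arr B" "g \<in> Arr B" "Dom B g = Cod B f"
  shows "inv_adj (g \<cdot> f) = adj_then (inv_adj g) (inv_adj f)"
  using dir_adj_Cmp[OF assms] by (simp add: dir_adj_def inv_adj_def adj_then_def)

lemma inv_adj_Ide:
  assumes "X \<in> Obj B"
  shows "inv_adj (Ide B X) = adj_id (opp (pwr_ord X))"
  using dir_adj_Ide[OF assms] by (simp add: dir_adj_def inv_adj_def adj_id_def)

section \<open>Axis and polar factorization of an adjunction between antisymmetric preorders\<close>

context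
  fixes P Q g
  assumes g: "is_adj P Q g" and P: "antisymmetric P" and Q: "antisymmetric Q"
begin

lemmas adj_typing [simp] = is_adj_simps[OF g]

text \<open>Counit and unit give the two inequalities, and antisymmetry of \<open>Q\<close> makes
  them an equality. It says that \<open>rgt g \<cdot> lft g\<close> and \<open>lft g\<close> form a
  bipolar pair, so that the lift in \<open>polar_refl\<close> exists.\<close>

lemma lft_rgt_lft: "lft g \<cdot> (rgt g \<cdot> lft g) = lft g"
proof (rule antisymmetricD[OF Q])
  show "le Q (lft g \<cdot> (rgt g \<cdot> lft g)) (lft g)" using adj_counit[OF g, of "lft g"] by simp
  have "le Q (lft g \<cdot> Ide B (car P)) (lft g \<cdot> (rgt g \<cdot> (lft g \<cdot> Ide B (car P))))"
    by (rule adj_mono(1)[OF g _ _ _ adj_unit[OF g]]) simp_all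
  then show "le Q (lft g) (lft g \<cdot> (rgt g \<cdot> lft g))" by simp
qed simp_all

lemma rgt_lft_rgt: "rgt g \<cdot> (lft g \<cdot> rgt g) = rgt g"
proof (rule antisymmetricD[OF P])
  show "le P (rgt g) (rgt g \<cdot> (lft g \<cdot> rgt g))" using adj_unit[OF g, of "rgt g"] by simp
  have "le P (rgt g \<cdot> (lft g \<cdot> (rgt g \<cdot> Ide B (car Q)))) (rgt g \<cdot> Ide B (car Q))"
    by (rule adj_mono(2)[OF g _ _ _ adj_counit[OF g]]) simp_all
  then show "le P (rgt g \<cdot> (lft g \<cdot> rgt g)) (rgt g)" by simp
qed simp_all

lemma axis_arr_simps:
  shows "monic (axis_arr P Q g)" "axis_arr P Q g \<in> Arr B" "Cod B (axis_arr P Q g) = Prod B (car P) (car Q)"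
    "Dom B (axis_arr P Q g) = car (axis P Q g)" "car (axis P Q g) \<in> Obj B"
    and factors_axis_arr: "\<And>a b. a \<in> Arr B \<Longrightarrow> b \<in> Arr B \<Longrightarrow> Dom B a = Dom B b \<Longrightarrow> Cod B a = car P \<Longrightarrow> Cod B b = car Q \<Longrightarrow>
      factors (pair a b) (axis_arr P Q g) \<longleftrightarrow> a = rgt g \<cdot> b \<and> b = lft g \<cdot> a"
proof -
  let ?W = "Prod B (car P) (car Q)"
  let ?v = "pair (rgt g \<cdot> Snd B (car P) (car Q)) (lft g \<cdot> Fst B (car P) (car Q))"
  have r: "represents (axis_arr P Q g) (\<lambda>z. Ide B ?W \<cdot> z = ?v \<cdot> z)"
    unfolding axis_arr_def by (rule represents_Eql) simp_all
  then show "monic (axis_arr P Q g)" by (simp add: represents_def)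
  show c: "axis_arr P Q g \<in> Arr B" "Cod B (axis_arr P Q g) = ?W" unfolding axis_arr_def by simp_all
  show d: "Dom B (axis_arr P Q g) = car (axis P Q g)" by (simp add: axis_def)
  show "car (axis P Q g) \<in> Obj B" unfolding d[symmetric] using c by simp
  show "factors (pair a b) (axis_arr P Q g) \<longleftrightarrow> a = rgt g \<cdot> b \<and> b = lft g \<cdot> a"
    if "a \<in> Arr B" "b \<in> Arr B" "Dom B a = Dom B b" "Cod B a = car P" "Cod B b = car Q" for a b
    using r that c by (simp add: represents_def pair_eq_iff)
qed

lemma axis_fst_snd:
  shows "axis_fst P Q g \<in> Arr B" "Dom B (axis_fst P Q g) = car (axis P Q g)" "Cod B (axis_fst P Q g) = car P"
    "axis_snd P Q g \<in> Arr B" "Dom B (axis_snd P Q g) = car (axis P Q g)" "Cod B (axis_snd P Q g) = car Q"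
    and axis_fst_eq: "rgt g \<cdot> axis_snd P Q g = axis_fst P Q g"
    and axis_snd_eq: "lft g \<cdot> axis_fst P Q g = axis_snd P Q g"
proof -
  note s = axis_arr_simps(2-4)
  show t: "axis_fst P Q g \<in> Arr B" "Dom B (axis_fst P Q g) = car (axis P Q g)" "Cod B (axis_fst P Q g) = car P"
    "axis_snd P Q g \<in> Arr B" "Dom B (axis_snd P Q g) = car (axis P Q g)" "Cod B (axis_snd P Q g) = car Q"
    using s by (simp_all add: axis_fst_def axis_snd_def)
  have "axis_arr P Q g = pair (axis_fst P Q g) (axis_snd P Q g)"
    by (rule pair_unique) (use s in \<open>simp_all add: axis_fst_def axis_snd_def\<close>)
  then have "factors (pair (axis_fst P Q g) (axis_snd P Q g)) (axis_arr P Q g)"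
    using factors_refl[OF s(1)] by simp
  moreover have "Dom B (axis_fst P Q g) = Dom B (axis_snd P Q g)" using t by simp
  ultimately have "axis_fst P Q g = rgt g \<cdot> axis_snd P Q g \<and> axis_snd P Q g = lft g \<cdot> axis_fst P Q g"
    using factors_axis_arr[OF t(1,4) _ t(3,6)] by blast
  then show "rgt g \<cdot> axis_snd P Q g = axis_fst P Q g" "lft g \<cdot> axis_fst P Q g = axis_snd P Q g"
    by metis+
qed

text \<open>The second component of a bipolar pair is \<open>lft g\<close> of the first, so the
  first projection out of the axis is monic.\<close>

lemma axis_ext:
  assumes a: "a \<in> Arr B" "b \<in> Arr B" "Dom B b = Dom B a" "Cod B a = car (axis P Q g)" "Cod B b = car (axis P Q g)"
    and eq: "axis_fst P Q g \<cdot> a = axis_fst P Q g \<cdot> b"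
  shows "a = b"
proof -
  note s = axis_arr_simps(2-4) and t = axis_fst_snd(1-6)
  have "axis_snd P Q g \<cdot> a = axis_snd P Q g \<cdot> b"
    using Cmp_split_cong[OF axis_snd_eq, of a] Cmp_split_cong[OF axis_snd_eq, of b] eq a t by simp
  then have "Fst B (car P) (car Q) \<cdot> (axis_arr P Q g \<cdot> a) = Fst B (car P) (car Q) \<cdot> (axis_arr P Q g \<cdot> b)"
    "Snd B (car P) (car Q) \<cdot> (axis_arr P Q g \<cdot> a) = Snd B (car P) (car Q) \<cdot> (axis_arr P Q g \<cdot> b)"
    using eq a s by (simp_all add: axis_fst_def axis_snd_def)
  then have "axis_arr P Q g \<cdot> a = axis_arr P Q g \<cdot> b"
    by (rule Prod_ext) (use s a in simp_all)
  then show ?thesis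
    by (rule monicD[OF axis_arr_simps(1)]) (use s a in simp_all)
qed

text \<open>Resolves the definite description in \<open>lift\<close>: a bipolar pair factors through
  the equalizer, uniquely because \<open>axis_arr\<close> is monic.\<close>

lemma lift_axis:
  assumes a: "a \<in> Arr B" "b \<in> Arr B" "Dom B a = Dom B b" "Cod B a = car P" "Cod B b = car Q"
    and ab: "a = rgt g \<cdot> b" "b = lft g \<cdot> a"
  defines "w \<equiv> lift (axis_arr P Q g) (pair a b)"
  shows "w \<in> Arr B" "Dom B w = Dom B b" "Cod B w = car (axis P Q g)"
    "axis_fst P Q g \<cdot> w = a" "axis_snd P Q g \<cdot> w = b"
proof -
  note s = axis_arr_simps(2-4)
  let ?m = "axis_arr P Q g"
  have "factors (pair a b) ?m" using factors_axis_arr[OF a] ab by blast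
  then obtain u where u: "u \<in> Arr B" "Cod B u = Dom B ?m" "Dom B u = Dom B (pair a b)" "pair a b = ?m \<cdot> u"
    using s(1) by (elim factorsE)
  have du: "Dom B u = Dom B b" using u(3) a by simp
  have "w = u"
    unfolding w_def lift_def
  proof (rule the_equality)
    show "u \<in> hom B (Dom B (pair a b)) (Dom B ?m) \<and> ?m \<cdot> u = pair a b" using u by (simp add: hom_iff)
    fix v assume v: "v \<in> hom B (Dom B (pair a b)) (Dom B ?m) \<and> ?m \<cdot> v = pair a b"
    then have "?m \<cdot> v = ?m \<cdot> u" using u(4) by simp
    then show "v = u"
      by (rule monicD[OF axis_arr_simps(1)]) (use u(1-3) v in \<open>simp_all add: hom_iff\<close>)
  qed
  with u(1,2) du s show w: "w \<in> Arr B" "Dom B w = Dom B b" "Cod B w = car (axis P Q g)" by simp_all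
  have "?m \<cdot> w = pair a b" using u(4) \<open>w = u\<close> by simp
  then show "axis_fst P Q g \<cdot> w = a" "axis_snd P Q g \<cdot> w = b"
    using w s a by (simp_all add: axis_fst_def axis_snd_def)
qed

lemma le_axis:
  assumes "a \<in> Arr B" "b \<in> Arr B" "Dom B b = Dom B a" "Cod B a = car (axis P Q g)" "Cod B b = car (axis P Q g)"
  shows "le (axis P Q g) a b \<longleftrightarrow> le P (axis_fst P Q g \<cdot> a) (axis_fst P Q g \<cdot> b)"
  using assms axis_fst_snd(1-3) preorder_Sub[of P]
    lies_pull[of "cross (axis_fst P Q g) (axis_fst P Q g)" "leq P" "pair a b"]
  by (simp add: le_def axis_def)

lemma is_preorder_axis: "is_preorder (axis P Q g)"
proof (rule is_preorderI)
  note t = axis_fst_snd(1-3)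
  show "car (axis P Q g) \<in> Obj B" by (rule axis_arr_simps(5))
  show "leq (axis P Q g) \<in> Sub (Prod B (car (axis P Q g)) (car (axis P Q g)))"
    using pull_Sub[of "cross (axis_fst P Q g) (axis_fst P Q g)" "leq P"] preorder_Sub[of P] t
    by (simp add: axis_def)
  fix a assume "a \<in> Arr B" "Cod B a = car (axis P Q g)"
  then show "le (axis P Q g) a a" using t by (simp add: le_axis le_refl)
next
  note t = axis_fst_snd(1-3)
  fix a b c assume a: "le (axis P Q g) a b" "le (axis P Q g) b c" "a \<in> Arr B" "b \<in> Arr B" "c \<in> Arr B"
    "Dom B b = Dom B a" "Dom B c = Dom B a" "Cod B a = car (axis P Q g)" "Cod B b = car (axis P Q g)" "Cod B c = car (axis P Q g)"
  then have "le P (axis_fst P Q g \<cdot> a) (axis_fst P Q g \<cdot> b)" "le P (axis_fst P Q g \<cdot> b) (axis_fst P Q g \<cdot> c)"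
    by (simp_all add: le_axis)
  then have "le P (axis_fst P Q g \<cdot> a) (axis_fst P Q g \<cdot> c)"
    by (rule le_trans) (use a t in simp_all)
  with a show "le (axis P Q g) a c" by (simp add: le_axis)
qed

lemma polar_refl_simps:
  "lft (polar_refl P Q g) \<in> Arr B" "Dom B (lft (polar_refl P Q g)) = car P"
  "Cod B (lft (polar_refl P Q g)) = car (axis P Q g)"
  "axis_fst P Q g \<cdot> lft (polar_refl P Q g) = rgt g \<cdot> lft g"
  "axis_snd P Q g \<cdot> lft (polar_refl P Q g) = lft g"
  "rgt (polar_refl P Q g) = axis_fst P Q g"
  using lift_axis[of "rgt g \<cdot> lft g" "lft g"] lft_rgt_lft by (simp_all add: polar_refl_def)

lemma polar_corefl_simps:
  "rgt (polar_corefl P Q g) \<in> Arr B" "Dom B (rgt (polar_corefl P Q g)) = car Q"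
  "Cod B (rgt (polar_corefl P Q g)) = car (axis P Q g)"
  "axis_fst P Q g \<cdot> rgt (polar_corefl P Q g) = rgt g"
  "axis_snd P Q g \<cdot> rgt (polar_corefl P Q g) = lft g \<cdot> rgt g"
  "lft (polar_corefl P Q g) = axis_snd P Q g"
  using lift_axis[of "rgt g" "lft g \<cdot> rgt g"] rgt_lft_rgt by (simp_all add: polar_corefl_def)

text \<open>First components of axis elements are fixed by the closure
  \<open>rgt g \<cdot> lft g\<close>, so the closure of \<open>a\<close> is below such a component
  iff \<open>a\<close> is. The composite on the axis is the identity because this can be tested
  after the monic first projection.\<close>

lemma is_reflection_polar_refl: "is_reflection P (axis P Q g) (polar_refl P Q g)"
proof -
  let ?e = "lft (polar_refl P Q g)" and ?p = "axis_fst P Q g" and ?q = "axis_snd P Q g"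
  note t = axis_fst_snd(1-6) and e = polar_refl_simps(1-3)
  have "is_adj P (axis P Q g) (polar_refl P Q g)"
  proof (rule is_adjI)
    fix a b assume a: "a \<in> Arr B" "b \<in> Arr B" "Dom B b = Dom B a" "Cod B a = car P" "Cod B b = car (axis P Q g)"
    have pe: "?p \<cdot> (?e \<cdot> a) = rgt g \<cdot> (lft g \<cdot> a)"
      using Cmp_split_cong[OF polar_refl_simps(4), of a] a t e by simp
    have pb: "rgt g \<cdot> (lft g \<cdot> (?p \<cdot> b)) = ?p \<cdot> b"
      using Cmp_split_cong[OF axis_fst_eq, of b] Cmp_split_cong[OF axis_snd_eq, of b] a t by simp
    have "le P (rgt g \<cdot> (lft g \<cdot> a)) (?p \<cdot> b) \<longleftrightarrow> le P a (?p \<cdot> b)"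
    proof
      assume "le P (rgt g \<cdot> (lft g \<cdot> a)) (?p \<cdot> b)"
      then show "le P a (?p \<cdot> b)"
        by (rule le_trans[OF adj_unit[OF g a(1,4)]]) (use a t in simp_all)
    next
      assume "le P a (?p \<cdot> b)"
      then have "le Q (lft g \<cdot> a) (lft g \<cdot> (?p \<cdot> b))"
        by (rule adj_mono(1)[OF g, rotated 3]) (use a t in simp_all)
      then have "le P (rgt g \<cdot> (lft g \<cdot> a)) (rgt g \<cdot> (lft g \<cdot> (?p \<cdot> b)))"
        by (rule adj_mono(2)[OF g, rotated 3]) (use a t in simp_all)
      then show "le P (rgt g \<cdot> (lft g \<cdot> a)) (?p \<cdot> b)" using pb by simp
    qed
    then show "le (axis P Q g) (?e \<cdot> a) b \<longleftrightarrow> le P a (rgt (polar_refl P Q g) \<cdot> b)"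
      using le_axis[of "?e \<cdot> a" b] pe a t e by (simp add: polar_refl_simps(6))
  qed (use t e in \<open>simp_all add: is_preorder_axis polar_refl_simps(6)\<close>)
  moreover have "?e \<cdot> ?p = Ide B (car (axis P Q g))"
  proof (rule axis_ext)
    show "?p \<cdot> (?e \<cdot> ?p) = ?p \<cdot> Ide B (car (axis P Q g))"
      using Cmp_split_cong[OF polar_refl_simps(4), of ?p] axis_fst_eq axis_snd_eq t e by simp
  qed (use t e axis_arr_simps(5) in simp_all)
  ultimately show ?thesis by (simp add: is_reflection_def polar_refl_simps(6))
qed

text \<open>The axis is ordered by first components, and its second projection is
  \<open>lft g\<close> of the first; the Galois condition required here is therefore that of
  \<open>g\<close>.\<close>

lemma is_coreflection_polar_corefl: "is_coreflection (axis P Q g) Q (polar_corefl P Q g)"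
proof -
  let ?m = "rgt (polar_corefl P Q g)" and ?p = "axis_fst P Q g" and ?q = "axis_snd P Q g"
  note t = axis_fst_snd(1-6) and e = polar_corefl_simps(1-3)
  have "is_adj (axis P Q g) Q (polar_corefl P Q g)"
  proof (rule is_adjI)
    fix a b assume a: "a \<in> Arr B" "b \<in> Arr B" "Dom B b = Dom B a" "Cod B a = car (axis P Q g)" "Cod B b = car Q"
    have pm: "?p \<cdot> (?m \<cdot> b) = rgt g \<cdot> b"
      using Cmp_split_cong[OF polar_corefl_simps(4), of b] a t e by simp
    have "le Q (?q \<cdot> a) b \<longleftrightarrow> le P (?p \<cdot> a) (rgt g \<cdot> b)"
      using adj_galois[OF g, of "?p \<cdot> a" b] Cmp_split_cong[OF axis_snd_eq, of a] a t by simp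
    then show "le Q (lft (polar_corefl P Q g) \<cdot> a) b \<longleftrightarrow> le (axis P Q g) a (?m \<cdot> b)"
      using le_axis[of a "?m \<cdot> b"] pm a t e by (simp add: polar_corefl_simps(6))
  qed (use t e in \<open>simp_all add: is_preorder_axis polar_corefl_simps(6)\<close>)
  moreover have "?m \<cdot> ?q = Ide B (car (axis P Q g))"
  proof (rule axis_ext)
    show "?p \<cdot> (?m \<cdot> ?q) = ?p \<cdot> Ide B (car (axis P Q g))"
      using Cmp_split_cong[OF polar_corefl_simps(4), of ?q] axis_fst_eq t e by simp
  qed (use t e axis_arr_simps(5) in simp_all)
  ultimately show ?thesis by (simp add: is_coreflection_def polar_corefl_simps(6))
qed

lemma polar_factorization: "adj_then (polar_refl P Q g) (polar_corefl P Q g) = g"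
  by (rule adj_eqI) (simp_all add: polar_refl_simps(5,6) polar_corefl_simps(4,6))

end

section \<open>Cancellation and diagonals for reflections and coreflections\<close>

lemma adj_cancel:
  assumes e: "is_reflection P L e" and m: "is_coreflection M Q m"
    and d: "is_adj L M d" "is_adj L M d'"
    and eq: "adj_then e d = adj_then e d'" "adj_then d m = adj_then d' m"
  shows "d = d'"
proof (rule adj_eqI)
  have ae: "is_adj P L e" "lft e \<cdot> rgt e = Ide B (car L)" and am: "is_adj M Q m" "rgt m \<cdot> lft m = Ide B (car M)"
    using e m by (simp_all add: is_reflection_def is_coreflection_def)
  note s = is_adj_simps[OF ae(1)] is_adj_simps[OF am(1)] is_adj_simps[OF d(1)] is_adj_simps[OF d(2)]
  have l: "lft d \<cdot> lft e = lft d' \<cdot> lft e" using eq(1) by (auto simp: adj_then_def)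
  have r: "rgt d \<cdot> rgt m = rgt d' \<cdot> rgt m" using eq(2) by (auto simp: adj_then_def)
  have "lft d \<cdot> (lft e \<cdot> rgt e) = lft d' \<cdot> (lft e \<cdot> rgt e)"
    using Cmp_split_cong[OF l, of "rgt e"] s by simp
  then show "lft d = lft d'" using ae(2) s by simp
  have "rgt d \<cdot> (rgt m \<cdot> lft m) = rgt d' \<cdot> (rgt m \<cdot> lft m)"
    using Cmp_split_cong[OF r, of "lft m"] s by simp
  then show "rgt d = rgt d'" using am(2) s by simp
qed

text \<open>The left component is taken from \<open>r\<close> and \<open>e\<close>, the right one
  from \<open>s\<close> and \<open>m\<close>, so their adjointness is not evident. It holds because
  \<open>lft m\<close> is an order embedding, \<open>rgt m\<close> being a retraction of it, and
  because \<open>lft m\<close> carries the left component to \<open>lft s\<close>: the Galois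
  condition becomes that of \<open>s\<close> at \<open>lft m \<cdot> b\<close>.\<close>

lemma diagonal:
  assumes e: "is_reflection P L e" and m: "is_coreflection M Q m"
    and s: "is_adj L Q s" and r: "is_adj P M r"
    and eq: "adj_then e s = adj_then r m"
  shows is_adj_diagonal: "is_adj L M (diagonal e s r m)"
    and reflection_diagonal: "adj_then e (diagonal e s r m) = r"
    and diagonal_coreflection: "adj_then (diagonal e s r m) m = s"
proof -
  have ae: "is_adj P L e" and ee: "lft e \<cdot> rgt e = Ide B (car L)"
    and am: "is_adj M Q m" and mm: "rgt m \<cdot> lft m = Ide B (car M)"
    using e m by (simp_all add: is_reflection_def is_coreflection_def)
  note t [simp] = is_adj_simps[OF ae] is_adj_simps[OF am] is_adj_simps[OF s] is_adj_simps[OF r]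
  have el: "lft s \<cdot> lft e = lft m \<cdot> lft r" and er: "rgt e \<cdot> rgt s = rgt r \<cdot> rgt m"
    using eq by (auto simp: adj_then_def)
  have ee': "lft e \<cdot> (rgt e \<cdot> a) = a" if "a \<in> Arr B" "Cod B a = car L" for a
    using Cmp_split_cong[OF ee, of a] that by simp
  have mm': "rgt m \<cdot> (lft m \<cdot> a) = a" if "a \<in> Arr B" "Cod B a = car M" for a
    using Cmp_split_cong[OF mm, of a] that by simp
  let ?l = "lft r \<cdot> rgt e" and ?r = "rgt s \<cdot> lft m"
  have ml: "lft m \<cdot> ?l = lft s" using Cmp_split_cong[OF el, of "rgt e"] ee by simp
  have er': "rgt e \<cdot> ?r = rgt r" using Cmp_split_cong[OF er, of "lft m"] mm by simp
  \<comment> \<open>Since \<open>lft m\<close> is split monic, it is enough to compare after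
    composing with it, where the given square applies. The next equation is dual, with
    \<open>rgt e\<close> split monic.\<close>
  have le': "?l \<cdot> lft e = lft r"
    using mm'[of "?l \<cdot> lft e"] Cmp_split_cong[OF ml, of "lft e"] el mm'[of "lft r"] by simp
  have rm: "?r \<cdot> rgt m = rgt s"
    using ee'[of "?r \<cdot> rgt m"] Cmp_split_cong[OF er', of "rgt m"] er ee'[of "rgt s"] by simp
  show "adj_then e (diagonal e s r m) = r" "adj_then (diagonal e s r m) m = s"
    using le' er' ml rm by (simp_all add: adj_then_def diagonal_def)
  show "is_adj L M (diagonal e s r m)"
  proof (rule is_adjI)
    fix a b assume a: "a \<in> Arr B" "b \<in> Arr B" "Dom B b = Dom B a" "Cod B a = car L" "Cod B b = car M"
    have "le M (?l \<cdot> a) b \<longleftrightarrow> le Q (lft m \<cdot> (?l \<cdot> a)) (lft m \<cdot> b)"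
      using adj_galois[OF am, of "?l \<cdot> a" "lft m \<cdot> b"] mm'[of b] a by simp
    also have "\<dots> \<longleftrightarrow> le L a (rgt s \<cdot> (lft m \<cdot> b))"
      using adj_galois[OF s, of a "lft m \<cdot> b"] Cmp_split_cong[OF ml, of a] a by simp
    finally show "le M (lft (diagonal e s r m) \<cdot> a) b \<longleftrightarrow> le L a (rgt (diagonal e s r m) \<cdot> b)"
      using a by (simp add: diagonal_def)
  qed (simp_all add: diagonal_def)
qed

section \<open>Classifications and conceptual structures\<close>

definition concept_adj :: "('o, 'm) cstruct \<Rightarrow> 'm adj" where
  "concept_adj L = adj_then (extent L) (intent L)"

lemma is_cstructD:
  assumes "is_cstruct L"
  shows "is_preorder (lOrd L)" "lInst L \<in> Obj B" "lTyp L \<in> Obj B"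
    "is_reflection (pwr_ord (lInst L)) (lOrd L) (extent L)"
    "is_coreflection (lOrd L) (opp (pwr_ord (lTyp L))) (intent L)"
    "is_adj (pwr_ord (lInst L)) (lOrd L) (extent L)"
    "is_adj (lOrd L) (opp (pwr_ord (lTyp L))) (intent L)"
    "is_adj (pwr_ord (lInst L)) (opp (pwr_ord (lTyp L))) (concept_adj L)"
proof -
  show e: "is_reflection (pwr_ord (lInst L)) (lOrd L) (extent L)" and m: "is_coreflection (lOrd L) (opp (pwr_ord (lTyp L))) (intent L)"
    and "is_preorder (lOrd L)" "lInst L \<in> Obj B" "lTyp L \<in> Obj B"
    using assms by (simp_all add: is_cstruct_def)
  from e m show "is_adj (pwr_ord (lInst L)) (lOrd L) (extent L)" "is_adj (lOrd L) (opp (pwr_ord (lTyp L))) (intent L)"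
    by (simp_all add: is_reflection_def is_coreflection_def)
  then show "is_adj (pwr_ord (lInst L)) (opp (pwr_ord (lTyp L))) (concept_adj L)"
    unfolding concept_adj_def by (rule is_adj_then)
qed

text \<open>Reduces the laws of \<open>Clg\<close>, functoriality and naturality to equations
  between instance and type morphisms, so that no adjunction component has to be computed.\<close>

lemma cmorphism_eqI:
  assumes h: "is_cmorphism h" and k: "is_cmorphism k"
    and eq: "mSrc h = mSrc k" "mTrg h = mTrg k" "mInst h = mInst k" "mTyp h = mTyp k"
  shows "h = k"
proof -
  have "mAdj h = mAdj k"
  proof (rule adj_cancel)
    show "is_reflection (pwr_ord (lInst (mTrg k))) (lOrd (mTrg k)) (extent (mTrg k))"
      "is_coreflection (lOrd (mSrc k)) (opp (pwr_ord (lTyp (mSrc k)))) (intent (mSrc k))"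
      using k is_cstructD by (auto simp: is_cmorphism_def)
    show "is_adj (lOrd (mTrg k)) (lOrd (mSrc k)) (mAdj h)" "is_adj (lOrd (mTrg k)) (lOrd (mSrc k)) (mAdj k)"
      "adj_then (extent (mTrg k)) (mAdj h) = adj_then (extent (mTrg k)) (mAdj k)"
      "adj_then (mAdj h) (intent (mSrc k)) = adj_then (mAdj k) (intent (mSrc k))"
      using h k eq by (simp_all add: is_cmorphism_def)
  qed
  with eq show ?thesis by simp
qed

text \<open>\<open>clg_arr\<close> is the case of two structures of the form
  \<open>clg_obj A\<close>. The general form also compares a structure \<open>L\<close> with
  \<open>clg_obj (clsn_obj L)\<close>.\<close>

definition fill_in :: "('o, 'm) cstruct \<Rightarrow> ('o, 'm) cstruct \<Rightarrow> 'm \<Rightarrow> 'm \<Rightarrow> ('o, 'm) cmorphism" where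
  "fill_in L1 L2 i t = \<lparr>mSrc = L1, mTrg = L2,
     mAdj = diagonal (extent L2) (adj_then (intent L2) (inv_adj t))
       (adj_then (dir_adj i) (extent L1)) (intent L1),
     mInst = i, mTyp = t\<rparr>"

text \<open>The two triangles of the diagonal are the extent condition and the intent
  condition.\<close>

lemma is_cmorphism_fill_in:
  assumes L1: "is_cstruct L1" and L2: "is_cstruct L2"
    and i: "i \<in> Arr B" "Dom B i = lInst L2" "Cod B i = lInst L1"
    and t: "t \<in> Arr B" "Dom B t = lTyp L1" "Cod B t = lTyp L2"
    and sq: "adj_then (concept_adj L2) (inv_adj t) = adj_then (dir_adj i) (concept_adj L1)"
  shows "is_cmorphism (fill_in L1 L2 i t)"
proof -
  note l1 = is_cstructD[OF L1] and l2 = is_cstructD[OF L2]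
  have di: "is_adj (pwr_ord (lInst L2)) (pwr_ord (lInst L1)) (dir_adj i)" using is_adj_dir[OF i(1)] i by simp
  have it: "is_adj (opp (pwr_ord (lTyp L2))) (opp (pwr_ord (lTyp L1))) (inv_adj t)" using is_adj_inv[OF t(1)] t by simp
  have "adj_then (extent L2) (adj_then (intent L2) (inv_adj t)) = adj_then (adj_then (dir_adj i) (extent L1)) (intent L1)"
    using sq adj_then_assoc[OF l2(6,7) it] adj_then_assoc[OF di l1(6,7)] by (simp add: concept_adj_def)
  note d = diagonal[OF l2(4) l1(5) is_adj_then[OF l2(7) it] is_adj_then[OF di l1(6)] this]
  show ?thesis
    unfolding is_cmorphism_def fill_in_def using L1 L2 i t d by (simp add: hom_iff)
qed

text \<open>Paste the extent and intent conditions along \<open>mAdj h\<close>. This is the converse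
  of \<open>is_cmorphism_fill_in\<close>.\<close>

lemma cmorphism_square:
  assumes h: "is_cmorphism h"
  shows "adj_then (concept_adj (mTrg h)) (inv_adj (mTyp h)) = adj_then (dir_adj (mInst h)) (concept_adj (mSrc h))"
proof -
  let ?L1 = "mSrc h" and ?L2 = "mTrg h"
  from h have L1: "is_cstruct ?L1" and L2: "is_cstruct ?L2" and a: "is_adj (lOrd ?L2) (lOrd ?L1) (mAdj h)"
    and i: "mInst h \<in> hom B (lInst ?L2) (lInst ?L1)" and t: "mTyp h \<in> hom B (lTyp ?L1) (lTyp ?L2)"
    and ext: "adj_then (extent ?L2) (mAdj h) = adj_then (dir_adj (mInst h)) (extent ?L1)"
    and int: "adj_then (mAdj h) (intent ?L1) = adj_then (intent ?L2) (inv_adj (mTyp h))"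
    by (simp_all add: is_cmorphism_def)
  note l1 = is_cstructD[OF L1] and l2 = is_cstructD[OF L2]
  have di: "is_adj (pwr_ord (lInst ?L2)) (pwr_ord (lInst ?L1)) (dir_adj (mInst h))"
    using is_adj_dir[of "mInst h"] i by (simp add: hom_iff)
  have it: "is_adj (opp (pwr_ord (lTyp ?L2))) (opp (pwr_ord (lTyp ?L1))) (inv_adj (mTyp h))"
    using is_adj_inv[of "mTyp h"] t by (simp add: hom_iff)
  show ?thesis
    unfolding concept_adj_def
    using adj_then_assoc[OF l2(6,7) it] adj_then_assoc[OF l2(6) a l1(7)] adj_then_assoc[OF di l1(6,7)] ext int
    by (simp del: adj_then_simps)
qed

text \<open>Compares the two pulled-back relations on pairs and then applies
  \<open>sat_square\<close>. In this form infomorphisms compose by pasting squares of adjunctions,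
  and match \<open>cmorphism_square\<close> directly.\<close>

lemma is_infomorphism_iff:
  "is_infomorphism f \<longleftrightarrow> is_clsn (iSrc f) \<and> is_clsn (iTrg f) \<and>
     iInst f \<in> hom B (cInst (iTrg f)) (cInst (iSrc f)) \<and>
     iTyp f \<in> hom B (cTyp (iSrc f)) (cTyp (iTrg f)) \<and>
     adj_then (deriv (iTrg f)) (inv_adj (iTyp f)) = adj_then (dir_adj (iInst f)) (deriv (iSrc f))"
proof -
  let ?A1 = "iSrc f" and ?A2 = "iTrg f" and ?i = "iInst f" and ?t = "iTyp f"
  have "pull (cross ?i (Ide B (cTyp ?A1))) (cSat ?A1) = pull (cross (Ide B (cInst ?A2)) ?t) (cSat ?A2) \<longleftrightarrow>
    adj_then (deriv ?A2) (inv_adj ?t) = adj_then (dir_adj ?i) (deriv ?A1)"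
    if A1: "is_clsn ?A1" and A2: "is_clsn ?A2" and i': "?i \<in> hom B (cInst ?A2) (cInst ?A1)"
      and t': "?t \<in> hom B (cTyp ?A1) (cTyp ?A2)"
  proof -
    note s = is_clsnD[OF A1] is_clsnD[OF A2]
    have i: "?i \<in> Arr B" "Dom B ?i = cInst ?A2" "Cod B ?i = cInst ?A1" using i' by (simp_all add: hom_iff)
    have t: "?t \<in> Arr B" "Dom B ?t = cTyp ?A1" "Cod B ?t = cTyp ?A2" using t' by (simp_all add: hom_iff)
    let ?c1 = "cross ?i (Ide B (cTyp ?A1))" and ?c2 = "cross (Ide B (cInst ?A2)) ?t"
    let ?W = "Prod B (cInst ?A2) (cTyp ?A1)"
    have S: "pull ?c1 (cSat ?A1) \<in> Sub ?W" "pull ?c2 (cSat ?A2) \<in> Sub ?W"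
      using pull_Sub[of ?c1 "cSat ?A1"] pull_Sub[of ?c2 "cSat ?A2"] s i t by simp_all
    have l: "lies (pair x y) (pull ?c1 (cSat ?A1)) \<longleftrightarrow> lies (pair (?i \<cdot> x) y) (cSat ?A1)"
      "lies (pair x y) (pull ?c2 (cSat ?A2)) \<longleftrightarrow> lies (pair x (?t \<cdot> y)) (cSat ?A2)"
      if "x \<in> Arr B" "y \<in> Arr B" "Dom B x = Dom B y" "Cod B x = cInst ?A2" "Cod B y = cTyp ?A1" for x y
      using lies_pull[of ?c1 "cSat ?A1" "pair x y"] lies_pull[of ?c2 "cSat ?A2" "pair x y"] s i t that by simp_all
    have "pull ?c1 (cSat ?A1) = pull ?c2 (cSat ?A2) \<longleftrightarrow>
      (\<forall>x y. x \<in> Arr B \<longrightarrow> y \<in> Arr B \<longrightarrow> Dom B x = Dom B y \<longrightarrow> Cod B x = cInst ?A2 \<longrightarrow> Cod B y = cTyp ?A1 \<longrightarrow>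
        lies (pair (?i \<cdot> x) y) (cSat ?A1) = lies (pair x (?t \<cdot> y)) (cSat ?A2))" (is "_ \<longleftrightarrow> ?R")
    proof
      assume "pull ?c1 (cSat ?A1) = pull ?c2 (cSat ?A2)"
      then show ?R using l by simp
    next
      assume R: ?R
      show "pull ?c1 (cSat ?A1) = pull ?c2 (cSat ?A2)"
      proof (rule Sub_ext[OF S])
        fix z assume "z \<in> Arr B" "Cod B z = ?W"
        then obtain x y where z: "z = pair x y" "x \<in> Arr B" "y \<in> Arr B" "Dom B y = Dom B x"
          "Cod B x = cInst ?A2" "Cod B y = cTyp ?A1"
          using s Prod_elem_cases[of z "cInst ?A2" "cTyp ?A1"] by metis
        then show "lies z (pull ?c1 (cSat ?A1)) = lies z (pull ?c2 (cSat ?A2))"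
          using R l[of x y] by simp
      qed
    qed
    with sat_square[OF A1 A2 i t] show ?thesis by simp
  qed
  then show ?thesis unfolding is_infomorphism_def by blast
qed

lemma clg_obj:
  assumes A: "is_clsn A"
  shows is_cstruct_clg_obj: "is_cstruct (clg_obj A)"
    and concept_adj_clg_obj: "concept_adj (clg_obj A) = deriv A"
    and clg_obj_simps: "lInst (clg_obj A) = cInst A" "lTyp (clg_obj A) = cTyp A"
proof -
  note o = is_clsnD[OF A]
  have a: "antisymmetric (pwr_ord (cInst A))" "antisymmetric (opp (pwr_ord (cTyp A)))"
    using o by (simp_all add: antisymmetric_pwr_ord antisymmetric_opp)
  note d = is_adj_deriv[OF A]
  show "is_cstruct (clg_obj A)"
    unfolding is_cstruct_def clg_obj_def Let_def
    using o is_preorder_axis[OF d a] is_reflection_polar_refl[OF d a] is_coreflection_polar_corefl[OF d a] by simp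
  show "concept_adj (clg_obj A) = deriv A"
    unfolding concept_adj_def clg_obj_def Let_def using polar_factorization[OF d a] by simp
  show "lInst (clg_obj A) = cInst A" "lTyp (clg_obj A) = cTyp A"
    by (simp_all add: clg_obj_def Let_def)
qed

lemma clsn_obj_simps [simp]: "cInst (clsn_obj L) = lInst L" "cTyp (clsn_obj L) = lTyp L"
  by (simp_all add: clsn_obj_def)

text \<open>The satisfaction relation was defined by evaluating \<open>concept_adj L\<close> at
  singletons, and by \<open>deriv_unique\<close> those values determine the adjunction.\<close>

lemma clsn_obj:
  assumes L: "is_cstruct L"
  shows is_clsn_clsn_obj: "is_clsn (clsn_obj L)"
    and deriv_clsn_obj: "deriv (clsn_obj L) = concept_adj L"
proof -
  note l = is_cstructD[OF L]
  let ?h = "lft (concept_adj L) \<cdot> singleton (lInst L)"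
  have s: "lft (concept_adj L) \<in> Arr B" "Dom B (lft (concept_adj L)) = Pwr B (lInst L)"
    "Cod B (lft (concept_adj L)) = Pwr B (lTyp L)"
    using is_adj_simps[OF l(8)] by simp_all
  have sat: "cSat (clsn_obj L) = rel (lTyp L) ?h" unfolding clsn_obj_def concept_adj_def by simp
  show A: "is_clsn (clsn_obj L)"
    using rel_Sub[of ?h "lTyp L"] s l by (simp add: is_clsn_def sat)
  have "concept_adj L = deriv (clsn_obj L)"
    by (rule deriv_unique[OF A]) (use l s lies_rel[of ?h "lTyp L"] sat in simp_all)
  then show "deriv (clsn_obj L) = concept_adj L" by simp
qed

text \<open>Both classifications have the same derivation adjunction, and its values at singletons
  recover satisfaction. Equality is strict because a relation is a full equivalence class of
  monomorphisms.\<close>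

lemma clsn_clg_obj:
  assumes A: "is_clsn A"
  shows "clsn_obj (clg_obj A) = A"
proof -
  note o = is_clsnD[OF A] and c = is_clsn_clsn_obj[OF is_cstruct_clg_obj[OF A]]
  have d: "deriv (clsn_obj (clg_obj A)) = deriv A"
    using deriv_clsn_obj[OF is_cstruct_clg_obj[OF A]] concept_adj_clg_obj[OF A] by simp
  have i: "cInst (clsn_obj (clg_obj A)) = cInst A" "cTyp (clsn_obj (clg_obj A)) = cTyp A"
    using clg_obj_simps[OF A] by simp_all
  have "cSat (clsn_obj (clg_obj A)) = cSat A"
  proof (rule Sub_ext)
    show "cSat (clsn_obj (clg_obj A)) \<in> Sub (Prod B (cInst A) (cTyp A))" using is_clsnD(3)[OF c] i by simp
    fix z assume "z \<in> Arr B" "Cod B z = Prod B (cInst A) (cTyp A)"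
    then obtain x y where z: "z = pair x y" "x \<in> Arr B" "y \<in> Arr B" "Dom B y = Dom B x"
      "Cod B x = cInst A" "Cod B y = cTyp A"
      using o Prod_elem_cases[of z "cInst A" "cTyp A"] by metis
    then show "lies z (cSat (clsn_obj (clg_obj A))) = lies z (cSat A)"
      using mem_deriv_singleton[OF A, of x y] mem_deriv_singleton[OF c, of x y] d i by simp
  qed (rule o(3))
  with i show ?thesis by simp
qed

section \<open>The categories of classifications and of conceptual structures\<close>

lemma Clsn_simps [simp]:
  "A \<in> Obj Clsn \<longleftrightarrow> is_clsn A" "f \<in> Arr Clsn \<longleftrightarrow> is_infomorphism f" "Dom Clsn f = iSrc f" "Cod Clsn f = iTrg f"
  "Ide Clsn A = \<lparr>iSrc = A, iTrg = A, iInst = Ide B (cInst A), iTyp = Ide B (cTyp A)\<rparr>"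
  "Cmp Clsn g f = \<lparr>iSrc = iSrc f, iTrg = iTrg g, iInst = iInst f \<cdot> iInst g, iTyp = iTyp g \<cdot> iTyp f\<rparr>"
  "f \<in> hom Clsn A A' \<longleftrightarrow> is_infomorphism f \<and> iSrc f = A \<and> iTrg f = A'"
  by (auto simp: Clsn_def hom_def)

lemma Clg_simps [simp]:
  "L \<in> Obj Clg \<longleftrightarrow> is_cstruct L" "h \<in> Arr Clg \<longleftrightarrow> is_cmorphism h" "Dom Clg h = mSrc h" "Cod Clg h = mTrg h"
  "Ide Clg L = \<lparr>mSrc = L, mTrg = L, mAdj = adj_id (lOrd L), mInst = Ide B (lInst L), mTyp = Ide B (lTyp L)\<rparr>"
  "Cmp Clg k h = \<lparr>mSrc = mSrc h, mTrg = mTrg k, mAdj = adj_then (mAdj k) (mAdj h),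
     mInst = mInst h \<cdot> mInst k, mTyp = mTyp k \<cdot> mTyp h\<rparr>"
  "h \<in> hom Clg L L' \<longleftrightarrow> is_cmorphism h \<and> mSrc h = L \<and> mTrg h = L'"
  by (auto simp: Clg_def hom_def)

lemma infomorphismD:
  assumes "is_infomorphism f"
  shows "is_clsn (iSrc f)" "is_clsn (iTrg f)"
    "iInst f \<in> Arr B" "Dom B (iInst f) = cInst (iTrg f)" "Cod B (iInst f) = cInst (iSrc f)"
    "iTyp f \<in> Arr B" "Dom B (iTyp f) = cTyp (iSrc f)" "Cod B (iTyp f) = cTyp (iTrg f)"
    "adj_then (deriv (iTrg f)) (inv_adj (iTyp f)) = adj_then (dir_adj (iInst f)) (deriv (iSrc f))"
  using assms by (simp_all add: is_infomorphism_iff hom_iff)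

lemma cmorphismD:
  assumes "is_cmorphism h"
  shows "is_cstruct (mSrc h)" "is_cstruct (mTrg h)" "is_adj (lOrd (mTrg h)) (lOrd (mSrc h)) (mAdj h)"
    "mInst h \<in> Arr B" "Dom B (mInst h) = lInst (mTrg h)" "Cod B (mInst h) = lInst (mSrc h)"
    "mTyp h \<in> Arr B" "Dom B (mTyp h) = lTyp (mSrc h)" "Cod B (mTyp h) = lTyp (mTrg h)"
    "adj_then (extent (mTrg h)) (mAdj h) = adj_then (dir_adj (mInst h)) (extent (mSrc h))"
    "adj_then (mAdj h) (intent (mSrc h)) = adj_then (intent (mTrg h)) (inv_adj (mTyp h))"
  using assms by (simp_all add: is_cmorphism_def hom_iff)

lemma dir_adj_then:
  assumes "f \<in> Arr B" "g \<in> Arr B" "Dom B g = Cod B f" "is_adj (pwr_ord (Cod B g)) P a"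
  shows "adj_then (dir_adj (g \<cdot> f)) a = adj_then (dir_adj f) (adj_then (dir_adj g) a)"
proof -
  have "is_adj (pwr_ord (Dom B f)) (pwr_ord (Dom B g)) (dir_adj f)"
    using is_adj_dir[OF assms(1)] assms(3) by simp
  from adj_then_assoc[OF this is_adj_dir[OF assms(2)] assms(4)] show ?thesis
    using dir_adj_Cmp[OF assms(1-3)] by simp
qed

lemma then_inv_adj:
  assumes "f \<in> Arr B" "g \<in> Arr B" "Dom B g = Cod B f" "is_adj P (opp (pwr_ord (Cod B g))) a"
  shows "adj_then a (inv_adj (g \<cdot> f)) = adj_then (adj_then a (inv_adj g)) (inv_adj f)"
proof -
  have "is_adj (opp (pwr_ord (Dom B g))) (opp (pwr_ord (Dom B f))) (inv_adj f)"
    using is_adj_inv[OF assms(1)] assms(3) by simp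
  from adj_then_assoc[OF assms(4) is_adj_inv[OF assms(2)] this] show ?thesis
    using inv_adj_Cmp[OF assms(1-3)] by simp
qed

lemma is_infomorphism_Ide:
  assumes A: "is_clsn A"
  shows "is_infomorphism (Ide Clsn A)"
proof -
  note o = is_clsnD[OF A]
  from adj_then_id[OF is_adj_deriv[OF A]] show ?thesis
    unfolding is_infomorphism_iff using o A
    by (simp add: hom_iff dir_adj_Ide inv_adj_Ide del: adj_then_simps)
qed

text \<open>Pasting of two commuting squares of derivation adjunctions, with \<open>dir_adj\<close>
  and \<open>inv_adj\<close> turning composites of arrows into composites of adjunctions.\<close>

lemma is_infomorphism_Cmp:
  assumes f: "is_infomorphism f" and g: "is_infomorphism g" and fg: "iSrc g = iTrg f"
  shows "is_infomorphism (Cmp Clsn g f)"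
proof -
  note f' = infomorphismD[OF f] and g' = infomorphismD[OF g]
  note d1 = is_adj_deriv[OF f'(1)] and d2 = is_adj_deriv[OF f'(2)] and d3 = is_adj_deriv[OF g'(2)]
  have di: "is_adj (pwr_ord (cInst (iTrg g))) (pwr_ord (cInst (iTrg f))) (dir_adj (iInst g))"
    using is_adj_dir[OF g'(3)] g' fg by simp
  have it: "is_adj (opp (pwr_ord (cTyp (iTrg f)))) (opp (pwr_ord (cTyp (iSrc f)))) (inv_adj (iTyp f))"
    using is_adj_inv[OF f'(6)] f' by simp
  have "adj_then (deriv (iTrg g)) (inv_adj (iTyp g \<cdot> iTyp f))
      = adj_then (adj_then (deriv (iTrg g)) (inv_adj (iTyp g))) (inv_adj (iTyp f))"
    using f' g' fg d3 by (intro then_inv_adj) simp_all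
  also have "\<dots> = adj_then (dir_adj (iInst g)) (adj_then (deriv (iTrg f)) (inv_adj (iTyp f)))"
    using g'(9) adj_then_assoc[OF di d2 it] fg by (simp del: adj_then_simps)
  also have "\<dots> = adj_then (dir_adj (iInst g)) (adj_then (dir_adj (iInst f)) (deriv (iSrc f)))"
    using f'(9) by simp
  also have "\<dots> = adj_then (dir_adj (iInst f \<cdot> iInst g)) (deriv (iSrc f))"
    using f' g' fg d1 by (intro dir_adj_then[symmetric]) simp_all
  finally show ?thesis
    unfolding is_infomorphism_iff using f' g' fg by (simp add: hom_iff del: adj_then_simps)
qed

lemma category_Clsn: "category Clsn"
proof
  show "Cmp Clsn g f \<in> hom Clsn X Z" if "f \<in> hom Clsn X Y" "g \<in> hom Clsn Y Z" for f g X Y Z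
    using that is_infomorphism_Cmp[of f g] by simp
  show "Ide Clsn X \<in> hom Clsn X X" if "X \<in> Obj Clsn" for X
    using that is_infomorphism_Ide[of X] by simp
qed (auto dest: infomorphismD simp: infomorphismD)

lemma is_cmorphism_Ide:
  assumes L: "is_cstruct L"
  shows "is_cmorphism (Ide Clg L)"
proof -
  note l = is_cstructD[OF L]
  from adj_then_id[OF l(6)] adj_then_id[OF l(7)] is_adj_id[OF l(1)] show ?thesis
    unfolding is_cmorphism_def using l L
    by (simp add: hom_iff dir_adj_Ide inv_adj_Ide del: adj_then_simps)
qed

text \<open>The extent squares and the intent squares are pasted separately, the former over direct
  images along instance morphisms, the latter over inverse images along type morphisms.\<close>

lemma is_cmorphism_Cmp:
  assumes h: "is_cmorphism h" and k: "is_cmorphism k" and hk: "mSrc k = mTrg h"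
  shows "is_cmorphism (Cmp Clg k h)"
proof -
  note h' = cmorphismD[OF h] and k' = cmorphismD[OF k]
  note l1 = is_cstructD[OF h'(1)] and l2 = is_cstructD[OF h'(2)] and l3 = is_cstructD[OF k'(2)]
  have ka: "is_adj (lOrd (mTrg k)) (lOrd (mTrg h)) (mAdj k)" using k'(3) hk by simp
  have di: "is_adj (pwr_ord (lInst (mTrg k))) (pwr_ord (lInst (mTrg h))) (dir_adj (mInst k))"
    using is_adj_dir[OF k'(4)] k' hk by simp
  have it: "is_adj (opp (pwr_ord (lTyp (mTrg h)))) (opp (pwr_ord (lTyp (mSrc h)))) (inv_adj (mTyp h))"
    using is_adj_inv[OF h'(7)] h' by simp
  have "adj_then (extent (mTrg k)) (adj_then (mAdj k) (mAdj h)) = adj_then (adj_then (dir_adj (mInst k)) (extent (mTrg h))) (mAdj h)"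
    using adj_then_assoc[OF l3(6) ka h'(3)] k'(10) hk by (simp del: adj_then_simps)
  also have "\<dots> = adj_then (dir_adj (mInst k)) (adj_then (dir_adj (mInst h)) (extent (mSrc h)))"
    using adj_then_assoc[OF di l2(6) h'(3)] h'(10) by (simp del: adj_then_simps)
  also have "\<dots> = adj_then (dir_adj (mInst h \<cdot> mInst k)) (extent (mSrc h))"
    using h' k' hk l1(6) by (intro dir_adj_then[symmetric]) simp_all
  finally have ext: "adj_then (extent (mTrg k)) (adj_then (mAdj k) (mAdj h)) = adj_then (dir_adj (mInst h \<cdot> mInst k)) (extent (mSrc h))" .
  have "adj_then (adj_then (mAdj k) (mAdj h)) (intent (mSrc h)) = adj_then (mAdj k) (adj_then (intent (mTrg h)) (inv_adj (mTyp h)))"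
    using adj_then_assoc[OF ka h'(3) l1(7)] h'(11) by (simp del: adj_then_simps)
  also have "\<dots> = adj_then (adj_then (intent (mTrg k)) (inv_adj (mTyp k))) (inv_adj (mTyp h))"
    using adj_then_assoc[OF ka l2(7) it] k'(11) hk by (simp del: adj_then_simps)
  also have "\<dots> = adj_then (intent (mTrg k)) (inv_adj (mTyp k \<cdot> mTyp h))"
    using h' k' hk l3(7) by (intro then_inv_adj[symmetric]) simp_all
  finally show ?thesis
    unfolding is_cmorphism_def using ext h' k' hk is_adj_then[OF ka h'(3)] by (simp add: hom_iff del: adj_then_simps)
qed

lemma category_Clg: "category Clg"
proof
  show Cmp: "Cmp Clg g f \<in> hom Clg X Z" if "f \<in> hom Clg X Y" "g \<in> hom Clg Y Z" for f g X Y Z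
    using that is_cmorphism_Cmp[of f g] by simp
  show Ide: "Ide Clg X \<in> hom Clg X X" if "X \<in> Obj Clg" for X
    using that is_cmorphism_Ide[of X] by simp
  \<comment> \<open>By \<open>cmorphism_eqI\<close> this law and the next two reduce to unit and
    associativity laws in \<open>B\<close>.\<close>
  show "Cmp Clg (Ide Clg Y) f = f" if f: "f \<in> hom Clg X Y" for f X Y
    by (rule cmorphism_eqI) (use f Cmp[OF f Ide[of Y]] cmorphismD[of f] in auto)
  show "Cmp Clg f (Ide Clg X) = f" if f: "f \<in> hom Clg X Y" for f X Y
    by (rule cmorphism_eqI) (use f Cmp[OF Ide[of X] f] cmorphismD[of f] in auto)
  show "Cmp Clg (Cmp Clg h g) f = Cmp Clg h (Cmp Clg g f)"
    if f: "f \<in> hom Clg W X" and g: "g \<in> hom Clg X Y" and h: "h \<in> hom Clg Y Z" for f g h W X Y Z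
    by (rule cmorphism_eqI)
      (use f g h Cmp[OF f Cmp[OF g h]] Cmp[OF Cmp[OF f g] h] cmorphismD[of f] cmorphismD[of g] cmorphismD[of h] in auto)
qed (auto dest: cmorphismD)

section \<open>The concept lattice functor and the classification functor\<close>

lemma clg_arr:
  assumes f: "is_infomorphism f"
  shows is_cmorphism_clg_arr: "is_cmorphism (clg_arr f)"
    and clg_arr_simps: "mSrc (clg_arr f) = clg_obj (iSrc f)" "mTrg (clg_arr f) = clg_obj (iTrg f)"
      "mInst (clg_arr f) = iInst f" "mTyp (clg_arr f) = iTyp f"
proof -
  note f' = infomorphismD[OF f]
  have e: "clg_arr f = fill_in (clg_obj (iSrc f)) (clg_obj (iTrg f)) (iInst f) (iTyp f)"
    by (simp add: clg_arr_def fill_in_def Let_def)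
  show "is_cmorphism (clg_arr f)"
    unfolding e by (rule is_cmorphism_fill_in)
      (use f' clg_obj[OF f'(1)] clg_obj[OF f'(2)] in \<open>simp_all del: adj_then_simps\<close>)
  show "mSrc (clg_arr f) = clg_obj (iSrc f)" "mTrg (clg_arr f) = clg_obj (iTrg f)"
    "mInst (clg_arr f) = iInst f" "mTyp (clg_arr f) = iTyp f"
    by (simp_all add: e fill_in_def)
qed

lemma is_functor_clg: "is_functor Clsn Clg clg_functor"
proof -
  \<comment> \<open>Here and for composites, both sides are concept morphisms over the same instance
    and type morphisms, so they agree without any computation of diagonals.\<close>
  have Ide: "clg_arr (Ide Clsn A) = Ide Clg (clg_obj A)" if A: "is_clsn A" for A
    using clg_arr[OF is_infomorphism_Ide[OF A]] is_cmorphism_Ide[OF is_cstruct_clg_obj[OF A]] clg_obj_simps[OF A]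
    by (intro cmorphism_eqI) simp_all
  have Cmp: "clg_arr (Cmp Clsn g f) = Cmp Clg (clg_arr g) (clg_arr f)"
    if f: "is_infomorphism f" and g: "is_infomorphism g" and fg: "iSrc g = iTrg f" for f g
    using clg_arr[OF is_infomorphism_Cmp[OF f g fg]] clg_arr[OF f] clg_arr[OF g]
      is_cmorphism_Cmp[of "clg_arr f" "clg_arr g"] fg
    by (intro cmorphism_eqI) simp_all
  show ?thesis
    unfolding is_functor_def clg_functor_def fctr.simps
  proof (intro conjI ballI impI category_Clsn category_Clg)
    fix A assume A: "A \<in> Obj Clsn"
    then show "clg_obj A \<in> Obj Clg" "clg_arr (Ide Clsn A) = Ide Clg (clg_obj A)"
      using is_cstruct_clg_obj Ide by (simp_all del: Clsn_simps(5) Clg_simps(5))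
  next
    fix f assume "f \<in> Arr Clsn"
    then show "clg_arr f \<in> hom Clg (clg_obj (Dom Clsn f)) (clg_obj (Cod Clsn f))" using clg_arr by simp
  next
    fix f g assume "f \<in> Arr Clsn" "g \<in> Arr Clsn" "Dom Clsn g = Cod Clsn f"
    then show "clg_arr (Cmp Clsn g f) = Cmp Clg (clg_arr g) (clg_arr f)"
      using Cmp by (simp del: Clsn_simps(6) Clg_simps(6))
  qed
qed

lemma is_infomorphism_clsn_arr:
  assumes h: "is_cmorphism h"
  shows "is_infomorphism (clsn_arr h)"
proof -
  note h' = cmorphismD[OF h]
  note c1 = clsn_obj[OF h'(1)] and c2 = clsn_obj[OF h'(2)]
  show ?thesis
    unfolding is_infomorphism_iff clsn_arr_def
    using h' c1 c2 cmorphism_square[OF h] by (simp add: hom_iff del: adj_then_simps)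
qed

lemma is_functor_clsn: "is_functor Clg Clsn clsn_functor"
  unfolding is_functor_def clsn_functor_def
  by (auto simp: category_Clsn category_Clg is_clsn_clsn_obj is_infomorphism_clsn_arr)
    (simp_all add: clsn_arr_def)

section \<open>Unit and counit of the equivalence\<close>

lemma unit_iso: "natural_iso Clsn Clsn id_fctr (comp_fctr clsn_functor clg_functor) (Ide Clsn)"
proof -
  interpret Clsn: category Clsn by (rule category_Clsn)
  \<comment> \<open>Since the round trip also fixes arrows, identities can serve as components, and
    naturality becomes the unit law.\<close>
  have a: "clsn_arr (clg_arr f) = f" if f: "is_infomorphism f" for f
    using clg_arr_simps[OF f] clsn_clg_obj[OF infomorphismD(1)[OF f]] clsn_clg_obj[OF infomorphismD(2)[OF f]]
    by (simp add: clsn_arr_def)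
  have id: "is_iso Clsn (Ide Clsn A) \<and> Ide Clsn A \<in> hom Clsn A A" if A: "A \<in> Obj Clsn" for A
    using Clsn.Ide_simps[OF A] Clsn.Ide_hom[OF A] Clsn.Cmp_Ide(1)[OF Clsn.Ide_simps(1)[OF A]]
    unfolding is_iso_def by metis
  show ?thesis
    unfolding natural_iso_def
  proof (intro conjI ballI)
    fix A assume A: "A \<in> Obj Clsn"
    then have "clsn_obj (clg_obj A) = A" using clsn_clg_obj by simp
    with id[OF A] show "Ide Clsn A \<in> hom Clsn (onObj id_fctr A) (onObj (comp_fctr clsn_functor clg_functor) A)"
      "is_iso Clsn (Ide Clsn A)"
      by (simp_all add: id_fctr_def comp_fctr_def clsn_functor_def clg_functor_def del: Clsn_simps)
  next
    fix f assume f: "f \<in> Arr Clsn"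
    then have "clsn_arr (clg_arr f) = f" using a by simp
    with f show "Cmp Clsn (Ide Clsn (Cod Clsn f)) (onArr id_fctr f) =
      Cmp Clsn (onArr (comp_fctr clsn_functor clg_functor) f) (Ide Clsn (Dom Clsn f))"
      by (simp add: id_fctr_def comp_fctr_def clsn_functor_def clg_functor_def del: Clsn_simps)
  qed
qed

text \<open>A form of the essential uniqueness of reflection-coreflection factorizations: two
  structures that factor the same adjunction are compared by a diagonal over identities. The
  hypotheses are symmetric, so a comparison exists in each direction.\<close>

lemma identity_fill_in:
  assumes L: "is_cstruct L" and L': "is_cstruct L'" and eq: "lInst L' = lInst L" "lTyp L' = lTyp L"
    "concept_adj L' = concept_adj L"
  shows "is_cmorphism (fill_in L L' (Ide B (lInst L)) (Ide B (lTyp L)))"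
proof -
  note l = is_cstructD[OF L]
  from adj_then_id[OF l(8)] l eq show ?thesis
    by (intro is_cmorphism_fill_in L L') (simp_all add: dir_adj_Ide inv_adj_Ide del: adj_then_simps)
qed

lemma fill_in_simps [simp]:
  "mSrc (fill_in L1 L2 i t) = L1" "mTrg (fill_in L1 L2 i t) = L2" "mInst (fill_in L1 L2 i t) = i" "mTyp (fill_in L1 L2 i t) = t"
  by (simp_all add: fill_in_def)

text \<open>\<open>L\<close> and \<open>clg_obj (clsn_obj L)\<close> factor the same adjunction, by
  \<open>deriv_clsn_obj\<close> and \<open>concept_adj_clg_obj\<close>. The comparisons in the two
  directions are mutually inverse, and natural, because the composites involved agree on instances
  and types.\<close>

lemma counit_iso:
  "natural_iso Clg Clg (comp_fctr clg_functor clsn_functor) id_fctr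
     (\<lambda>L. fill_in (clg_obj (clsn_obj L)) L (Ide B (lInst L)) (Ide B (lTyp L)))"
proof -
  let ?F = "\<lambda>L. clg_obj (clsn_obj L)"
  let ?\<epsilon> = "\<lambda>L. fill_in (?F L) L (Ide B (lInst L)) (Ide B (lTyp L))"
  let ?\<delta> = "\<lambda>L. fill_in L (?F L) (Ide B (lInst L)) (Ide B (lTyp L))"
  have F: "is_cstruct (?F L)" "lInst (?F L) = lInst L" "lTyp (?F L) = lTyp L" "concept_adj (?F L) = concept_adj L"
    if L: "is_cstruct L" for L
    using clg_obj[OF is_clsn_clsn_obj[OF L]] deriv_clsn_obj[OF L] by simp_all
  have \<epsilon>: "is_cmorphism (?\<epsilon> L)" and \<delta>: "is_cmorphism (?\<delta> L)" if L: "is_cstruct L" for L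
    using identity_fill_in[OF F(1)[OF L] L] identity_fill_in[OF L F(1)[OF L]] F(2-)[OF L] by simp_all
  have "Cmp Clg (?\<delta> L) (?\<epsilon> L) = Ide Clg (?F L)" if L: "is_cstruct L" for L
    by (rule cmorphism_eqI[OF is_cmorphism_Cmp[OF \<epsilon>[OF L] \<delta>[OF L]] is_cmorphism_Ide[OF F(1)[OF L]]])
      (use F[OF L] is_cstructD(2,3)[OF L] in simp_all)
  moreover have "Cmp Clg (?\<epsilon> L) (?\<delta> L) = Ide Clg L" if L: "is_cstruct L" for L
    by (rule cmorphism_eqI[OF is_cmorphism_Cmp[OF \<delta>[OF L] \<epsilon>[OF L]] is_cmorphism_Ide[OF L]])
      (use F[OF L] is_cstructD(2,3)[OF L] in simp_all)
  ultimately have iso: "is_iso Clg (?\<epsilon> L)" if L: "is_cstruct L" for L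
    unfolding is_iso_def using L \<epsilon>[OF L] \<delta>[OF L] by (auto simp del: Clg_simps(5,6) intro!: bexI[of _ "?\<delta> L"])
  have nat: "Cmp Clg (?\<epsilon> (mTrg h)) (clg_arr (clsn_arr h)) = Cmp Clg h (?\<epsilon> (mSrc h))" if h: "is_cmorphism h" for h
  proof -
    note h' = cmorphismD[OF h]
    have c: "iSrc (clsn_arr h) = clsn_obj (mSrc h)" "iTrg (clsn_arr h) = clsn_obj (mTrg h)"
      "iInst (clsn_arr h) = mInst h" "iTyp (clsn_arr h) = mTyp h" by (simp_all add: clsn_arr_def)
    note k = clg_arr[OF is_infomorphism_clsn_arr[OF h]]
    show ?thesis
      using is_cmorphism_Cmp[OF k(1) \<epsilon>[OF h'(2)]] is_cmorphism_Cmp[OF \<epsilon>[OF h'(1)] h] k c h'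
      by (intro cmorphism_eqI) simp_all
  qed
  show ?thesis
    unfolding natural_iso_def
  proof (intro conjI ballI)
    fix L assume "L \<in> Obj Clg"
    then show "?\<epsilon> L \<in> hom Clg (onObj (comp_fctr clg_functor clsn_functor) L) (onObj id_fctr L)" "is_iso Clg (?\<epsilon> L)"
      using \<epsilon> iso by (simp_all add: id_fctr_def comp_fctr_def clsn_functor_def clg_functor_def)
  next
    fix h assume "h \<in> Arr Clg"
    then show "Cmp Clg (?\<epsilon> (Cod Clg h)) (onArr (comp_fctr clg_functor clsn_functor) h) = Cmp Clg (onArr id_fctr h) (?\<epsilon> (Dom Clg h))"
      using nat by (simp add: id_fctr_def comp_fctr_def clsn_functor_def clg_functor_def del: Clg_simps(5,6))
  qed
qed

end

theorem theorem3:
  fixes B :: "('o, 'm) topos_data"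
  assumes "topos B"
  shows "is_equivalence (topos.Clsn B) (topos.Clg B) (topos.clg_functor B) (topos.clsn_functor B)"
proof -
  interpret topos B by (rule assms)
  show ?thesis
    unfolding is_equivalence_def using is_functor_clg is_functor_clsn unit_iso counit_iso by blast
qed

end
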